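(* Let $\Lambda$ be a lattice in $\mathbb{R}^{2d}$ and $v$ a GRS-weight that is not constant on $\mathbb{R}^d$ and not constant on $\widehat{\mathbb{R}}^d$. Then there exist $n\in\mathbb{N}$ and $g_1,\dots,g_n\in\mathscr{S}_v(\mathbb{R}^d)$ such that $\mathcal{G}(g_1,\dots,g_n;\Lambda)$ is a multi-window Gabor frame for the class of modulation spaces $M^{p,q}_m(\mathbb{R}^d)$, $p,q\in[1,\infty]$, for any $v$-moderate weight $m$.
   Context: Time-frequency shifts: for $x,\omega\in\mathbb{R}^d$, $T_xf(t)=f(t-x)$, $M_\omega f(t)=e^{2\pi i\omega\cdot t}f(t)$, $\pi(x,\omega)=M_\omega T_x$. $\langle f,g\rangle=\int f\overline{g}$. $\mathbb{R}^{2d}=\mathbb{R}^d\times\widehat{\mathbb{R}}^d$. A lattice in $\mathbb{R}^{2d}$ is a discrete cocompact subgroup. A weight $v$ is a measurable $v:\mathbb{R}^{2d}\to[0,\infty)$ with $v(z+w)\le v(z)v(w)$, $v(z)\ge1$, $v(-z)=v(z)$ for all $z,w$. It is a GRS-weight if $\lim_{n\to\infty}v(n\lambda)^{1/n}=1$ for all $\lambda\in\Lambda$. A measurable function $m:\mathbb{R}^{2d}\to(0,\infty)$ is a $v$-moderate weight if there is $C>0$ with $m(z+w)\le Cv(z)m(w)$ for all $z,w\in\mathbb{R}^{2d}$. $M^1_v(\mathbb{R}^d)=\{f\in L^2(\mathbb{R}^d):\int_{\mathbb{R}^{2d}}|\langle f,\pi(z)\varphi\rangle|v(z)\,dz<\infty\}$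 with $\varphi(t)=e^{-\pi t\cdot t}$, normed by this integral; $\mathscr{S}_v(\mathbb{R}^d)=\bigcap_{s\ge0}M^1_{v^s}(\mathbb{R}^d)$. Modulation spaces: for a fixed non-zero $g\in M^1_v(\mathbb{R}^d)$ put $V_gf(x,\omega)=\langle f,\pi(x,\omega)g\rangle$; $M^{p,q}_m(\mathbb{R}^d)$ is the space of $f$ in the space of bounded conjugate-linear functionals on $M^1_v(\mathbb{R}^d)$ with $\|f\|_{M^{p,q}_m}=\big(\int_{\mathbb{R}^d}(\int_{\mathbb{R}^d}|V_gf(x,\omega)|^pm(x,\omega)^p\,dx)^{q/p}d\omega\big)^{1/q}<\infty$ (usual modification if $p$ or $q$ is $\infty$); different $g$ give the same space with equivalent norms. $L^{p,q}_m(\mathbb{R}^{2d})$ is the corresponding weighted mixed-norm space. $\mathcal{G}(g_1,\dots,g_n;\Lambda)=\{\pi(\lambda)g_i:\lambda\in\Lambda,1\le i\le n\}$. It is a multi-window Gabor frame for $M^{p,q}_m(\mathbb{R}^d)$ if it is a Banach frame for it: with $Q$ a relatively compact measurable fundamental domain of $\Lambda$ and $Y$ the space of $(a_i(\lambda))_{i,\lambda}$ with norm $\sum_{i=1}^n\big\|\sum_{\lambda\in\Lambda}|a_i(\lambda)|\mathbf{1}_{\lambda+Q}\big\|_{L^{p,q}_m}<\infty$, there exist $A,B>0$ with $A\|f\|_{M^{p,q}_m}\le\|(\langle f,\pi(\lambda)g_i\rangle)_{i,\lambda}\|_Y\le B\|f\|_{M^{p,q}_m}$ for all $f\in M^{p,q}_m(\mathbb{R}^d)$,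 and there is a bounded linear operator $R:Y\to M^{p,q}_m(\mathbb{R}^d)$ with $R\big((\langle f,\pi(\lambda)g_i\rangle)_{i,\lambda}\big)=f$ for all $f\in M^{p,q}_m(\mathbb{R}^d)$. *)

theory Defs
  imports "HOL-Probability.Probability"
begin

section \<open>The time-frequency plane, lattices and weights\<close>

text \<open>Points \<open>z = (x, \<omega>)\<close>; the dual group of \<open>\<real>\<^sup>d\<close> is identified with \<open>\<real>\<^sup>d\<close> via
  \<open>\<omega> \<mapsto> (t \<mapsto> exp (2 \<pi> \<i> \<omega> \<bullet> t))\<close>. Functions and weights are measurable with respect to
  \<^const>\<open>lebesgue\<close>.\<close>

type_synonym 'd tfplane = "(real^'d) \<times> (real^'d)"

definition is_lattice :: "'d::finite tfplane set \<Rightarrow> bool" where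
  "is_lattice \<Lambda> \<longleftrightarrow>
     0 \<in> \<Lambda> \<and> (\<forall>z\<in>\<Lambda>. \<forall>w\<in>\<Lambda>. z + w \<in> \<Lambda>) \<and> (\<forall>z\<in>\<Lambda>. - z \<in> \<Lambda>) \<and>
     (\<forall>l\<in>\<Lambda>. l isolated_in \<Lambda>) \<and>
     (\<exists>X. quotient_map euclidean X (\<lambda>z. (+) z ` \<Lambda>) \<and> compact_space X)"

text \<open>Exact tiling: every point lies in exactly one translate of \<open>Q\<close> by \<open>\<Lambda>\<close>.\<close>

definition fundamental_domain :: "'d::finite tfplane set \<Rightarrow> 'd tfplane set \<Rightarrow> bool" where
  "fundamental_domain \<Lambda> Q \<longleftrightarrow>
     Q \<in> sets lebesgue \<and> compact (closure Q) \<and> (\<forall>z. \<exists>!l. l \<in> \<Lambda> \<and> z \<in> (+) l ` Q)"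

definition is_weight :: "('d::finite tfplane \<Rightarrow> real) \<Rightarrow> bool" where
  "is_weight v \<longleftrightarrow> v \<in> borel_measurable lebesgue \<and>
     (\<forall>z w. v (z + w) \<le> v z * v w) \<and> (\<forall>z. 1 \<le> v z) \<and> (\<forall>z. v (- z) = v z)"

definition GRS_weight :: "'d::finite tfplane set \<Rightarrow> ('d tfplane \<Rightarrow> real) \<Rightarrow> bool" where
  "GRS_weight \<Lambda> v \<longleftrightarrow> is_weight v \<and>
     (\<forall>l\<in>\<Lambda>. (\<lambda>n. v (real n *\<^sub>R l) powr (1 / real n)) \<longlonglongrightarrow> 1)"

definition moderate_weight :: "('d::finite tfplane \<Rightarrow> real) \<Rightarrow> ('d tfplane \<Rightarrow> real) \<Rightarrow> bool" where
  "moderate_weight v m \<longleftrightarrow> m \<in> borel_measurable lebesgue \<and> (\<forall>z. 0 < m z) \<and>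
     (\<exists>C>0. \<forall>z w. m (z + w) \<le> C * v z * m w)"

section \<open>Time-frequency shifts and \<open>M\<^sup>1\<^sub>v\<close>\<close>

definition translation :: "real^'d::finite \<Rightarrow> (real^'d \<Rightarrow> complex) \<Rightarrow> (real^'d \<Rightarrow> complex)" where
  "translation x f = (\<lambda>t. f (t - x))"

definition modulation :: "real^'d::finite \<Rightarrow> (real^'d \<Rightarrow> complex) \<Rightarrow> (real^'d \<Rightarrow> complex)" where
  "modulation \<omega> f = (\<lambda>t. exp (2 * of_real pi * \<i> * of_real (\<omega> \<bullet> t)) * f t)"

definition tf_shift :: "'d::finite tfplane \<Rightarrow> (real^'d \<Rightarrow> complex) \<Rightarrow> (real^'d \<Rightarrow> complex)" where
  "tf_shift z f = modulation (snd z) (translation (fst z) f)"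

text \<open>Elements of \<open>L\<^sup>2\<close> and \<open>M\<^sup>1\<^sub>v\<close> are represented by functions, not by classes modulo
  almost everywhere equality.\<close>

definition L2_space :: "(real^'d::finite \<Rightarrow> complex) set" where
  "L2_space = {f \<in> borel_measurable lebesgue. integrable lebesgue (\<lambda>t. (cmod (f t))\<^sup>2)}"

definition L2_inner :: "(real^'d::finite \<Rightarrow> complex) \<Rightarrow> (real^'d \<Rightarrow> complex) \<Rightarrow> complex" where
  "L2_inner f g = (LINT t|lebesgue. f t * cnj (g t))"

definition gaussian :: "real^'d::finite \<Rightarrow> complex" where
  "gaussian t = of_real (exp (- pi * (t \<bullet> t)))"

definition M1_norm :: "('d::finite tfplane \<Rightarrow> real) \<Rightarrow> (real^'d \<Rightarrow> complex) \<Rightarrow> ennreal" where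
  "M1_norm v f = (\<integral>\<^sup>+ z. ennreal (cmod (L2_inner f (tf_shift z gaussian)) * v z) \<partial>lebesgue)"

definition M1_space :: "('d::finite tfplane \<Rightarrow> real) \<Rightarrow> (real^'d \<Rightarrow> complex) set" where
  "M1_space v = {f \<in> L2_space. M1_norm v f < \<infinity>}"

definition S_space :: "('d::finite tfplane \<Rightarrow> real) \<Rightarrow> (real^'d \<Rightarrow> complex) set" where
  "S_space v = (\<Inter>s\<in>{0::real..}. M1_space (\<lambda>z. v z powr s))"

section \<open>Weighted mixed norms\<close>

text \<open>Only used for \<open>r > 0\<close>.\<close>

definition enn_powr :: "ennreal \<Rightarrow> real \<Rightarrow> ennreal" where
  "enn_powr a r = (if a = \<infinity> then \<infinity> else ennreal (enn2real a powr r))"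

definition Lp_norm :: "ennreal \<Rightarrow> 'a measure \<Rightarrow> ('a \<Rightarrow> ennreal) \<Rightarrow> ennreal" where
  "Lp_norm p M f =
     (if p = \<infinity> then esssup M f
      else enn_powr (\<integral>\<^sup>+ t. enn_powr (f t) (enn2real p) \<partial>M) (1 / enn2real p))"

text \<open>The norm of \<open>L\<^sup>p\<^sup>,\<^sup>q\<^sub>m\<close>, applied to the modulus \<open>F\<close> of a function; the inner norm is over
  the time variable, the outer one over the frequency variable.\<close>

definition mixed_norm ::
  "ennreal \<Rightarrow> ennreal \<Rightarrow> ('d::finite tfplane \<Rightarrow> real) \<Rightarrow> ('d tfplane \<Rightarrow> ennreal) \<Rightarrow> ennreal" where
  "mixed_norm p q m F =
     Lp_norm q lebesgue (\<lambda>\<omega>. Lp_norm p lebesgue (\<lambda>x. F (x, \<omega>) * ennreal (m (x, \<omega>))))"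

section \<open>Modulation spaces\<close>

text \<open>Bounded conjugate-linear functionals on \<open>M\<^sup>1\<^sub>v\<close>, extended by \<open>0\<close> to all functions so that
  equality of functionals is equality on \<open>M\<^sup>1\<^sub>v\<close>. Boundedness forces them to respect almost
  everywhere equality. The pairing \<open>\<langle>f, h\<rangle>\<close> is \<open>f h\<close>.\<close>

definition M1_dual :: "('d::finite tfplane \<Rightarrow> real) \<Rightarrow> ((real^'d \<Rightarrow> complex) \<Rightarrow> complex) set" where
  "M1_dual v = {f.
     (\<forall>h\<in>M1_space v. \<forall>k\<in>M1_space v. f (\<lambda>t. h t + k t) = f h + f k) \<and>
     (\<forall>c. \<forall>h\<in>M1_space v. f (\<lambda>t. c * h t) = cnj c * f h) \<and>
     (\<exists>C. \<forall>h\<in>M1_space v. ennreal (cmod (f h)) \<le> ennreal C * M1_norm v h) \<and>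
     (\<forall>h. h \<notin> M1_space v \<longrightarrow> f h = 0)}"

definition is_window :: "('d::finite tfplane \<Rightarrow> real) \<Rightarrow> (real^'d \<Rightarrow> complex) \<Rightarrow> bool" where
  "is_window v w \<longleftrightarrow> w \<in> M1_space v \<and> \<not> (AE t in lebesgue. w t = 0)"

definition STFT ::
  "(real^'d::finite \<Rightarrow> complex) \<Rightarrow> ((real^'d \<Rightarrow> complex) \<Rightarrow> complex) \<Rightarrow> 'd tfplane \<Rightarrow> complex" where
  "STFT w f z = f (tf_shift z w)"

definition modulation_norm ::
  "(real^'d::finite \<Rightarrow> complex) \<Rightarrow> ennreal \<Rightarrow> ennreal \<Rightarrow> ('d tfplane \<Rightarrow> real) \<Rightarrow>
   ((real^'d \<Rightarrow> complex) \<Rightarrow> complex) \<Rightarrow> ennreal" where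
  "modulation_norm w p q m f = mixed_norm p q m (\<lambda>z. ennreal (cmod (STFT w f z)))"

definition modulation_space ::
  "('d::finite tfplane \<Rightarrow> real) \<Rightarrow> (real^'d \<Rightarrow> complex) \<Rightarrow> ennreal \<Rightarrow> ennreal \<Rightarrow>
   ('d tfplane \<Rightarrow> real) \<Rightarrow> ((real^'d \<Rightarrow> complex) \<Rightarrow> complex) set" where
  "modulation_space v w p q m = {f \<in> M1_dual v. modulation_norm w p q m f < \<infinity>}"

section \<open>Multi-window Gabor frames\<close>

definition seq_norm ::
  "ennreal \<Rightarrow> ennreal \<Rightarrow> ('d::finite tfplane \<Rightarrow> real) \<Rightarrow> 'd tfplane set \<Rightarrow> 'd tfplane set \<Rightarrow> nat \<Rightarrow>
   (nat \<Rightarrow> 'd tfplane \<Rightarrow> complex) \<Rightarrow> ennreal" where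
  "seq_norm p q m \<Lambda> Q n a =
     (\<Sum>i=1..n. mixed_norm p q m
        (\<lambda>z. \<Sum>\<^sub>\<infinity>l\<in>\<Lambda>. ennreal (cmod (a i l)) * indicator ((+) l ` Q) z))"

text \<open>Families indexed by \<open>{1..n} \<times> \<Lambda>\<close> are extended by \<open>0\<close>.\<close>

definition seq_space ::
  "ennreal \<Rightarrow> ennreal \<Rightarrow> ('d::finite tfplane \<Rightarrow> real) \<Rightarrow> 'd tfplane set \<Rightarrow> 'd tfplane set \<Rightarrow> nat \<Rightarrow>
   (nat \<Rightarrow> 'd tfplane \<Rightarrow> complex) set" where
  "seq_space p q m \<Lambda> Q n =
     {a. (\<forall>i l. i \<notin> {1..n} \<or> l \<notin> \<Lambda> \<longrightarrow> a i l = 0) \<and> seq_norm p q m \<Lambda> Q n a < \<infinity>}"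

definition gabor_coeffs ::
  "'d::finite tfplane set \<Rightarrow> nat \<Rightarrow> (nat \<Rightarrow> real^'d \<Rightarrow> complex) \<Rightarrow>
   ((real^'d \<Rightarrow> complex) \<Rightarrow> complex) \<Rightarrow> nat \<Rightarrow> 'd tfplane \<Rightarrow> complex" where
  "gabor_coeffs \<Lambda> n g f =
     (\<lambda>i l. if i \<in> {1..n} \<and> l \<in> \<Lambda> then f (tf_shift l (g i)) else 0)"

text \<open>The Banach frame property of the Gabor system of \<open>g\<^sub>1, \<dots>, g\<^sub>n\<close> along \<open>\<Lambda>\<close> for
  \<open>M\<^sup>p\<^sup>,\<^sup>q\<^sub>m\<close>, where the latter is normed by means of the window \<open>w\<close> and the sequence space by means
  of the fundamental domain \<open>Q\<close>.\<close>

definition multi_window_gabor_frame ::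
  "('d::finite tfplane \<Rightarrow> real) \<Rightarrow> (real^'d \<Rightarrow> complex) \<Rightarrow> 'd tfplane set \<Rightarrow>
   ennreal \<Rightarrow> ennreal \<Rightarrow> ('d tfplane \<Rightarrow> real) \<Rightarrow>
   'd tfplane set \<Rightarrow> nat \<Rightarrow> (nat \<Rightarrow> real^'d \<Rightarrow> complex) \<Rightarrow> bool" where
  "multi_window_gabor_frame v w Q p q m \<Lambda> n g \<longleftrightarrow>
     (\<exists>A>0. \<exists>B>0. \<forall>f\<in>modulation_space v w p q m.
        ennreal A * modulation_norm w p q m f \<le> seq_norm p q m \<Lambda> Q n (gabor_coeffs \<Lambda> n g f) \<and>
        seq_norm p q m \<Lambda> Q n (gabor_coeffs \<Lambda> n g f) \<le> ennreal B * modulation_norm w p q m f) \<and>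
     (\<exists>R. (\<forall>a\<in>seq_space p q m \<Lambda> Q n. R a \<in> modulation_space v w p q m) \<and>
          (\<forall>a\<in>seq_space p q m \<Lambda> Q n. \<forall>b\<in>seq_space p q m \<Lambda> Q n.
             R (\<lambda>i l. a i l + b i l) = (\<lambda>h. R a h + R b h)) \<and>
          (\<forall>c. \<forall>a\<in>seq_space p q m \<Lambda> Q n. R (\<lambda>i l. c * a i l) = (\<lambda>h. c * R a h)) \<and>
          (\<exists>K. \<forall>a\<in>seq_space p q m \<Lambda> Q n.
             modulation_norm w p q m (R a) \<le> ennreal K * seq_norm p q m \<Lambda> Q n a) \<and>
          (\<forall>f\<in>modulation_space v w p q m. R (gabor_coeffs \<Lambda> n g f) = f))"

end

theory Submission
  imports Defs
begin

text \<open>The windows are time-frequency shifts \<open>\<pi>(x\<^sub>i)\<phi>\<close> of the Gaussian for finitely many points \<open>x\<^sub>i\<close> such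
  that the translates \<open>\<Lambda> + x\<^sub>i\<close> together are \<open>\<epsilon>\<close>-dense in the time-frequency plane. The transform \<open>V f(z)
  = \<langle>f, \<pi>(z)\<phi>\<rangle>\<close> satisfies a reproducing formula; replacing \<open>V f(z)\<close> in it by the phase-corrected sample
  of \<open>V f\<close> at a point \<open>\<lambda> + x\<^sub>i\<close> near \<open>z\<close> perturbs the identity by an operator that is dominated
  pointwise by convolution with a multiple of \<open>\<theta> exp (- |z|\<^sup>2/4)\<close>, where \<open>\<theta>\<close> is small for small
  \<open>\<epsilon>\<close>, so that a Neumann series inverts it. Every \<open>v\<close>-moderate weight is equivalent to a continuous weight
  \<open>\<mu>\<close> with \<open>\<mu>(z + u) \<le> exp (a|u|) \<mu>(z)\<close>, where \<open>a\<close> depends on \<open>v\<close> only; hence one \<open>\<epsilon>\<close> serves all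
  weights, and the pointwise domination serves all \<open>p\<close> and \<open>q\<close> at once.\<close>

subsection \<open>Powers and Lebesgue norms of extended nonnegative functions\<close>

text \<open>Elements of the modulation spaces are functionals, so all estimates are transferred to
  their transforms. This rests on \<open>synth v (stft f) = f\<close>: a functional is recovered
  from its values at the shifted Gaussians. The phase correction is forced by covariance: once it is
  made, the oscillation of the kernel depends in modulus only on \<open>u' - u\<close> and
  \<open>z - u\<close>, and smallness becomes uniform over the plane. The Neumann series is summed
  at every point, under a weighted sup bound, so that one operator serves all norms; its mixed norm
  bound is then Young's inequality. Two such sup bounds occur. For a coefficient family it has the
  weight \<open>\<mu>\<close> and comes from the finite sequence norm; for an arbitrary functional
  it has the weight \<open>exp (- (a * norm z))\<close>, and this one yields the left inverse
  identity. A general window enters only through the equivalence of its norm with the Gaussian one.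
  There one divides by a value \<open>gst w r\<close>, and such a nonzero value exists because the
  transform is injective. The growth bound for \<open>v\<close>, from which \<open>a\<close> is
  taken, comes from Steinhaus' theorem on difference sets.\<close>

lemma enn_powr_0 [simp]: "enn_powr 0 r = 0"
  by (simp add: enn_powr_def)

lemma enn_powr_top [simp]: "enn_powr \<top> r = \<top>"
  by (simp add: enn_powr_def)

lemma enn_powr_ennreal: "0 \<le> x \<Longrightarrow> enn_powr (ennreal x) r = ennreal (x powr r)"
  by (simp add: enn_powr_def)

lemma enn_powr_one [simp]: "enn_powr 1 r = 1"
  by (simp add: enn_powr_def)

lemma enn_powr_mono:
  assumes "a \<le> b" "0 \<le> r"
  shows "enn_powr a r \<le> enn_powr b r"
  using assms
  by (cases a; cases b) (auto simp: enn_powr_ennreal powr_mono2 top_unique intro!: ennreal_leI)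

lemma enn_powr_eq_0_iff [simp]: "enn_powr a r = 0 \<longleftrightarrow> a = 0"
  by (cases a) (auto simp: enn_powr_ennreal ennreal_eq_0_iff)

lemma enn_powr_mult: "enn_powr (a * b) r = enn_powr a r * enn_powr b r"
proof (cases "a = \<top> \<or> b = \<top>")
  case True
  then show ?thesis
    by (cases "a = 0 \<or> b = 0") (auto simp: ennreal_mult_eq_top_iff ennreal_top_mult ennreal_mult_top)
next
  case False
  then obtain x y where "a = ennreal x" "b = ennreal y" "0 \<le> x" "0 \<le> y"
    by (cases a; cases b) auto
  then show ?thesis
    by (simp add: enn_powr_ennreal powr_mult flip: ennreal_mult)
qed

lemma enn_powr_powr: "enn_powr (enn_powr a r) s = enn_powr a (r * s)"
  by (cases a) (auto simp: enn_powr_ennreal powr_powr)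

lemma enn_powr_1 [simp]: "enn_powr a 1 = a"
  by (cases a) (auto simp: enn_powr_ennreal)

lemma enn_powr_inverse [simp]:
  assumes "0 < r"
  shows "enn_powr (enn_powr a r) (1 / r) = a" "enn_powr (enn_powr a (1 / r)) r = a"
  using assms by (simp_all add: enn_powr_powr)

lemma measurable_enn_powr [measurable]:
  assumes [measurable]: "f \<in> borel_measurable M"
  shows "(\<lambda>x. enn_powr (f x) r) \<in> borel_measurable M"
  unfolding enn_powr_def by measurable

lemma enn2real_ge_1: "1 \<le> p \<Longrightarrow> p \<noteq> \<infinity> \<Longrightarrow> 1 \<le> enn2real p"
  by (cases p) (auto simp flip: ennreal_1)

lemma Lp_norm_powr:
  assumes "1 \<le> p" "p \<noteq> \<infinity>"
  shows "enn_powr (Lp_norm p M f) (enn2real p) = (\<integral>\<^sup>+ t. enn_powr (f t) (enn2real p) \<partial>M)"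
  using enn2real_ge_1[OF assms] assms by (simp add: Lp_norm_def)

lemma Lp_norm_le_iff:
  assumes "1 \<le> p" "p \<noteq> \<infinity>"
  shows "Lp_norm p M f \<le> c \<longleftrightarrow>
    (\<integral>\<^sup>+ t. enn_powr (f t) (enn2real p) \<partial>M) \<le> enn_powr c (enn2real p)"
proof -
  have r: "0 < enn2real p" using enn2real_ge_1[OF assms] by simp
  show ?thesis
    unfolding Lp_norm_powr[OF assms, symmetric]
    using enn_powr_mono[of "Lp_norm p M f" c "enn2real p"]
      enn_powr_mono[of "enn_powr (Lp_norm p M f) (enn2real p)" "enn_powr c (enn2real p)" "1 / enn2real p"] r
    by (auto simp: less_imp_le)
qed

lemma esssup_le_iff:
  fixes f :: "'a \<Rightarrow> ennreal"
  assumes "f \<in> borel_measurable M"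
  shows "esssup M f \<le> c \<longleftrightarrow> (AE x in M. f x \<le> c)"
  using esssup_I[OF assms] esssup_AE[of f M] by (auto elim: eventually_mono)

lemma Lp_norm_mono_AE:
  assumes "f \<in> borel_measurable M" "AE x in M. f x \<le> g x" "1 \<le> p"
  shows "Lp_norm p M f \<le> Lp_norm p M g"
proof (cases "p = \<infinity>")
  case True
  then show ?thesis using assms by (simp add: Lp_norm_def esssup_AE_mono)
next
  case False
  have "0 < enn2real p" using enn2real_ge_1[OF assms(3) False] by simp
  then have "(\<integral>\<^sup>+ t. enn_powr (f t) (enn2real p) \<partial>M) \<le> (\<integral>\<^sup>+ t. enn_powr (g t) (enn2real p) \<partial>M)"
    using assms(2) by (intro nn_integral_mono_AE) (auto elim!: eventually_mono intro!: enn_powr_mono)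
  then show ?thesis
    using False \<open>0 < enn2real p\<close> by (simp add: Lp_norm_def enn_powr_mono)
qed

text \<open>Completeness: preimages under \<open>g\<close> differ from those under \<open>f\<close>
  by subsets of null sets. Weights, \<open>Q\<close> and square integrable functions are only
  Lebesgue measurable, while Tonelli is applied to Borel representatives, so such replacements are
  frequent.\<close>

lemma borel_measurable_completion_AE:
  fixes f g :: "'a \<Rightarrow> 'b::topological_space"
  assumes "f \<in> borel_measurable (completion M)" "AE x in completion M. f x = g x"
  shows "g \<in> borel_measurable (completion M)"
proof (rule measurableI)
  fix A :: "'b set" assume A: "A \<in> sets borel"
  have "f -` A \<inter> space M \<in> sets (completion M)"
    using measurable_sets[OF assms(1) A] by simp
  then show "g -` A \<inter> space (completion M) \<in> sets (completion M)"
    by (rule completion.in_sets_AE[rotated 1]) (use assms(2) in \<open>auto elim!: AE_mp\<close>)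
qed simp

text \<open>No measurability is assumed: the essential supremum of a non-measurable function is
  infinite by convention, and over a complete measure almost equal functions are measurable or
  non-measurable together.\<close>

lemma Lp_norm_cong_AE_completion:
  assumes "AE x in completion M. f x = g x"
  shows "Lp_norm p (completion M) f = Lp_norm p (completion M) g"
proof (cases "p = \<infinity>")
  case True
  note * = borel_measurable_completion_AE
  show ?thesis
  proof (cases "f \<in> borel_measurable (completion M)")
    case m: True
    then show ?thesis
      using True *[OF m assms] esssup_AE_cong assms by (auto simp: Lp_norm_def)
  next
    case False
    moreover have "AE x in completion M. g x = f x" using assms by (auto elim: eventually_mono)
    ultimately have "g \<notin> borel_measurable (completion M)" using *[of g M f] by auto
    with False True show ?thesis by (simp add: Lp_norm_def esssup_non_measurable)
  qed
next
  case False
  have "(\<integral>\<^sup>+ t. enn_powr (f t) r \<partial>completion M) = (\<integral>\<^sup>+ t. enn_powr (g t) r \<partial>completion M)" for r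
    using assms by (intro nn_integral_cong_AE) auto
  then show ?thesis using False by (simp add: Lp_norm_def)
qed

lemma Lp_norm_completion:
  assumes "f \<in> borel_measurable M"
  shows "Lp_norm p (completion M) f = Lp_norm p M f"
proof (cases "p = \<infinity>")
  case True
  with assms measurable_completion[OF assms] show ?thesis
    by (simp add: Lp_norm_def esssup_eq_AE AE_completion_iff)
next
  case False
  then show ?thesis by (simp add: Lp_norm_def nn_integral_completion)
qed

text \<open>Stated for every \<open>c\<close>, infinity included, because the convolution kernels in
  Young's inequality may take that value. Equality for finite \<open>c\<close> then follows by
  applying the inequality to the reciprocal.\<close>

lemma Lp_norm_cmult_le:
  assumes [measurable]: "f \<in> borel_measurable M" and p: "1 \<le> p"
  shows "Lp_norm p M (\<lambda>x. c * f x) \<le> c * Lp_norm p M f"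
proof (cases "p = \<infinity>")
  case True
  have "AE x in M. c * f x \<le> c * esssup M f"
    using esssup_AE[of f M] by eventually_elim (rule mult_left_mono, auto)
  then show ?thesis using True by (simp add: Lp_norm_def esssup_le_iff)
next
  case False
  show ?thesis
    using False p
    by (simp add: Lp_norm_le_iff enn_powr_mult nn_integral_cmult Lp_norm_powr)
qed

lemma Lp_norm_cmult:
  assumes [measurable]: "f \<in> borel_measurable M" and p: "1 \<le> p" and c: "c \<noteq> \<top>"
  shows "Lp_norm p M (\<lambda>x. c * f x) = c * Lp_norm p M f"
proof (cases "c = 0")
  case True
  then show ?thesis
    using Lp_norm_cmult_le[OF assms(1,2), of c] by simp
next
  case False
  then obtain r where r: "c = ennreal r" "0 < r" using c by (cases c) (auto simp: less_le)
  have *: "ennreal (1 / r) * c = 1" using r by (simp flip: ennreal_mult)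
  have "Lp_norm p M f = Lp_norm p M (\<lambda>x. ennreal (1 / r) * (c * f x))"
    by (simp add: * flip: mult.assoc)
  also have "\<dots> \<le> ennreal (1 / r) * Lp_norm p M (\<lambda>x. c * f x)"
    by (rule Lp_norm_cmult_le) (use p in auto)
  finally have "c * Lp_norm p M f \<le> c * (ennreal (1 / r) * Lp_norm p M (\<lambda>x. c * f x))"
    by (rule mult_left_mono) simp
  also have "\<dots> = Lp_norm p M (\<lambda>x. c * f x)"
    using * by (simp add: mult.commute flip: mult.assoc)
  finally show ?thesis using Lp_norm_cmult_le[OF assms(1,2), of c] by simp
qed

lemma Lp_norm_eq_0_iff:
  assumes [measurable]: "f \<in> borel_measurable M" and p: "1 \<le> p"
  shows "Lp_norm p M f = 0 \<longleftrightarrow> (AE x in M. f x = 0)"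
proof (cases "p = \<infinity>")
  case True
  then show ?thesis using esssup_le_iff[of f M 0] by (simp add: Lp_norm_def)
next
  case False
  then show ?thesis by (simp add: Lp_norm_def nn_integral_0_iff_AE)
qed

lemma measurable_Lp_norm:
  assumes "sigma_finite_measure M" and p: "1 \<le> p"
    and f[measurable]: "(\<lambda>(y, x). f y x) \<in> borel_measurable (N \<Otimes>\<^sub>M M)"
  shows "(\<lambda>y. Lp_norm p M (f y)) \<in> borel_measurable N"
proof -
  interpret sigma_finite_measure M by fact
  show ?thesis
  proof (cases "p = \<infinity>")
    case True
    have m: "f y \<in> borel_measurable M" if "y \<in> space N" for y
      using that by measurable
    have "{y \<in> space N. esssup M (f y) \<le> c} \<in> sets N" for c
    proof -
      \<comment> \<open>A sublevel set of the essential supremum is the zero set of the measure of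
        the exceptional values, and that measure is a measurable function of the parameter by
        Tonelli.\<close>
      have "{y \<in> space N. esssup M (f y) \<le> c}
          = {y \<in> space N. (\<integral>\<^sup>+ x. indicator {c<..} (f y x) \<partial>M) = 0}"
        using esssup_le_iff[OF m] m
        by (auto simp: nn_integral_0_iff_AE indicator_def not_less split: if_splits)
      also have "\<dots> \<in> sets N" by measurable
      finally show ?thesis .
    qed
    then show ?thesis
      using True by (auto simp: Lp_norm_def intro!: borel_measurableI_le)
  next
    case False
    then show ?thesis unfolding Lp_norm_def by simp
  qed
qed

text \<open>Jensen's inequality for the probability density \<open>w\<close>, from the tangent of \<open>s \<mapsto> s\<^sup>r\<close>
  at the mean.\<close>

lemma enn_powr_tangent:
  assumes "1 \<le> r" "0 \<le> t"
  shows "ennreal (r * t powr (r - 1)) * a \<le> enn_powr a r + ennreal ((r - 1) * t powr r)"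
proof (cases a)
  case (real s)
  have "r * t powr (r - 1) * s \<le> s powr r + (r - 1) * t powr r"
  proof (cases "s = 0 \<or> t = 0")
    case True
    then show ?thesis using assms real by (auto simp: zero_le_mult_iff)
  next
    case False
    then have "0 < s" "0 < t" using assms real by auto
    show ?thesis
    proof (cases "r = 1")
      case True
      then show ?thesis using \<open>0 < s\<close> \<open>0 < t\<close> by simp
    next
      case False
      \<comment> \<open>Young's inequality for the conjugate exponents \<open>r\<close> and
        \<open>r / (r - 1)\<close>, which is why \<open>r = 1\<close> has been split off.\<close>
      have "s * t powr (r - 1)
        \<le> s powr r / r + (t powr (r - 1)) powr (r / (r - 1)) / (r / (r - 1))"
        using assms False \<open>0 < s\<close> \<open>0 < t\<close>
        by (intro Youngs_inequality) (auto simp: field_simps)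
      also have "(t powr (r - 1)) powr (r / (r - 1)) = t powr r"
        using False by (simp add: powr_powr)
      finally show ?thesis
        using assms False by (simp add: field_simps)
    qed
  qed
  then show ?thesis
    using real assms by (simp add: enn_powr_ennreal flip: ennreal_mult ennreal_plus)
qed auto

lemma enn_powr_jensen:
  assumes r: "1 \<le> r" and [measurable]: "w \<in> borel_measurable M" "g \<in> borel_measurable M"
    and w: "(\<integral>\<^sup>+ u. w u \<partial>M) = 1"
  shows "enn_powr (\<integral>\<^sup>+ u. w u * g u \<partial>M) r \<le> (\<integral>\<^sup>+ u. w u * enn_powr (g u) r \<partial>M)"
proof -
  have *: "ennreal (r * t powr (r - 1)) * (\<integral>\<^sup>+ u. w u * g u \<partial>M)
     \<le> (\<integral>\<^sup>+ u. w u * enn_powr (g u) r \<partial>M) + ennreal ((r - 1) * t powr r)" if "0 \<le> t" for t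
  proof -
    have "ennreal (r * t powr (r - 1)) * (\<integral>\<^sup>+ u. w u * g u \<partial>M)
       = (\<integral>\<^sup>+ u. w u * (ennreal (r * t powr (r - 1)) * g u) \<partial>M)"
      by (subst nn_integral_cmult[symmetric]) (auto simp: mult_ac)
    also have "\<dots> \<le> (\<integral>\<^sup>+ u. w u * (enn_powr (g u) r + ennreal ((r - 1) * t powr r)) \<partial>M)"
      by (intro nn_integral_mono mult_left_mono enn_powr_tangent r that) simp
    also have "\<dots> = (\<integral>\<^sup>+ u. w u * enn_powr (g u) r \<partial>M) + ennreal ((r - 1) * t powr r)"
      using w by (simp add: distrib_left nn_integral_add nn_integral_multc)
    finally show ?thesis .
  qed
  show ?thesis
  proof (cases "\<integral>\<^sup>+ u. w u * g u \<partial>M")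
    case top
    \<comment> \<open>If the mean is infinite, any tangent of positive slope gives the claim, here
      the one at 1; in the other case the tangent at the mean itself is taken.\<close>
    with *[of 1] r have "(\<integral>\<^sup>+ u. w u * enn_powr (g u) r \<partial>M) = \<top>"
      by (auto simp: ennreal_mult_top top_unique)
    then show ?thesis by simp
  next
    case (real t)
    have "t powr r = t powr (r - 1) * t" 
      using real powr_add[of t "r - 1" 1] by simp
    then have "r * t powr (r - 1) * t = t powr r + (r - 1) * t powr r"
      by (simp add: algebra_simps)
    then have "ennreal (t powr r) + ennreal ((r - 1) * t powr r)
      \<le> (\<integral>\<^sup>+ u. w u * enn_powr (g u) r \<partial>M) + ennreal ((r - 1) * t powr r)"
      using *[of t] real r by (simp flip: ennreal_mult ennreal_plus)
    then show ?thesis using real by (simp add: enn_powr_ennreal)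
  qed
qed

text \<open>With \<open>n u\<close> the norm of the slice and \<open>I\<close> the integral of these
  norms, the inner integral is \<open>I\<close> times an average of the normalised slices
  \<open>f u / n u\<close> for the probability density \<open>n u / I\<close>. Jensen moves the
  power inside this average, and every normalised slice contributes at most 1.\<close>

theorem Lp_norm_minkowski:
  assumes "sigma_finite_measure U" "sigma_finite_measure M" and p: "1 \<le> p"
    and f[measurable]: "(\<lambda>(u, x). f u x) \<in> borel_measurable (U \<Otimes>\<^sub>M M)"
  shows "Lp_norm p M (\<lambda>x. \<integral>\<^sup>+ u. f u x \<partial>U) \<le> (\<integral>\<^sup>+ u. Lp_norm p M (f u) \<partial>U)"
proof -
  interpret pair_sigma_finite U M using assms(1,2) by (simp add: pair_sigma_finite_def)
  define n where "n = (\<lambda>u. Lp_norm p M (f u))"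
  define I where "I = (\<integral>\<^sup>+ u. n u \<partial>U)"
  have n[measurable]: "n \<in> borel_measurable U"
    unfolding n_def by (rule measurable_Lp_norm) (use assms in auto)
  have fu[measurable]: "f u \<in> borel_measurable M" if "u \<in> space U" for u using that by measurable
  have S[measurable]: "(\<lambda>x. \<integral>\<^sup>+ u. f u x \<partial>U) \<in> borel_measurable M" by measurable
  have swap: "AE x in M. AE u in U. P u x"
    if "AE u in U. AE x in M. P u x" "Measurable.pred (U \<Otimes>\<^sub>M M) (\<lambda>(u, x). P u x)" for P
    using that AE_commute[of P] by (simp add: split_beta' pred_def)
  show ?thesis
  proof (cases "p = \<infinity>")
    case True
    have "AE u in U. AE x in M. f u x \<le> n u"
      using True esssup_AE by (auto simp: n_def Lp_norm_def)
    then have "AE x in M. AE u in U. f u x \<le> n u"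
      by (rule swap) measurable
    then have "AE x in M. (\<integral>\<^sup>+ u. f u x \<partial>U) \<le> I"
      unfolding I_def by (auto elim!: eventually_mono intro: nn_integral_mono_AE)
    then show ?thesis
      using True by (simp add: Lp_norm_def esssup_le_iff I_def n_def)
  next
    case False
    define r where "r = enn2real p"
    have r: "1 \<le> r" using enn2real_ge_1[OF p False] by (simp add: r_def)
    consider "I = \<top>" | "I = 0" | "0 < I" "I < \<top>"
      by (metis not_gr_zero top.not_eq_extremum)
    then show ?thesis
    proof cases
      case 1
      then show ?thesis by (simp add: I_def n_def)
    next
      case 2
      then have "AE u in U. n u = 0"
        by (simp add: I_def nn_integral_0_iff_AE)
      with AE_space have "AE u in U. AE x in M. f u x = 0"
        by eventually_elim (use Lp_norm_eq_0_iff[OF fu p] in \<open>simp add: n_def\<close>)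
      then have "AE x in M. AE u in U. f u x = 0"
        by (rule swap) measurable
      then have "AE x in M. (\<integral>\<^sup>+ u. f u x \<partial>U) = 0"
        by (auto elim!: eventually_mono simp: nn_integral_0_iff_AE)
      then show ?thesis using Lp_norm_eq_0_iff[OF S p] by simp
    next
      case 3
      define w where "w = (\<lambda>u. n u / I)"
      define g where "g = (\<lambda>u x. f u x / n u)"
      have [measurable]: "w \<in> borel_measurable U" unfolding w_def by measurable
      have [measurable]: "(\<lambda>(u, x). g u x) \<in> borel_measurable (U \<Otimes>\<^sub>M M)"
        unfolding g_def by measurable
      have w1: "(\<integral>\<^sup>+ u. w u \<partial>U) = 1"
        unfolding w_def using 3 by (simp add: nn_integral_divide I_def[symmetric] ennreal_divide_self)
      have nfin: "AE u in U. n u \<noteq> \<top>"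
        using nn_integral_PInf_AE[of n U] 3 by (simp add: I_def less_top)
      \<comment> \<open>Cancelling \<open>n u\<close> in \<open>ennreal\<close> fails at 0 and at
        infinity. In the first case the slice vanishes almost everywhere anyway; the second occurs
        only on a null set.\<close>
      have "AE u in U. AE x in M. f u x = I * (w u * g u x)"
        using AE_space nfin
      proof eventually_elim
        case u: (elim u)
        show "AE x in M. f u x = I * (w u * g u x)"
        proof (cases "n u = 0")
          case True
          then have "AE x in M. f u x = 0" using u Lp_norm_eq_0_iff[OF fu p] by (simp add: n_def)
          then show ?thesis using True by (auto simp: w_def elim!: eventually_mono)
        next
          case False
          have "I * (n u / I * (a / n u)) = a" for a
          proof -
            have "I * (n u / I * (a / n u)) = (I / I) * (n u / n u) * a"
              by (simp add: divide_ennreal_def mult_ac)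
            also have "\<dots> = a" using False u 3 by (simp add: ennreal_divide_self less_top)
            finally show ?thesis .
          qed
          then show ?thesis by (simp add: w_def g_def)
        qed
      qed
      then have "AE x in M. AE u in U. f u x = I * (w u * g u x)"
        by (rule swap) measurable
      with AE_space have eq: "AE x in M. (\<integral>\<^sup>+ u. f u x \<partial>U) = I * (\<integral>\<^sup>+ u. w u * g u x \<partial>U)"
      proof eventually_elim
        case (elim x)
        note x = elim(1) and * = elim(2)
        have "(\<integral>\<^sup>+ u. f u x \<partial>U) = (\<integral>\<^sup>+ u. I * (w u * g u x) \<partial>U)"
          using * by (rule nn_integral_cong_AE)
        also have "\<dots> = I * (\<integral>\<^sup>+ u. w u * g u x \<partial>U)"
          by (rule nn_integral_cmult) (use x in measurable)
        finally show "(\<integral>\<^sup>+ u. f u x \<partial>U) = I * (\<integral>\<^sup>+ u. w u * g u x \<partial>U)" .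
      qed
      have g1: "(\<integral>\<^sup>+ x. enn_powr (g u x) r \<partial>M) \<le> 1" if u: "u \<in> space U" "n u \<noteq> \<top>" for u
      proof (cases "n u = 0")
        case True
        then have "AE x in M. f u x = 0" using u Lp_norm_eq_0_iff[OF fu p] by (simp add: n_def)
        then have "AE x in M. enn_powr (g u x) r = 0" 
          using True by (auto simp: g_def elim!: eventually_mono)
        then have "(\<integral>\<^sup>+ x. enn_powr (g u x) r \<partial>M) = (\<integral>\<^sup>+ x. 0 \<partial>M)"
          by (rule nn_integral_cong_AE)
        then show ?thesis by simp
      next
        case False
        have "(\<integral>\<^sup>+ x. enn_powr (g u x) r \<partial>M) = (\<integral>\<^sup>+ x. enn_powr (inverse (n u)) r * enn_powr (f u x) r \<partial>M)"
          by (simp add: g_def divide_ennreal_def enn_powr_mult mult.commute)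
        also have "\<dots> = enn_powr (inverse (n u)) r * enn_powr (n u) r"
          using u by (simp add: nn_integral_cmult n_def r_def Lp_norm_powr[OF p \<open>p \<noteq> \<infinity>\<close>])
        also have "\<dots> = enn_powr (n u / n u) r"
          by (simp add: divide_ennreal_def enn_powr_mult mult.commute)
        also have "\<dots> = 1" using False u by (simp add: ennreal_divide_self less_top)
        finally show ?thesis by simp
      qed
      have "(\<integral>\<^sup>+ x. enn_powr (\<integral>\<^sup>+ u. f u x \<partial>U) r \<partial>M)
          = (\<integral>\<^sup>+ x. enn_powr I r * enn_powr (\<integral>\<^sup>+ u. w u * g u x \<partial>U) r \<partial>M)"
        using eq by (intro nn_integral_cong_AE) (auto elim!: eventually_mono simp: enn_powr_mult)
      also have "\<dots> \<le> (\<integral>\<^sup>+ x. enn_powr I r * (\<integral>\<^sup>+ u. w u * enn_powr (g u x) r \<partial>U) \<partial>M)"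
        by (intro nn_integral_mono mult_left_mono enn_powr_jensen r w1) measurable
      also have "\<dots> = enn_powr I r * (\<integral>\<^sup>+ x. (\<integral>\<^sup>+ u. w u * enn_powr (g u x) r \<partial>U) \<partial>M)"
        by (rule nn_integral_cmult) measurable
      also have "(\<integral>\<^sup>+ x. (\<integral>\<^sup>+ u. w u * enn_powr (g u x) r \<partial>U) \<partial>M)
          = (\<integral>\<^sup>+ u. (\<integral>\<^sup>+ x. w u * enn_powr (g u x) r \<partial>M) \<partial>U)"
        by (rule Fubini') measurable
      also have "\<dots> = (\<integral>\<^sup>+ u. w u * (\<integral>\<^sup>+ x. enn_powr (g u x) r \<partial>M) \<partial>U)"
        by (intro nn_integral_cong nn_integral_cmult) measurable
      also have "\<dots> \<le> (\<integral>\<^sup>+ u. w u * 1 \<partial>U)"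
        by (intro nn_integral_mono_AE, use AE_space nfin in eventually_elim)
          (intro mult_left_mono g1; simp)
      also have "\<dots> = 1" using w1 by simp
      finally have "(\<integral>\<^sup>+ x. enn_powr (\<integral>\<^sup>+ u. f u x \<partial>U) r \<partial>M) \<le> enn_powr I r"
        by (simp add: mult_left_mono)
      then show ?thesis
        using p False by (simp add: Lp_norm_le_iff r_def I_def n_def)
    qed
  qed
qed

subsection \<open>Translation of Lebesgue integrals\<close>

lemma lborel_distr_reflect: "distr lborel borel (\<lambda>x. a - x) = (lborel :: 'a::euclidean_space measure)"
  using lborel_affine[of "-1" a] by (simp add: density_1)

lemma nn_integral_lborel_translate:
  fixes f :: "'a::euclidean_space \<Rightarrow> ennreal"
  assumes [measurable]: "f \<in> borel_measurable borel"
  shows "(\<integral>\<^sup>+ x. f (x + a) \<partial>lborel) = (\<integral>\<^sup>+ x. f x \<partial>lborel)"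
  by (subst (2) lborel_distr_plus[of a, symmetric]) (simp add: nn_integral_distr add.commute)

lemma nn_integral_lborel_reflect:
  fixes f :: "'a::euclidean_space \<Rightarrow> ennreal"
  assumes [measurable]: "f \<in> borel_measurable borel"
  shows "(\<integral>\<^sup>+ x. f (a - x) \<partial>lborel) = (\<integral>\<^sup>+ x. f x \<partial>lborel)"
  by (subst (2) lborel_distr_reflect[of a, symmetric]) (simp add: nn_integral_distr)

lemma integral_lborel_translate:
  fixes f :: "'a::euclidean_space \<Rightarrow> 'b::{banach, second_countable_topology}"
  assumes [measurable]: "f \<in> borel_measurable borel"
  shows "(LINT x|lborel. f (x + a)) = (LINT x|lborel. f x)"
  by (subst (2) lborel_distr_plus[of a, symmetric]) (simp add: integral_distr add.commute)

lemma integral_lborel_reflect: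
  fixes f :: "'a::euclidean_space \<Rightarrow> 'b::{banach, second_countable_topology}"
  assumes [measurable]: "f \<in> borel_measurable borel"
  shows "(LINT x|lborel. f (a - x)) = (LINT x|lborel. f x)"
  by (subst (2) lborel_distr_reflect[of a, symmetric]) (simp add: integral_distr)

lemma integrable_lborel_translate:
  fixes f :: "'a::euclidean_space \<Rightarrow> 'b::{banach, second_countable_topology}"
  assumes "integrable lborel f"
  shows "integrable lborel (\<lambda>x. f (x + a))"
proof -
  have [measurable]: "f \<in> borel_measurable borel" using assms by auto
  have "integrable (distr lborel borel ((+) a)) f"
    using assms by (simp add: lborel_distr_plus)
  then show ?thesis by (simp add: integrable_distr_eq add.commute)
qed

lemma integrable_lborel_reflect:
  fixes f :: "'a::euclidean_space \<Rightarrow> 'b::{banach, second_countable_topology}"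
  assumes "integrable lborel f"
  shows "integrable lborel (\<lambda>x. f (a - x))"
proof -
  have [measurable]: "f \<in> borel_measurable borel" using assms by auto
  have "integrable (distr lborel borel (\<lambda>x. a - x)) f"
    using assms by (simp add: lborel_distr_reflect)
  then show ?thesis by (simp add: integrable_distr_eq)
qed

lemma AE_lborel_translate:
  fixes a :: "'a::euclidean_space"
  assumes "AE x in lborel. P x"
  shows "AE x in lborel. P (x + a)"
proof -
  obtain N where N: "N \<in> null_sets lborel" "{x. \<not> P x} \<subseteq> N"
    using assms by (auto simp: eventually_ae_filter)
  have "{x. x - (- a) \<in> N} \<in> null_sets lborel"
    by (rule null_sets_translation) fact
  then show ?thesis
    by (rule AE_I'[OF _ subsetI]) (use N in auto)
qed

lemma AE_lborel_reflect:
  fixes a :: "'a::euclidean_space"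
  assumes "AE x in lborel. P x"
  shows "AE x in lborel. P (a - x)"
proof -
  obtain N where N: "N \<in> null_sets lborel" "{x. \<not> P x} \<subseteq> N"
    using assms by (auto simp: eventually_ae_filter)
  then have [measurable]: "N \<in> sets borel" by auto
  have "AE x in distr lborel borel (\<lambda>x. a - x). x \<notin> N"
    using N(1) by (simp add: lborel_distr_reflect AE_not_in)
  then have "AE x in lborel. a - x \<notin> N"
    by (subst (asm) AE_distr_iff) auto
  then show ?thesis using N(2) by (auto elim!: eventually_mono)
qed

text \<open>The mixed norm has its outer variable in the second component, whereas the product
  measure yields the quantifiers in the order of the factors. Passing to a measurable null set
  around the exceptional points allows the exchange.\<close>

lemma AE_lborel_prod_swap:
  fixes P :: "'a::euclidean_space \<times> 'b::euclidean_space \<Rightarrow> bool"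
  assumes "AE z in lborel. P z"
  shows "AE y in lborel. AE x in lborel. P (x, y)"
proof -
  obtain N where N: "N \<in> null_sets (lborel \<Otimes>\<^sub>M lborel)" "{z. \<not> P z} \<subseteq> N"
    using assms by (auto simp: eventually_ae_filter lborel_prod)
  then have [measurable]: "N \<in> sets (lborel \<Otimes>\<^sub>M lborel)" by auto
  have "AE x in lborel. AE y in lborel. (x, y) \<notin> N"
    using AE_not_in[OF N(1)] by (intro lborel_pair.AE_pair)
  then have "AE y in lborel. AE x in lborel. (x, y) \<notin> N"
  proof (subst (asm) lborel_pair.AE_commute)
    show "{z \<in> space (lborel \<Otimes>\<^sub>M lborel). (fst z, snd z) \<notin> N} \<in> sets (lborel \<Otimes>\<^sub>M lborel)"
      by measurable
  qed
  then show ?thesis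
    using N(2) by (auto elim!: eventually_mono)
qed

lemma borel_measurable_completion_complex:
  fixes f :: "'a \<Rightarrow> complex"
  assumes [measurable]: "f \<in> borel_measurable (completion M)"
  obtains g where "g \<in> borel_measurable M" "AE x in M. f x = g x"
proof -
  obtain a where a: "a \<in> borel_measurable M" "AE x in M. Re (f x) = a x"
    using completion_ex_borel_measurable_real[of "\<lambda>x. Re (f x)" M] by auto
  obtain b where b: "b \<in> borel_measurable M" "AE x in M. Im (f x) = b x"
    using completion_ex_borel_measurable_real[of "\<lambda>x. Im (f x)" M] by auto
  show thesis
  proof
    show "(\<lambda>x. Complex (a x) (b x)) \<in> borel_measurable M"
      using a(1) b(1) by (simp add: borel_measurable_complex_iff)
    show "AE x in M. f x = Complex (a x) (b x)"
      using a(2) b(2) by eventually_elim (simp add: complex_eq_iff)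
  qed
qed

subsection \<open>Mixed norms\<close>

lemma Lp_norm_translate:
  fixes f :: "'a::euclidean_space \<Rightarrow> ennreal"
  assumes [measurable]: "f \<in> borel_measurable borel"
  shows "Lp_norm p lborel (\<lambda>x. f (x + a)) = Lp_norm p lborel f"
proof (cases "p = \<infinity>")
  case True
  have "(AE x in lborel. f (x + a) \<le> c) \<longleftrightarrow> (AE x in lborel. f x \<le> c)" for c
    using AE_lborel_translate[of "\<lambda>x. f x \<le> c" a] AE_lborel_translate[of "\<lambda>x. f (x + a) \<le> c" "- a"]
    by (intro iffI) simp_all
  then show ?thesis using True by (simp add: Lp_norm_def esssup_eq_AE)
next
  case False
  then show ?thesis
    using nn_integral_lborel_translate[of "\<lambda>x. enn_powr (f x) (enn2real p)" a]
    by (simp add: Lp_norm_def)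
qed

text \<open>The weight is left to the argument, and Borel measure replaces its completion: slices of
  a Borel function are always measurable, those of a Lebesgue measurable one need not be.\<close>

definition mnorm ::
  "ennreal \<Rightarrow> ennreal \<Rightarrow> ('a::euclidean_space \<times> 'b::euclidean_space \<Rightarrow> ennreal) \<Rightarrow> ennreal" where
  "mnorm p q A = Lp_norm q lborel (\<lambda>y. Lp_norm p lborel (\<lambda>x. A (x, y)))"

lemma measurable_mnorm_inner:
  fixes A :: "'a::euclidean_space \<times> 'b::euclidean_space \<Rightarrow> ennreal"
  assumes A: "A \<in> borel_measurable borel" and "1 \<le> p"
  shows "(\<lambda>y. Lp_norm p lborel (\<lambda>x. A (x, y))) \<in> borel_measurable borel"
proof -
  have [measurable]: "A \<in> borel_measurable (borel \<Otimes>\<^sub>M borel)" using A by (simp add: borel_prod)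
  have "(\<lambda>y. Lp_norm p lborel (\<lambda>x. A (x, y))) \<in> borel_measurable lborel"
    by (rule measurable_Lp_norm) (use assms in \<open>auto simp: sigma_finite_lborel\<close>)
  then show ?thesis by simp
qed

text \<open>Almost every slice of the weighted \<open>F\<close> agrees almost everywhere with the
  slice of \<open>A\<close>, so the null sets disappear first in the inner and then in the outer
  norm. This is the passage from the norms of the statement to those of Borel functions.\<close>

lemma mixed_norm_eq_mnorm:
  assumes A: "A \<in> borel_measurable borel" and p: "1 \<le> p"
    and eq: "AE z in lborel. F z * ennreal (m z) = A z"
  shows "mixed_norm p q m F = mnorm p q A"
proof -
  have "AE y in lborel. AE x in lborel. F (x, y) * ennreal (m (x, y)) = A (x, y)"
    using AE_lborel_prod_swap[OF eq] .
  then have "AE y in lborel. Lp_norm p lebesgue (\<lambda>x. F (x, y) * ennreal (m (x, y)))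
      = Lp_norm p lebesgue (\<lambda>x. A (x, y))"
    by eventually_elim (rule Lp_norm_cong_AE_completion, simp add: AE_completion_iff)
  moreover have "Lp_norm p lebesgue (\<lambda>x. A (x, y)) = Lp_norm p lborel (\<lambda>x. A (x, y))" for y
  proof -
    have [measurable]: "A \<in> borel_measurable (borel \<Otimes>\<^sub>M borel)" using A by (simp add: borel_prod)
    show ?thesis by (rule Lp_norm_completion) simp
  qed
  ultimately have "mixed_norm p q m F = Lp_norm q lebesgue (\<lambda>y. Lp_norm p lborel (\<lambda>x. A (x, y)))"
    unfolding mixed_norm_def
    by (intro Lp_norm_cong_AE_completion) (simp add: AE_completion_iff)
  also have "\<dots> = mnorm p q A"
    unfolding mnorm_def using measurable_mnorm_inner[OF A p] by (intro Lp_norm_completion) simp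
  finally show ?thesis .
qed

context
  fixes p q :: ennreal
  assumes p: "1 \<le> p" and q: "1 \<le> q"
begin

lemma mnorm_mono_AE:
  assumes [measurable]: "A \<in> borel_measurable borel" "B \<in> borel_measurable borel"
    and "AE z in lborel. A z \<le> B z"
  shows "mnorm p q A \<le> mnorm p q B"
proof -
  have [measurable]: "A \<in> borel_measurable (borel \<Otimes>\<^sub>M borel)" using assms(1) by (simp add: borel_prod)
  have "AE y in lborel. Lp_norm p lborel (\<lambda>x. A (x, y)) \<le> Lp_norm p lborel (\<lambda>x. B (x, y))"
    using AE_lborel_prod_swap[OF assms(3)]
    by eventually_elim (rule Lp_norm_mono_AE, auto simp: p)
  then show ?thesis
    unfolding mnorm_def using measurable_mnorm_inner[OF assms(1) p]
    by (intro Lp_norm_mono_AE) (auto simp: q)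
qed

lemma mnorm_mono:
  assumes "A \<in> borel_measurable borel" "B \<in> borel_measurable borel" "\<And>z. A z \<le> B z"
  shows "mnorm p q A \<le> mnorm p q B"
  using assms by (intro mnorm_mono_AE) auto

lemma mnorm_cmult:
  assumes A: "A \<in> borel_measurable borel" and c: "c \<noteq> \<top>"
  shows "mnorm p q (\<lambda>z. c * A z) = c * mnorm p q A"
proof -
  have [measurable]: "A \<in> borel_measurable (borel \<Otimes>\<^sub>M borel)" using assms(1) by (simp add: borel_prod)
  show ?thesis
    unfolding mnorm_def using measurable_mnorm_inner[OF A p]
    by (simp add: Lp_norm_cmult p q c)
qed

lemma mnorm_translate:
  assumes A: "A \<in> borel_measurable borel"
  shows "mnorm p q (\<lambda>z. A (z + w)) = mnorm p q A"
proof -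
  have [measurable]: "A \<in> borel_measurable (borel \<Otimes>\<^sub>M borel)" using assms(1) by (simp add: borel_prod)
  obtain a b where w: "w = (a, b)" by (cases w)
  have "Lp_norm p lborel (\<lambda>x. A (x + a, y)) = Lp_norm p lborel (\<lambda>x. A (x, y))" for y
    by (rule Lp_norm_translate) simp
  then show ?thesis
    unfolding mnorm_def w
    using Lp_norm_translate[OF measurable_mnorm_inner[OF A p], of q b] by simp
qed

lemma mnorm_eq_0:
  assumes A[measurable]: "A \<in> borel_measurable borel" and "mnorm p q A = 0"
  shows "AE z in lborel. A z = 0"
proof -
  have [measurable]: "A \<in> borel_measurable (borel \<Otimes>\<^sub>M borel)" using assms(1) by (simp add: borel_prod)
  have "AE y in lborel. Lp_norm p lborel (\<lambda>x. A (x, y)) = 0"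
    using assms(2) measurable_mnorm_inner[OF A p] by (simp add: mnorm_def Lp_norm_eq_0_iff q)
  then have "AE y in lborel. AE x in lborel. A (x, y) = 0"
    by (simp add: Lp_norm_eq_0_iff p)
  then have "AE x in lborel. AE y in lborel. A (x, y) = 0"
  proof (subst lborel_pair.AE_commute)
    show "{z \<in> space (lborel \<Otimes>\<^sub>M lborel). A (fst z, snd z) = 0} \<in> sets (lborel \<Otimes>\<^sub>M lborel)"
      by measurable
  qed
  then have "AE z in lborel \<Otimes>\<^sub>M lborel. A z = 0"
    by (rule lborel_pair.AE_pair_measure[rotated]) measurable
  then show ?thesis unfolding lborel_prod .
qed

text \<open>Minkowski's inequality in the inner variable and then in the outer one. With counting
  measure for \<open>U\<close> it becomes the triangle inequality for finite and infinite
  sums.\<close>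

lemma mnorm_minkowski:
  assumes U: "sigma_finite_measure U"
    and f[measurable]: "(\<lambda>(u, z). f u z) \<in> borel_measurable (U \<Otimes>\<^sub>M borel)"
  shows "mnorm p q (\<lambda>z. \<integral>\<^sup>+ u. f u z \<partial>U) \<le> (\<integral>\<^sup>+ u. mnorm p q (f u) \<partial>U)"
proof -
  interpret sigma_finite_measure U by fact
  have f'[measurable]: "(\<lambda>(u, z). f u z) \<in> borel_measurable (U \<Otimes>\<^sub>M (borel \<Otimes>\<^sub>M borel))"
    using f by (simp add: borel_prod)
  have fu[measurable]: "(\<lambda>z. \<integral>\<^sup>+ u. f u z \<partial>U) \<in> borel_measurable borel" by measurable
  have m1: "(\<lambda>(u, y). Lp_norm p lborel (\<lambda>x. f u (x, y))) \<in> borel_measurable (U \<Otimes>\<^sub>M lborel)"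
    using measurable_Lp_norm[of lborel p "\<lambda>(u, y) x. f u (x, y)" "U \<Otimes>\<^sub>M lborel"] p
    by (simp add: split_beta' sigma_finite_lborel)
  have "mnorm p q (\<lambda>z. \<integral>\<^sup>+ u. f u z \<partial>U)
    \<le> Lp_norm q lborel (\<lambda>y. \<integral>\<^sup>+ u. Lp_norm p lborel (\<lambda>x. f u (x, y)) \<partial>U)"
    unfolding mnorm_def
  proof (rule Lp_norm_mono_AE)
    show "AE y in lborel. Lp_norm p lborel (\<lambda>x. \<integral>\<^sup>+ u. f u (x, y) \<partial>U)
         \<le> (\<integral>\<^sup>+ u. Lp_norm p lborel (\<lambda>x. f u (x, y)) \<partial>U)"
      by (intro AE_I2 Lp_norm_minkowski U sigma_finite_lborel p) measurable
    show "(\<lambda>y. Lp_norm p lborel (\<lambda>x. \<integral>\<^sup>+ u. f u (x, y) \<partial>U)) \<in> borel_measurable lborel"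
      using measurable_mnorm_inner[OF fu p] by simp
  qed (rule q)
  also have "\<dots> \<le> (\<integral>\<^sup>+ u. mnorm p q (f u) \<partial>U)"
    unfolding mnorm_def by (rule Lp_norm_minkowski[OF U sigma_finite_lborel q m1])
  finally show ?thesis .
qed

text \<open>A convolution is a superposition of translates, which all have the same norm; hence
  Minkowski gives the mass of the kernel as constant, one and the same for all \<open>p\<close> and
  \<open>q\<close>.\<close>

lemma mnorm_young:
  assumes A[measurable]: "A \<in> borel_measurable borel" and B[measurable]: "B \<in> borel_measurable borel"
    and k[measurable]: "\<kappa> \<in> borel_measurable borel"
    and le: "AE z in lborel. A z \<le> (\<integral>\<^sup>+ u. B u * \<kappa> (z - u) \<partial>lborel)"
  shows "mnorm p q A \<le> (\<integral>\<^sup>+ u. \<kappa> u \<partial>lborel) * mnorm p q B"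
proof -
  have eq: "(\<integral>\<^sup>+ u. B u * \<kappa> (z - u) \<partial>lborel) = (\<integral>\<^sup>+ u. \<kappa> u * B (z - u) \<partial>lborel)" for z
    using nn_integral_lborel_reflect[of "\<lambda>u. \<kappa> u * B (z - u)" z] by (simp add: mult.commute)
  have "mnorm p q A \<le> mnorm p q (\<lambda>z. \<integral>\<^sup>+ u. \<kappa> u * B (z - u) \<partial>lborel)"
    using le by (intro mnorm_mono_AE) (simp_all add: eq)
  also have "\<dots> \<le> (\<integral>\<^sup>+ u. mnorm p q (\<lambda>z. \<kappa> u * B (z - u)) \<partial>lborel)"
    by (rule mnorm_minkowski) (simp_all add: sigma_finite_lborel)
  also have "\<dots> \<le> (\<integral>\<^sup>+ u. \<kappa> u * mnorm p q B \<partial>lborel)"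
  proof (rule nn_integral_mono)
    fix u
    have Bu: "(\<lambda>z. B (z - u)) \<in> borel_measurable borel" by measurable
    have "mnorm p q (\<lambda>z. \<kappa> u * B (z - u)) \<le> \<kappa> u * mnorm p q (\<lambda>z. B (z - u))"
    proof -
      have [measurable]: "(\<lambda>z. B (z - u)) \<in> borel_measurable (borel \<Otimes>\<^sub>M borel)" using Bu by (simp add: borel_prod)
      have "mnorm p q (\<lambda>z. \<kappa> u * B (z - u))
        \<le> Lp_norm q lborel (\<lambda>y. \<kappa> u * Lp_norm p lborel (\<lambda>x. B ((x, y) - u)))"
        unfolding mnorm_def
        using measurable_mnorm_inner[of "\<lambda>z. \<kappa> u * B (z - u)", OF _ p]
        by (intro Lp_norm_mono_AE AE_I2 Lp_norm_cmult_le p q) auto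
      also have "\<dots> \<le> \<kappa> u * mnorm p q (\<lambda>z. B (z - u))"
        unfolding mnorm_def using measurable_mnorm_inner[OF Bu p]
        by (intro Lp_norm_cmult_le q) simp
      finally show ?thesis .
    qed
    also have "mnorm p q (\<lambda>z. B (z - u)) = mnorm p q B"
      using mnorm_translate[OF B, of "- u"] by simp
    finally show "mnorm p q (\<lambda>z. \<kappa> u * B (z - u)) \<le> \<kappa> u * mnorm p q B" .
  qed
  also have "\<dots> = (\<integral>\<^sup>+ u. \<kappa> u \<partial>lborel) * mnorm p q B"
    by (rule nn_integral_multc) simp
  finally show ?thesis .
qed

lemma mnorm_suminf:
  assumes [measurable]: "\<And>n::nat. f n \<in> borel_measurable borel"
  shows "mnorm p q (\<lambda>z. \<Sum>n. f n z) \<le> (\<Sum>n. mnorm p q (f n))"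
proof -
  have "(\<lambda>(n, z). f n z) \<in> borel_measurable (count_space UNIV \<Otimes>\<^sub>M borel)"
    by (rule measurable_pair_measure_countable1) auto
  from mnorm_minkowski[OF sigma_finite_measure_count_space this] show ?thesis
    by (simp add: nn_integral_count_space_nat)
qed

lemma mnorm_sum:
  assumes "finite I" and [measurable]: "\<And>i. i \<in> I \<Longrightarrow> f i \<in> borel_measurable borel"
  shows "mnorm p q (\<lambda>z. \<Sum>i\<in>I. f i z) \<le> (\<Sum>i\<in>I. mnorm p q (f i))"
proof -
  have "(\<lambda>(n, z). f n z) \<in> borel_measurable (count_space I \<Otimes>\<^sub>M borel)"
    by (rule measurable_pair_measure_countable1) (use assms in \<open>auto simp: countable_finite\<close>)
  from mnorm_minkowski[OF sigma_finite_measure_count_space_finite[OF assms(1)] this] show ?thesis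
    by (simp add: nn_integral_count_space_finite assms(1))
qed

end

subsection \<open>Fourier transforms of Gaussians\<close>

definition phase :: "real \<Rightarrow> complex" where "phase x = cis (2 * pi * x)"

lemma phase_eq: "phase x = exp (2 * of_real pi * \<i> * of_real x)"
  by (simp add: phase_def cis_conv_exp mult_ac)

lemma phase_0 [simp]: "phase 0 = 1"
  and norm_phase [simp]: "cmod (phase x) = 1"
  and phase_add: "phase (x + y) = phase x * phase y"
  and phase_minus: "phase (- x) = cnj (phase x)"
  and phase_cnj: "cnj (phase x) = phase (- x)"
  by (simp_all add: phase_def cis_mult distrib_left cis_cnj)

lemma phase_ne_0 [simp]: "phase x \<noteq> 0"
  by (simp add: phase_def)

lemma phase_mult_minus [simp]: "phase x * phase (- x) = 1" "phase (- x) * phase x = 1"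
  by (simp_all flip: phase_add)

lemma continuous_on_phase [continuous_intros]:
  "continuous_on A f \<Longrightarrow> continuous_on A (\<lambda>x. phase (f x))"
  unfolding phase_eq by (intro continuous_intros)

lemma tendsto_phase [tendsto_intros]:
  "(f \<longlongrightarrow> a) F \<Longrightarrow> ((\<lambda>x. phase (f x)) \<longlongrightarrow> phase a) F"
  unfolding phase_eq by (intro tendsto_intros)

lemma borel_measurable_phase [measurable]: "phase \<in> borel_measurable borel"
  by (intro borel_measurable_continuous_onI continuous_intros)

text \<open>The characteristic function of the standard normal distribution, rescaled:
  \<open>s\<close> matches the exponents, \<open>(s * x)\<^sup>2 / 2 = pi * a * x\<^sup>2\<close>,
  and \<open>t\<close> the frequencies, \<open>t * (s * x) = 2 * pi * (w * x)\<close>.\<close>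

lemma has_bochner_integral_gauss_real:
  assumes a: "0 < a"
  shows "has_bochner_integral lborel (\<lambda>x::real. of_real (exp (- pi * a * x\<^sup>2)) * phase (w * x))
    (of_real (exp (- pi * w\<^sup>2 / a) / sqrt a))"
proof -
  define s where "s = sqrt (2 * pi * a)"
  have s: "0 < s" "s\<^sup>2 = 2 * pi * a" using a by (auto simp: s_def)
  define t where "t = 2 * pi * w / s"
  define g where "g = (\<lambda>x. std_normal_density x *\<^sub>R exp (\<i> * of_real (t * x)))"
  have int: "integrable lborel g"
  proof (rule Bochner_Integration.integrable_bound[OF integrable_std_normal_moment[of 0]])
    show "g \<in> borel_measurable lborel" unfolding g_def by measurable
  qed (simp add: g_def)
  have "(LINT x|lborel. g x) = char std_normal_distribution t"
    unfolding char_def g_def by (subst integral_density) (auto simp: normal_density_nonneg)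
  then have "has_bochner_integral lborel g (of_real (exp (- t\<^sup>2 / 2)))"
    using int by (simp add: char_std_normal_distribution has_bochner_integral_iff)
  then have "has_bochner_integral lborel (\<lambda>x. g (0 + s * x)) (of_real (exp (- t\<^sup>2 / 2)) /\<^sub>R \<bar>s\<bar>)"
    using lborel_has_bochner_integral_real_affine_iff[of s g "of_real (exp (- t\<^sup>2 / 2))" 0] s by simp
  then have "has_bochner_integral lborel (\<lambda>x. of_real (sqrt (2 * pi)) * g (0 + s * x))
      (of_real (sqrt (2 * pi)) * (of_real (exp (- t\<^sup>2 / 2)) /\<^sub>R \<bar>s\<bar>))"
    by (rule has_bochner_integral_mult_right)
  also have "(\<lambda>x. of_real (sqrt (2 * pi)) * g (0 + s * x))
      = (\<lambda>x. of_real (exp (- pi * a * x\<^sup>2)) * phase (w * x))"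
  proof
    fix x
    have *: "t * (s * x) = 2 * pi * (w * x)" using s by (simp add: t_def)
    show "of_real (sqrt (2 * pi)) * g (0 + s * x) = of_real (exp (- pi * a * x\<^sup>2)) * phase (w * x)"
      using s unfolding g_def add_0 * phase_def cis_conv_exp
      by (simp add: std_normal_density_def power_mult_distrib scaleR_conv_of_real flip: of_real_mult)
  qed
  also have "of_real (sqrt (2 * pi)) * (of_real (exp (- t\<^sup>2 / 2)) /\<^sub>R \<bar>s\<bar>)
      = complex_of_real (exp (- pi * w\<^sup>2 / a) / sqrt a)"
  proof -
    have "t\<^sup>2 / 2 = pi * w\<^sup>2 / a"
      using s a by (simp add: t_def power_divide power_mult_distrib field_simps power2_eq_square)
    moreover have "s = sqrt (2 * pi) * sqrt a" using a by (simp add: s_def real_sqrt_mult)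
    ultimately show ?thesis
      using s a by (simp add: scaleR_conv_of_real field_simps flip: of_real_mult of_real_inverse)
  qed
  finally show ?thesis .
qed

lemma has_bochner_integral_lborel_prod_Basis:
  fixes f :: "'a::euclidean_space \<Rightarrow> real \<Rightarrow> complex"
  assumes "\<And>b. b \<in> Basis \<Longrightarrow> has_bochner_integral lborel (f b) (I b)"
  shows "has_bochner_integral lborel (\<lambda>x::'a. \<Prod>b\<in>Basis. f b (x \<bullet> b)) (\<Prod>b\<in>Basis. I b)"
proof -
  interpret product_sigma_finite "\<lambda>_::'a. lborel :: real measure"
    by (simp add: product_sigma_finite_def sigma_finite_lborel)
  let ?P = "Pi\<^sub>M Basis (\<lambda>_::'a. lborel :: real measure)"
  let ?T = "\<lambda>g. \<Sum>b\<in>Basis. g b *\<^sub>R b :: 'a"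
  have int: "integrable lborel (f b)" "(LINT x|lborel. f b x) = I b" if "b \<in> Basis" for b
    using assms[OF that] by (auto simp: has_bochner_integral_iff)
  have [measurable]: "f b \<in> borel_measurable borel" if "b \<in> Basis" for b
    using int(1)[OF that] by auto
  have [measurable]: "?T \<in> ?P \<rightarrow>\<^sub>M borel" by measurable
  have [measurable]: "(\<lambda>x::'a. \<Prod>b\<in>Basis. f b (x \<bullet> b)) \<in> borel_measurable borel" by measurable
  have eq: "(\<Prod>b\<in>Basis. f b (?T g \<bullet> b)) = (\<Prod>b\<in>Basis. f b (g b))" for g
    by (intro prod.cong) (simp_all add: inner_sum_left_Basis)
  have "integrable (distr ?P borel ?T) (\<lambda>x::'a. \<Prod>b\<in>Basis. f b (x \<bullet> b))"
    using int(1) by (simp add: integrable_distr_eq eq product_integrable_prod)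
  moreover have "(LINT x|distr ?P borel ?T. (\<Prod>b\<in>Basis. f b (x \<bullet> b))) = (\<Prod>b\<in>Basis. I b)"
    using int by (simp add: integral_distr eq product_integral_prod)
  moreover have "(lborel :: 'a measure) = distr ?P borel ?T" by (rule lborel_eq)
  ultimately show ?thesis unfolding has_bochner_integral_iff by metis
qed

lemma has_bochner_integral_gauss:
  fixes w :: "'a::euclidean_space"
  assumes a: "0 < a"
  shows "has_bochner_integral lborel (\<lambda>x::'a. of_real (exp (- pi * a * (x \<bullet> x))) * phase (w \<bullet> x))
    (of_real (exp (- pi * (w \<bullet> w) / a) / sqrt a ^ DIM('a)))"
proof -
  have "has_bochner_integral lborel
      (\<lambda>x::'a. \<Prod>b\<in>Basis. of_real (exp (- pi * a * (x \<bullet> b)\<^sup>2)) * phase ((w \<bullet> b) * (x \<bullet> b)))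
      (\<Prod>b\<in>Basis. of_real (exp (- pi * (w \<bullet> b)\<^sup>2 / a) / sqrt a))"
    by (intro has_bochner_integral_lborel_prod_Basis has_bochner_integral_gauss_real a)
  moreover have "(\<Prod>b\<in>Basis. of_real (exp (- pi * a * (x \<bullet> b)\<^sup>2)) * phase ((w \<bullet> b) * (x \<bullet> b)))
      = of_real (exp (- pi * a * (x \<bullet> x))) * phase (w \<bullet> x)" for x :: 'a
  proof -
    have "(\<Prod>b\<in>Basis. exp (- pi * a * (x \<bullet> b)\<^sup>2)) = exp (- pi * a * (x \<bullet> x))"
      by (simp add: exp_sum[symmetric] euclidean_inner[of x x] power2_eq_square sum_distrib_left sum_negf)
    moreover have "(\<Prod>b\<in>Basis. phase ((w \<bullet> b) * (x \<bullet> b))) = phase (w \<bullet> x)"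
      by (simp add: phase_eq exp_sum[symmetric] euclidean_inner[of w x] sum_distrib_left)
    ultimately show ?thesis by (simp add: prod.distrib flip: of_real_prod)
  qed
  moreover have "(\<Prod>b\<in>Basis. of_real (exp (- pi * (w \<bullet> b)\<^sup>2 / a) / sqrt a))
      = complex_of_real (exp (- pi * (w \<bullet> w) / a) / sqrt a ^ DIM('a))"
  proof -
    have "(\<Prod>b\<in>Basis. exp (- pi * (w \<bullet> b)\<^sup>2 / a)) = exp (- pi * (w \<bullet> w) / a)"
      by (simp add: exp_sum[symmetric] euclidean_inner[of w w] power2_eq_square sum_distrib_left sum_negf
          sum_divide_distrib)
    then show ?thesis by (simp add: prod_dividef flip: of_real_prod)
  qed
  ultimately show ?thesis by simp
qed

lemma integrable_gauss:
  "0 < a \<Longrightarrow> integrable lborel (\<lambda>x::'a::euclidean_space. exp (- pi * a * (x \<bullet> x)))"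
  using has_bochner_integral_gauss[of a "0::'a"]
    complex_of_real_integrable_eq[of lborel "\<lambda>x::'a. exp (- pi * a * (x \<bullet> x))"]
  by (simp add: has_bochner_integral_iff)

lemma integrable_gauss_exp_norm:
  assumes "0 < a"
  shows "integrable lborel (\<lambda>x::'a::euclidean_space. exp (- a * (norm x)\<^sup>2 + b * norm x))"
proof -
  define C where "C = exp (b\<^sup>2 / (2 * a))"
  \<comment> \<open>Half of the quadratic term absorbs the linear one, at the price of the factor
    \<open>C\<close>.\<close>
  have "- a * t\<^sup>2 + b * t \<le> b\<^sup>2 / (2 * a) - (a / 2) * t\<^sup>2" for t
  proof -
    have "0 \<le> (a * t - b)\<^sup>2 / (2 * a)" using assms by simp
    then show ?thesis using assms by (simp add: field_simps power2_eq_square)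
  qed
  then have *: "exp (- a * t\<^sup>2 + b * t) \<le> C * exp (- pi * (a / (2 * pi)) * t\<^sup>2)" for t
    by (simp add: C_def flip: exp_add)
  have "integrable lborel (\<lambda>x::'a. C * exp (- pi * (a / (2 * pi)) * (x \<bullet> x)))"
    using assms by (intro integrable_mult_right integrable_gauss) simp
  then show ?thesis
  proof (rule Bochner_Integration.integrable_bound)
    have "exp (- a * (norm x)\<^sup>2 + b * norm x) \<le> C * exp (- pi * (a / (2 * pi)) * (x \<bullet> x))" for x :: 'a
      using *[of "norm x"] by (simp add: power2_norm_eq_inner)
    then show "AE x::'a in lborel. norm (exp (- a * (norm x)\<^sup>2 + b * norm x))
        \<le> norm (C * exp (- pi * (a / (2 * pi)) * (x \<bullet> x)))"
      by (intro AE_I2) (simp add: C_def)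
  qed measurable
qed

subsection \<open>Time-frequency shifts\<close>

lemma tf_shift_apply: "tf_shift z f t = phase (snd z \<bullet> t) * f (t - fst z)"
  by (simp add: tf_shift_def modulation_def translation_def phase_eq)

text \<open>The shifts form a projective representation; its cocycle reappears in
  \<open>osc_phase\<close> and in the phases of the Gabor coefficients.\<close>

lemma tf_shift_tf_shift:
  "tf_shift z (tf_shift w f) t = phase (- (snd w \<bullet> fst z)) * tf_shift (z + w) f t"
proof -
  have "phase (snd z \<bullet> t) * phase (snd w \<bullet> (t - fst z))
      = phase (- (snd w \<bullet> fst z)) * phase (snd (z + w) \<bullet> t)"
    by (simp add: inner_diff_right inner_add_left algebra_simps flip: phase_add)
  moreover have "t - fst z - fst w = t - fst (z + w)" by simp
  ultimately show ?thesis by (simp only: tf_shift_apply mult.assoc[symmetric])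
qed

lemma tf_shift_0 [simp]: "tf_shift 0 f = f"
  by (simp add: fun_eq_iff tf_shift_apply)

lemma cnj_gaussian [simp]: "cnj (gaussian t) = gaussian t"
  by (simp add: gaussian_def)

lemma continuous_on_gaussian [continuous_intros]:
  "continuous_on A f \<Longrightarrow> continuous_on A (\<lambda>x. gaussian (f x))"
  unfolding gaussian_def by (intro continuous_intros)

lemma measurable_gaussian [measurable]: "gaussian \<in> borel_measurable borel"
  by (intro borel_measurable_continuous_onI continuous_intros)

lemma measurable_tf_shift_gaussian [measurable]:
  "(\<lambda>(u, t). tf_shift u gaussian t) \<in> borel_measurable (borel \<Otimes>\<^sub>M borel)"
  unfolding borel_prod tf_shift_apply split_beta'
  by (intro borel_measurable_continuous_onI continuous_intros)

text \<open>Parallelogram identity: the squared distances from \<open>t\<close> to \<open>a\<close>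
  and to \<open>b\<close> add up to twice the squared distance to the midpoint plus half of
  \<open>(norm (a - b))\<^sup>2\<close>.\<close>

lemma gaussian_mult:
  "gaussian (t - a) * gaussian (t - b) =
    of_real (exp (- pi / 2 * (norm (a - b))\<^sup>2) * exp (- pi * 2 * ((t - (1/2) *\<^sub>R (a + b)) \<bullet> (t - (1/2) *\<^sub>R (a + b)))))"
proof -
  have "- pi * ((t - a) \<bullet> (t - a)) + - pi * ((t - b) \<bullet> (t - b)) = - pi / 2 * (norm (a - b))\<^sup>2
     + (- pi * 2 * ((t - (1/2) *\<^sub>R (a + b)) \<bullet> (t - (1/2) *\<^sub>R (a + b))))"
    unfolding power2_norm_eq_inner
    by (simp add: inner_diff_left inner_diff_right inner_add_left inner_add_right inner_commute algebra_simps)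
  then show ?thesis
    by (simp add: gaussian_def flip: of_real_mult exp_add)
qed

lemma integrable_gaussian_mult:
  "integrable lborel (\<lambda>t. gaussian (t - a) * gaussian (t - b))"
  unfolding gaussian_mult of_real_mult
  using integrable_lborel_translate[OF integrable_gauss[of 2], of "- (1/2) *\<^sub>R (a + b)"]
  by (intro integrable_mult_right) (simp add: complex_of_real_integrable_eq)

subsection \<open>Square integrable functions\<close>

lemma borel_measurable_cnj [measurable]: "cnj \<in> borel_measurable borel"
  by (intro borel_measurable_continuous_onI continuous_intros)

lemma L2_space_measurable: "f \<in> L2_space \<Longrightarrow> f \<in> borel_measurable lebesgue"
  by (simp add: L2_space_def)

lemma nn_integral_lebesgue_translate:
  fixes f :: "'a::euclidean_space \<Rightarrow> ennreal"
  assumes "f \<in> borel_measurable lebesgue"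
  shows "(\<integral>\<^sup>+ x. f (x + a) \<partial>lebesgue) = (\<integral>\<^sup>+ x. f x \<partial>lebesgue)"
proof -
  obtain g where g[measurable]: "g \<in> borel_measurable lborel" and eq: "AE x in lborel. f x = g x"
    using completion_ex_borel_measurable[OF assms] by auto
  have "(\<integral>\<^sup>+ x. f (x + a) \<partial>lebesgue) = (\<integral>\<^sup>+ x. g (x + a) \<partial>lborel)"
    using AE_lborel_translate[OF eq, of a] by (simp add: nn_integral_completion nn_integral_cong_AE)
  also have "\<dots> = (\<integral>\<^sup>+ x. g x \<partial>lborel)"
    using g by (intro nn_integral_lborel_translate) simp
  also have "\<dots> = (\<integral>\<^sup>+ x. f x \<partial>lebesgue)"
    unfolding nn_integral_completion by (rule nn_integral_cong_AE) (use eq in auto)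
  finally show ?thesis .
qed

lemma borel_measurable_lebesgue_translate:
  fixes f :: "'a::euclidean_space \<Rightarrow> complex"
  assumes "f \<in> borel_measurable lebesgue"
  shows "(\<lambda>x. f (x + a)) \<in> borel_measurable lebesgue"
proof -
  obtain g where g[measurable]: "g \<in> borel_measurable lborel" and eq: "AE x in lborel. f x = g x"
    using borel_measurable_completion_complex[OF assms] by auto
  have "(\<lambda>x. g (x + a)) \<in> borel_measurable lebesgue"
    using g by (intro measurable_completion) simp
  moreover have "AE x in lebesgue. g (x + a) = f (x + a)"
    unfolding AE_completion_iff using AE_lborel_translate[OF eq, of a] by (auto elim!: eventually_mono)
  ultimately show ?thesis by (rule borel_measurable_completion_AE)
qed

text \<open>Fubini over products of Borel measures is applied to a Borel representative; the last
  conclusion lets every pairing with a Borel function be computed with it.\<close>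

lemma L2_space_obtain_borel:
  assumes "w \<in> L2_space"
  obtains w' where "w' \<in> borel_measurable borel" "AE t in lborel. w t = w' t" "w' \<in> L2_space"
    "integrable lborel (\<lambda>t. (cmod (w' t))\<^sup>2)"
    "\<And>g. g \<in> borel_measurable borel \<Longrightarrow> L2_inner w g = (LINT t|lborel. w' t * cnj (g t))"
proof -
  have w[measurable]: "w \<in> borel_measurable lebesgue" and int: "integrable lebesgue (\<lambda>t. (cmod (w t))\<^sup>2)"
    using assms by (auto simp: L2_space_def)
  obtain w' where w': "w' \<in> borel_measurable lborel" and eq: "AE t in lborel. w t = w' t"
    using borel_measurable_completion_complex[OF w] by blast
  have [measurable]: "w' \<in> borel_measurable lebesgue" "w' \<in> borel_measurable borel"
    using w' by (auto intro: measurable_completion)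
  have eq': "AE t in lebesgue. w t = w' t" using eq by (simp add: AE_completion_iff)
  have "integrable lebesgue (\<lambda>t. (cmod (w' t))\<^sup>2) \<longleftrightarrow> integrable lebesgue (\<lambda>t. (cmod (w t))\<^sup>2)"
    using eq' by (intro integrable_cong_AE) (auto elim!: eventually_mono)
  with int have int': "integrable lebesgue (\<lambda>t. (cmod (w' t))\<^sup>2)" by simp
  show thesis
  proof
    show "w' \<in> borel_measurable borel" by simp
    show "w' \<in> L2_space" using int' by (simp add: L2_space_def)
    show "integrable lborel (\<lambda>t. (cmod (w' t))\<^sup>2)"
      using int' by (subst (asm) integrable_completion) auto
    fix g :: "real^'a \<Rightarrow> complex" assume [measurable]: "g \<in> borel_measurable borel"
    have [measurable]: "g \<in> borel_measurable lebesgue" by (auto intro: measurable_completion)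
    have "L2_inner w g = (LINT t|lebesgue. w' t * cnj (g t))"
      unfolding L2_inner_def using eq' by (intro integral_cong_AE) (measurable, auto elim!: eventually_mono)
    also have "\<dots> = (LINT t|lborel. w' t * cnj (g t))"
      by (rule integral_completion) measurable
    finally show "L2_inner w g = (LINT t|lborel. w' t * cnj (g t))" .
  qed fact
qed

lemma integrable_L2_mult:
  assumes "f \<in> L2_space" "g \<in> L2_space"
  shows "integrable lebesgue (\<lambda>t. f t * cnj (g t))"
proof (rule Bochner_Integration.integrable_bound)
  show "integrable lebesgue (\<lambda>t. (cmod (f t))\<^sup>2 + (cmod (g t))\<^sup>2)"
    using assms by (simp add: L2_space_def)
  have "cmod a * cmod b \<le> (cmod a)\<^sup>2 + (cmod b)\<^sup>2" for a b
    using sum_squares_bound[of "cmod a" "cmod b"] zero_le_power2[of "cmod a"] zero_le_power2[of "cmod b"]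
      mult_nonneg_nonneg[OF norm_ge_zero[of a] norm_ge_zero[of b]]
    by linarith
  then show "AE t in lebesgue. norm (f t * cnj (g t)) \<le> norm ((cmod (f t))\<^sup>2 + (cmod (g t))\<^sup>2)"
    by (simp add: norm_mult)
next
  note [measurable] = assms[THEN L2_space_measurable]
  show "(\<lambda>t. f t * cnj (g t)) \<in> borel_measurable lebesgue" by measurable
qed

text \<open>Cauchy-Schwarz in the form of the weighted inequality between arithmetic and geometric
  mean. The weight \<open>s\<close> is left to the caller, who balances a small norm against a fixed
  one.\<close>

lemma norm_L2_inner_le:
  assumes "f \<in> L2_space" "g \<in> L2_space" and s: "0 < s"
  shows "cmod (L2_inner f g)
    \<le> (s * (LINT t|lebesgue. (cmod (f t))\<^sup>2) + (LINT t|lebesgue. (cmod (g t))\<^sup>2) / s) / 2"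
proof -
  have *: "cmod a * cmod b \<le> (s * (cmod a)\<^sup>2 + (cmod b)\<^sup>2 / s) / 2" for a b
  proof -
    have "0 \<le> (s * cmod a - cmod b)\<^sup>2 / s" using s by simp
    then show ?thesis using s by (simp add: power2_diff field_simps power2_eq_square)
  qed
  have "cmod (L2_inner f g) \<le> (LINT t|lebesgue. cmod (f t * cnj (g t)))"
    unfolding L2_inner_def by (rule integral_norm_bound)
  also have "\<dots> \<le> (LINT t|lebesgue. (s * (cmod (f t))\<^sup>2 + (cmod (g t))\<^sup>2 / s) / 2)"
    using assms integrable_L2_mult[OF assms(1,2)]
  proof (intro integral_mono integrable_norm)
    show "cmod (f t * cnj (g t)) \<le> (s * (cmod (f t))\<^sup>2 + (cmod (g t))\<^sup>2 / s) / 2" for t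
      using *[of "f t" "g t"] by (simp add: norm_mult)
  qed (auto simp: L2_space_def)
  also have "\<dots> = (s * (LINT t|lebesgue. (cmod (f t))\<^sup>2) + (LINT t|lebesgue. (cmod (g t))\<^sup>2) / s) / 2"
    using assms by (simp add: L2_space_def)
  finally show ?thesis .
qed

lemma L2_space_add: "f \<in> L2_space \<Longrightarrow> g \<in> L2_space \<Longrightarrow> (\<lambda>t. f t + g t) \<in> L2_space"
proof -
  assume f: "f \<in> L2_space" and g: "g \<in> L2_space"
  note [measurable] = f[THEN L2_space_measurable] g[THEN L2_space_measurable]
  have "integrable lebesgue (\<lambda>t. (cmod (f t + g t))\<^sup>2)"
  proof (rule Bochner_Integration.integrable_bound)
    show "integrable lebesgue (\<lambda>t. 2 * (cmod (f t))\<^sup>2 + 2 * (cmod (g t))\<^sup>2)"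
      using f g by (simp add: L2_space_def)
    have "(cmod (a + b))\<^sup>2 \<le> 2 * (cmod a)\<^sup>2 + 2 * (cmod b)\<^sup>2" for a b
    proof -
      have "(cmod (a + b))\<^sup>2 \<le> (cmod a + cmod b)\<^sup>2"
        by (intro power_mono norm_triangle_ineq) simp
      also have "\<dots> \<le> 2 * (cmod a)\<^sup>2 + 2 * (cmod b)\<^sup>2"
        using sum_squares_bound[of "cmod a" "cmod b"] by (simp add: power2_sum)
      finally show ?thesis .
    qed
    then show "AE t in lebesgue. norm ((cmod (f t + g t))\<^sup>2) \<le> norm (2 * (cmod (f t))\<^sup>2 + 2 * (cmod (g t))\<^sup>2)"
      by simp
  qed measurable
  then show ?thesis by (simp add: L2_space_def)
qed

lemma L2_space_cmult: "f \<in> L2_space \<Longrightarrow> (\<lambda>t. c * f t) \<in> L2_space"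
proof -
  assume f: "f \<in> L2_space"
  note [measurable] = f[THEN L2_space_measurable]
  have "(\<lambda>t. c * f t) \<in> borel_measurable lebesgue" by measurable
  with f show ?thesis by (simp add: L2_space_def norm_mult power_mult_distrib)
qed

lemma L2_space_0: "(\<lambda>t. 0) \<in> L2_space"
  by (simp add: L2_space_def)

lemma L2_inner_add_left:
  "f \<in> L2_space \<Longrightarrow> g \<in> L2_space \<Longrightarrow> h \<in> L2_space \<Longrightarrow>
    L2_inner (\<lambda>t. f t + g t) h = L2_inner f h + L2_inner g h"
  using integrable_L2_mult[of f h] integrable_L2_mult[of g h]
  by (simp add: L2_inner_def distrib_right)

lemma L2_inner_cmult_left: "L2_inner (\<lambda>t. c * f t) h = c * L2_inner f h"
  by (simp add: L2_inner_def mult.assoc)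

lemma L2_inner_0 [simp]: "L2_inner (\<lambda>t. 0) h = 0"
  by (simp add: L2_inner_def)

lemma L2_space_tf_shift:
  assumes "f \<in> L2_space"
  shows "tf_shift z f \<in> L2_space"
proof -
  have f: "f \<in> borel_measurable lebesgue" and int: "integrable lebesgue (\<lambda>t. (cmod (f t))\<^sup>2)"
    using assms by (auto simp: L2_space_def)
  have [measurable]: "(\<lambda>t. f (t - fst z)) \<in> borel_measurable lebesgue"
    using borel_measurable_lebesgue_translate[OF f, of "- fst z"] by simp
  have [measurable]: "(\<lambda>t. phase (snd z \<bullet> t)) \<in> borel_measurable lebesgue"
    by (intro measurable_completion) measurable
  have m: "tf_shift z f \<in> borel_measurable lebesgue"
    unfolding tf_shift_apply[abs_def] by measurable
  have "(\<integral>\<^sup>+ t. ennreal ((cmod (f (t - fst z)))\<^sup>2) \<partial>lebesgue) = (\<integral>\<^sup>+ t. ennreal ((cmod (f t))\<^sup>2) \<partial>lebesgue)"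
    using nn_integral_lebesgue_translate[of "\<lambda>t. ennreal ((cmod (f t))\<^sup>2)" "- fst z"] f by simp
  then have "integrable lebesgue (\<lambda>t. (cmod (tf_shift z f t))\<^sup>2)"
    using int m by (simp add: integrable_iff_bounded tf_shift_apply norm_mult)
  with m show ?thesis by (simp add: L2_space_def)
qed

lemma L2_space_gaussian: "gaussian \<in> L2_space"
proof -
  have "integrable lborel (\<lambda>t::real^'a. cmod (gaussian (t - 0) * gaussian (t - 0)))"
    by (intro integrable_norm integrable_gaussian_mult)
  then have "integrable lebesgue (\<lambda>t::real^'a. (cmod (gaussian t))\<^sup>2)"
    by (subst integrable_completion) (auto simp: norm_mult power2_eq_square)
  then show ?thesis by (simp add: L2_space_def measurable_completion)
qed

lemmas L2_space_gaussian_shift [simp] = L2_space_tf_shift[OF L2_space_gaussian]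

subsection \<open>The short-time Fourier transform with Gaussian window\<close>

definition gst :: "(real^'d::finite \<Rightarrow> complex) \<Rightarrow> 'd tfplane \<Rightarrow> complex" where
  "gst w u = L2_inner w (tf_shift u gaussian)"

text \<open>The Gram kernel of the shifted Gaussians. Multiplied by
  \<open>sqrt 2 ^ CARD('d)\<close>, the reciprocal of the squared norm of the Gaussian, it becomes
  the reproducing kernel of the range of \<open>gst\<close>.\<close>

definition gker :: "'d::finite tfplane \<Rightarrow> 'd tfplane \<Rightarrow> complex" where
  "gker u z = gst (tf_shift u gaussian) z"

lemma L2_inner_borel:
  assumes [measurable]: "f \<in> borel_measurable borel" "g \<in> borel_measurable borel"
  shows "L2_inner f g = (LINT t|lborel. f t * cnj (g t))"
  unfolding L2_inner_def by (rule integral_completion) measurable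

text \<open>The product of the two translated Gaussians is a Gaussian centred at the midpoint, so
  the pairing is its Fourier transform at the difference of the frequencies. The centre accounts for
  the phase.\<close>

lemma gker_eq:
  fixes u z :: "'d::finite tfplane"
  shows "gker u z = of_real (exp (- pi / 2 * (norm (u - z))\<^sup>2) / sqrt 2 ^ CARD('d))
    * phase ((snd u - snd z) \<bullet> ((1/2) *\<^sub>R (fst u + fst z)))"
proof -
  define w where "w = snd u - snd z"
  define p where "p = (1/2) *\<^sub>R (fst u + fst z)"
  define E where "E = exp (- pi / 2 * (norm (fst u - fst z))\<^sup>2)"
  define h :: "real^'d \<Rightarrow> complex" where
    "h = (\<lambda>t. of_real (exp (- pi * 2 * (t \<bullet> t))) * phase (w \<bullet> t))"
  have [measurable]: "h \<in> borel_measurable borel" unfolding h_def by measurable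
  have eq: "tf_shift u gaussian t * cnj (tf_shift z gaussian t)
      = of_real E * phase (w \<bullet> p) * h (t + - p)" for t
  proof -
    have "tf_shift u gaussian t * cnj (tf_shift z gaussian t)
      = phase (w \<bullet> t) * (gaussian (t - fst u) * gaussian (t - fst z))"
    proof -
      have "phase (w \<bullet> t) = phase (snd u \<bullet> t) * phase (- (snd z \<bullet> t))"
        by (simp add: w_def inner_diff_left flip: phase_add)
      then show ?thesis by (simp add: tf_shift_apply phase_cnj mult_ac)
    qed
    also have "\<dots> = of_real E * (phase (w \<bullet> t) * of_real (exp (- pi * 2 * ((t - p) \<bullet> (t - p)))))"
      by (simp add: gaussian_mult E_def p_def)
    also have "phase (w \<bullet> t) = phase (w \<bullet> p) * phase (w \<bullet> (t - p))"
      by (simp add: inner_diff_right flip: phase_add)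
    finally show ?thesis by (simp add: h_def mult_ac)
  qed
  have "gker u z = of_real E * phase (w \<bullet> p) * (LINT t|lborel. h (t + - p))"
    unfolding gker_def gst_def by (subst L2_inner_borel) (simp_all add: eq)
  also have "(LINT t|lborel. h (t + - p)) = (LINT t|lborel. h t)"
    by (rule integral_lborel_translate) measurable
  also have "(LINT t|lborel. h t) = of_real (exp (- pi * (w \<bullet> w) / 2) / sqrt 2 ^ CARD('d))"
    using has_bochner_integral_gauss[of 2 w] by (simp add: has_bochner_integral_iff h_def)
  also have "of_real E * phase (w \<bullet> p) * of_real (exp (- pi * (w \<bullet> w) / 2) / sqrt 2 ^ CARD('d))
     = of_real (exp (- pi / 2 * (norm (u - z))\<^sup>2) / sqrt 2 ^ CARD('d)) * phase (w \<bullet> p)"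
  proof -
    have "(norm (u - z))\<^sup>2 = (norm (fst u - fst z))\<^sup>2 + w \<bullet> w"
      by (simp add: norm_prod_def w_def power2_norm_eq_inner)
    then have "E * exp (- pi * (w \<bullet> w) / 2) = exp (- pi / 2 * (norm (u - z))\<^sup>2)"
      by (simp add: E_def algebra_simps flip: exp_add)
    then show ?thesis by (simp flip: of_real_mult)
  qed
  finally show ?thesis by (simp add: w_def p_def)
qed

lemma norm_gker:
  "cmod (gker u (z::'d::finite tfplane)) = exp (- pi / 2 * (norm (u - z))\<^sup>2) / sqrt 2 ^ CARD('d)"
  by (simp add: gker_eq norm_mult norm_divide norm_power)

lemma norm_gker_le: "cmod (gker u z) \<le> exp (- pi / 2 * (norm (u - z))\<^sup>2)"
proof -
  have "exp (- pi / 2 * (norm (u - z))\<^sup>2) * 1 \<le> exp (- pi / 2 * (norm (u - z))\<^sup>2) * sqrt 2 ^ CARD('a)"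
    by (intro mult_left_mono one_le_power) auto
  then show ?thesis by (simp add: norm_gker divide_le_eq)
qed

lemma gker_cnj: "cnj (gker u z) = gker z u"
  unfolding gker_eq
  by (simp add: phase_cnj norm_minus_commute add.commute inner_diff_left diff_divide_distrib)

lemma gker_self: "gker u (u::'d::finite tfplane) = of_real (1 / sqrt 2 ^ CARD('d))"
  by (simp add: gker_eq)

lemma measurable_gker [measurable]: "(\<lambda>(u::'d::finite tfplane, z). gker u z) \<in> borel_measurable (borel \<Otimes>\<^sub>M borel)"
proof -
  have "continuous_on UNIV (\<lambda>(u::'d tfplane, z). gker u z)"
    unfolding gker_eq split_beta' by (intro continuous_intros) auto
  then show ?thesis unfolding borel_prod by (rule borel_measurable_continuous_onI)
qed

lemma LINT_norm2_gaussian_shift: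
  "(LINT t|lebesgue. (cmod (tf_shift u gaussian t))\<^sup>2) = 1 / sqrt 2 ^ CARD('d)"
  for u :: "'d::finite tfplane"
proof -
  have "of_real (LINT t|lebesgue. (cmod (tf_shift u gaussian t))\<^sup>2) = gker u u"
    unfolding gker_def gst_def L2_inner_def complex_norm_square[symmetric] integral_complex_of_real ..
  then show ?thesis unfolding gker_self of_real_eq_iff .
qed

lemma measurable_gst:
  assumes "w \<in> L2_space"
  shows "gst w \<in> borel_measurable borel"
proof -
  obtain w' where [measurable]: "w' \<in> borel_measurable borel"
    and eq: "\<And>g. g \<in> borel_measurable borel \<Longrightarrow> L2_inner w g = (LINT t|lborel. w' t * cnj (g t))"
    using L2_space_obtain_borel[OF assms] by metis
  have "(\<lambda>u. LINT t|lborel. w' t * cnj (tf_shift u gaussian t)) \<in> borel_measurable borel"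
    by measurable
  then show ?thesis by (simp add: gst_def[abs_def] eq)
qed

lemma gst_bounded:
  assumes "w \<in> L2_space"
  obtains C where "\<And>u. cmod (gst w u) \<le> C" "0 \<le> C"
proof
  let ?C = "((LINT t|lebesgue. (cmod (w t))\<^sup>2) + 1 / sqrt 2 ^ CARD('a)) / 2"
  show "cmod (gst w u) \<le> ?C" for u
    using norm_L2_inner_le[OF assms L2_space_gaussian_shift, of 1 u]
    by (simp add: gst_def LINT_norm2_gaussian_shift)
  show "0 \<le> ?C" by simp
qed

lemma gst_add: "f \<in> L2_space \<Longrightarrow> g \<in> L2_space \<Longrightarrow> gst (\<lambda>t. f t + g t) u = gst f u + gst g u"
  by (simp add: gst_def L2_inner_add_left)

lemma gst_cmult: "gst (\<lambda>t. c * f t) u = c * gst f u"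
  by (simp add: gst_def L2_inner_cmult_left)

lemma gst_0 [simp]: "gst (\<lambda>t. 0) u = 0"
  by (simp add: gst_def)

text \<open>Covariance, from the substitution of \<open>t + fst z\<close> for \<open>t\<close> on a
  Borel representative.\<close>

lemma gst_tf_shift:
  assumes "w \<in> L2_space"
  shows "gst (tf_shift z w) u = phase ((snd z - snd u) \<bullet> fst z) * gst w (u - z)"
proof -
  obtain w' where w'[measurable]: "w' \<in> borel_measurable borel" and ae: "AE t in lborel. w t = w' t"
    and "w' \<in> L2_space"
    and eq: "\<And>g. g \<in> borel_measurable borel \<Longrightarrow> L2_inner w g = (LINT t|lborel. w' t * cnj (g t))"
    using L2_space_obtain_borel[OF assms] by metis
  have m[measurable]: "tf_shift z w' \<in> borel_measurable borel"
    unfolding tf_shift_apply[abs_def] by measurable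
  have "AE t in lborel. tf_shift z w t = tf_shift z w' t"
    using AE_lborel_translate[OF ae, of "- fst z"] by (auto elim!: eventually_mono simp: tf_shift_apply)
  then have ae': "AE t in lebesgue. tf_shift z w t = tf_shift z w' t"
    by (simp add: AE_completion_iff)
  note [measurable] = L2_space_measurable[OF L2_space_tf_shift[OF assms]]
    L2_space_measurable[OF L2_space_tf_shift[OF \<open>w' \<in> L2_space\<close>]]
    L2_space_measurable[OF L2_space_gaussian_shift]
  have "gst (tf_shift z w) u = L2_inner (tf_shift z w') (tf_shift u gaussian)"
    unfolding gst_def L2_inner_def using ae'
    by (intro integral_cong_AE) (measurable, auto elim!: eventually_mono)
  also have "\<dots> = (LINT t|lborel. tf_shift z w' t * cnj (tf_shift u gaussian t))"
    by (rule L2_inner_borel) measurable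
  also have "\<dots> = (LINT t|lborel. tf_shift z w' (t + fst z) * cnj (tf_shift u gaussian (t + fst z)))"
    by (rule integral_lborel_translate[symmetric]) measurable
  also have "\<dots> = (LINT t|lborel. phase ((snd z - snd u) \<bullet> fst z) * (w' t * cnj (tf_shift (u - z) gaussian t)))"
  proof (intro Bochner_Integration.integral_cong refl)
    fix t
    have p: "phase (snd z \<bullet> (t + fst z)) * phase (- (snd u \<bullet> (t + fst z)))
      = phase ((snd z - snd u) \<bullet> fst z) * phase (- ((snd u - snd z) \<bullet> t))"
      by (simp add: inner_diff_left inner_add_right algebra_simps flip: phase_add)
    have e: "t + fst z - fst u = t - (fst u - fst z)" by simp
    show "tf_shift z w' (t + fst z) * cnj (tf_shift u gaussian (t + fst z))
      = phase ((snd z - snd u) \<bullet> fst z) * (w' t * cnj (tf_shift (u - z) gaussian t))"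
      using p by (simp add: tf_shift_apply phase_cnj mult_ac e)
  qed
  also have "\<dots> = phase ((snd z - snd u) \<bullet> fst z) * gst w (u - z)"
    by (simp add: gst_def eq)
  finally show ?thesis .
qed

lemma norm_gst_tf_shift: "w \<in> L2_space \<Longrightarrow> cmod (gst (tf_shift z w) u) = cmod (gst w (u - z))"
  by (simp add: gst_tf_shift norm_mult)

subsection \<open>The reproducing formula\<close>

lemma gker_shift:
  "L2_inner (tf_shift u (tf_shift r gaussian)) (tf_shift y gaussian)
    = phase (- (snd r \<bullet> fst u)) * gker (u + r) y"
proof -
  have "tf_shift u (tf_shift r gaussian) = (\<lambda>t. phase (- (snd r \<bullet> fst u)) * tf_shift (u + r) gaussian t)"
    by (rule ext) (rule tf_shift_tf_shift)
  then show ?thesis by (simp only: L2_inner_cmult_left gker_def gst_def)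
qed

lemma has_bochner_integral_lborel_translate:
  fixes f :: "'a::euclidean_space \<Rightarrow> 'b::{banach, second_countable_topology}"
  assumes "has_bochner_integral lborel f I"
  shows "has_bochner_integral lborel (\<lambda>x. f (x + a)) I"
  using assms integrable_lborel_translate[of f a] integral_lborel_translate[of f a]
  by (auto simp: has_bochner_integral_iff)

text \<open>Fourier inversion in the frequency variable for the product of the two shifted
  Gaussians, whose Fourier transform is again an explicit Gaussian. It reduces the orthogonality
  relation below to two applications of Fubini.\<close>

lemma gker_inversion:
  fixes r y :: "'d::finite tfplane" and x t :: "real^'d"
  shows "has_bochner_integral lborel
    (\<lambda>w. phase (- (w \<bullet> t)) * (phase (- (snd r \<bullet> x)) * gker ((x, w) + r) y))
    (tf_shift r gaussian (t - x) * cnj (tf_shift y gaussian t))"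
proof -
  define q where "q = snd r - snd y"
  define p where "p = (1/2) *\<^sub>R (x + fst r + fst y)"
  define E where "E = exp (- pi / 2 * (norm (x + fst r - fst y))\<^sup>2) / sqrt 2 ^ CARD('d)"
  define h :: "real^'d \<Rightarrow> complex" where
    "h = (\<lambda>w. of_real (exp (- pi * (1/2) * (w \<bullet> w))) * phase ((p - t) \<bullet> w))"
  define c where "c = of_real E * phase (q \<bullet> t) * phase (- (snd r \<bullet> x))"
  have eq: "phase (- (w \<bullet> t)) * (phase (- (snd r \<bullet> x)) * gker ((x, w) + r) y) = c * h (w + q)" for w
  proof -
    have n: "(norm ((x, w) + r - y))\<^sup>2 = (norm (x + fst r - fst y))\<^sup>2 + (w + q) \<bullet> (w + q)"
      unfolding power2_norm_eq_inner inner_prod_def by (simp add: q_def add_diff_eq)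
    have g: "gker ((x, w) + r) y = of_real (E * exp (- pi * (1/2) * ((w + q) \<bullet> (w + q)))) * phase ((w + q) \<bullet> p)"
      unfolding gker_eq n by (simp add: E_def p_def q_def distrib_left exp_add[symmetric] add.assoc)
        (simp add: add_diff_eq)
    have ph: "phase (- (w \<bullet> t)) * phase ((w + q) \<bullet> p) = phase (q \<bullet> t) * phase ((p - t) \<bullet> (w + q))"
      by (simp add: inner_diff_left inner_add_left inner_add_right inner_commute algebra_simps flip: phase_add)
    have "phase (- (w \<bullet> t)) * (phase (- (snd r \<bullet> x)) * gker ((x, w) + r) y)
      = of_real E * phase (- (snd r \<bullet> x)) * of_real (exp (- pi * (1/2) * ((w + q) \<bullet> (w + q))))
        * (phase (- (w \<bullet> t)) * phase ((w + q) \<bullet> p))"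
      unfolding g by (simp only: of_real_mult mult_ac)
    also have "\<dots> = c * h (w + q)"
      unfolding ph c_def h_def by (simp only: mult_ac)
    finally show ?thesis .
  qed
  have "has_bochner_integral lborel h
      (of_real (exp (- pi * ((p - t) \<bullet> (p - t)) / (1/2)) / sqrt (1/2) ^ CARD('d)))"
    unfolding h_def using has_bochner_integral_gauss[of "1/2" "p - t"] by simp
  from has_bochner_integral_mult_right[OF has_bochner_integral_lborel_translate[OF this, of q], of c]
  have "has_bochner_integral lborel
    (\<lambda>w. phase (- (w \<bullet> t)) * (phase (- (snd r \<bullet> x)) * gker ((x, w) + r) y))
    (c * of_real (exp (- pi * ((p - t) \<bullet> (p - t)) / (1/2)) / sqrt (1/2) ^ CARD('d)))"
    unfolding eq .
  also have "c * of_real (exp (- pi * ((p - t) \<bullet> (p - t)) / (1/2)) / sqrt (1/2) ^ CARD('d))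
    = tf_shift r gaussian (t - x) * cnj (tf_shift y gaussian t)"
  proof -
    have s: "sqrt (1/2) ^ CARD('d) * sqrt 2 ^ CARD('d) = 1"
      by (simp add: real_sqrt_divide flip: power_mult_distrib)
    have "tf_shift r gaussian (t - x) * cnj (tf_shift y gaussian t)
      = phase (snd r \<bullet> (t - x)) * phase (- (snd y \<bullet> t)) * (gaussian (t - (x + fst r)) * gaussian (t - fst y))"
      by (simp add: tf_shift_apply phase_cnj mult_ac diff_diff_add)
    also have "phase (snd r \<bullet> (t - x)) * phase (- (snd y \<bullet> t)) = phase (q \<bullet> t) * phase (- (snd r \<bullet> x))"
      by (simp add: q_def inner_diff_left inner_diff_right algebra_simps flip: phase_add)
    also have "gaussian (t - (x + fst r)) * gaussian (t - fst y) =
      of_real (exp (- pi / 2 * (norm (x + fst r - fst y))\<^sup>2) * exp (- pi * 2 * ((t - p) \<bullet> (t - p))))"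
      by (simp add: gaussian_mult p_def)
    also have "(t - p) \<bullet> (t - p) = (p - t) \<bullet> (p - t)"
      by (simp add: inner_diff_left inner_diff_right inner_commute)
    also have "exp (- pi / 2 * (norm (x + fst r - fst y))\<^sup>2) = E / sqrt (1/2) ^ CARD('d)"
      using s by (simp add: E_def field_simps)
    finally show ?thesis by (simp add: c_def mult_ac)
  qed
  finally show ?thesis .
qed

lemma integrable_gst_gker:
  assumes w: "w \<in> L2_space"
  shows "integrable lborel (\<lambda>u. gst w u * (phase (- (snd r \<bullet> fst u)) * gker (u + r) y))"
proof -
  obtain C where C: "\<And>u. cmod (gst w u) \<le> C" "0 \<le> C" using gst_bounded[OF w] by metis
  have [measurable]: "gst w \<in> borel_measurable borel" by (rule measurable_gst) fact
  have "integrable lborel (\<lambda>u::'a tfplane. C * exp (- pi * (1/2) * ((u + (r - y)) \<bullet> (u + (r - y)))))"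
    by (intro integrable_mult_right integrable_lborel_translate[of "\<lambda>u. exp (- pi * (1/2) * (u \<bullet> u))"] integrable_gauss) simp
  then show ?thesis
  proof (rule Bochner_Integration.integrable_bound)
    have "cmod (gst w u) * cmod (gker (u + r) y) \<le> C * exp (- pi * (1/2) * ((u + (r - y)) \<bullet> (u + (r - y))))" for u
      using mult_mono[OF C(1)[of u] norm_gker_le[of "u + r" y] C(2) norm_ge_zero]
      by (simp add: power2_norm_eq_inner add_diff_eq)
    then show "AE u in lborel. norm (gst w u * (phase (- (snd r \<bullet> fst u)) * gker (u + r) y))
      \<le> norm (C * exp (- pi * (1/2) * ((u + (r - y)) \<bullet> (u + (r - y)))))"
      using C(2) by (intro AE_I2) (simp add: norm_mult)
  next
    have [measurable]: "(\<lambda>u::'a tfplane. phase (- (snd r \<bullet> fst u))) \<in> borel_measurable borel"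
      by (intro borel_measurable_continuous_onI continuous_intros)
    have [measurable]: "(\<lambda>u. gker (u + r) y) \<in> borel_measurable borel" by measurable
    show "(\<lambda>u. gst w u * (phase (- (snd r \<bullet> fst u)) * gker (u + r) y)) \<in> borel_measurable lborel"
      by measurable
  qed
qed

text \<open>Moyal's orthogonality relation for the windows \<open>\<phi>\<close> and
  \<open>\<pi>(r)\<phi>\<close>: the second factor is the conjugate of the transform of
  \<open>\<pi>(y)\<phi>\<close> with the latter window. The case \<open>r = 0\<close> is the
  reproducing formula; general \<open>r\<close> serves the change of window.\<close>

theorem gst_moyal:
  fixes w :: "real^'d::finite \<Rightarrow> complex"
  assumes w: "w \<in> L2_space"
  shows "(LINT u|lborel. gst w u * L2_inner (tf_shift u (tf_shift r gaussian)) (tf_shift y gaussian))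
    = gst w y * gker r 0"
proof -
  obtain w' where w'[measurable]: "w' \<in> borel_measurable borel" and "w' \<in> L2_space"
    and eq: "\<And>g. g \<in> borel_measurable borel \<Longrightarrow> L2_inner w g = (LINT t|lborel. w' t * cnj (g t))"
    using L2_space_obtain_borel[OF w] by metis
  let ?k = "\<lambda>x \<omega>. phase (- (snd r \<bullet> x)) * gker ((x, \<omega>) + r) y"
  have int: "integrable lborel (\<lambda>t. w' t * cnj (g t))" 
    if "g \<in> L2_space" and [measurable]: "g \<in> borel_measurable borel" for g
    using integrable_L2_mult[OF \<open>w' \<in> L2_space\<close> that(1)] by (subst (asm) integrable_completion) auto
  have intw: "integrable lborel (\<lambda>t. w' t * gaussian (t - x))" for x
    using int[OF L2_space_gaussian_shift, of "(x, 0)"] by (simp add: tf_shift_apply)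
  have gst_w: "gst w (x, \<omega>) = (LINT t|lborel. w' t * gaussian (t - x) * phase (- (\<omega> \<bullet> t)))" for x \<omega>
    by (simp add: gst_def eq tf_shift_apply phase_cnj mult_ac)
  \<comment> \<open>For fixed \<open>x\<close>, Fubini in \<open>t\<close> and the frequency lets
    \<open>gker_inversion\<close> carry out the frequency integral.\<close>
  have inner: "(LINT \<omega>|lborel. gst w (x, \<omega>) * ?k x \<omega>)
    = (LINT t|lborel. w' t * gaussian (t - x) * (tf_shift r gaussian (t - x) * cnj (tf_shift y gaussian t)))" for x
  proof -
    have intk: "integrable lborel (\<lambda>\<omega>. ?k x \<omega>)"
      using gker_inversion[of 0 r x y] by (simp add: has_bochner_integral_iff)
    have m[measurable]: "(\<lambda>\<omega>. ?k x \<omega>) \<in> borel_measurable borel"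
      using borel_measurable_integrable[OF intk] by simp
    let ?f = "\<lambda>(\<omega>, t). w' t * gaussian (t - x) * phase (- (\<omega> \<bullet> t)) * ?k x \<omega>"
    have "integrable (lborel \<Otimes>\<^sub>M lborel) ?f"
    proof (rule lborel_pair.Fubini_integrable)
      have "(LINT t|lborel. norm (?f (\<omega>, t))) = (LINT t|lborel. norm (w' t * gaussian (t - x))) * norm (?k x \<omega>)" for \<omega>
        by (simp add: norm_mult)
      moreover have "integrable lborel (\<lambda>\<omega>. (LINT t|lborel. norm (w' t * gaussian (t - x))) * norm (?k x \<omega>))"
        by (rule integrable_mult_right, rule integrable_norm, rule intk)
      ultimately show "integrable lborel (\<lambda>\<omega>. LINT t|lborel. norm (?f (\<omega>, t)))"
        by (simp only:)
      show "AE \<omega> in lborel. integrable lborel (\<lambda>t. ?f (\<omega>, t))"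
      proof (intro AE_I2)
        fix \<omega>
        have "integrable lborel (\<lambda>t. w' t * gaussian (t - x) * phase (- (\<omega> \<bullet> t)))"
          by (rule Bochner_Integration.integrable_bound[OF intw[of x]]) (auto simp: norm_mult)
        then show "integrable lborel (\<lambda>t. ?f (\<omega>, t))" by (simp only: split integrable_mult_left)
      qed
    qed measurable
    from lborel_pair.Fubini_integral[OF this]
    have "(LINT \<omega>|lborel. LINT t|lborel. w' t * gaussian (t - x) * phase (- (\<omega> \<bullet> t)) * ?k x \<omega>)
      = (LINT t|lborel. LINT \<omega>|lborel. w' t * gaussian (t - x) * phase (- (\<omega> \<bullet> t)) * ?k x \<omega>)"
      by simp
    moreover have "(LINT \<omega>|lborel. w' t * gaussian (t - x) * phase (- (\<omega> \<bullet> t)) * ?k x \<omega>)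
      = w' t * gaussian (t - x) * (tf_shift r gaussian (t - x) * cnj (tf_shift y gaussian t))" for t
      using has_bochner_integral_integral_eq[OF gker_inversion[of t r x y]]
      by (simp add: mult.assoc)
    ultimately show ?thesis by (simp add: gst_w)
  qed
  have inty: "integrable lborel (\<lambda>t. w' t * cnj (tf_shift y gaussian t))"
    by (rule int) auto
  let ?B = "\<lambda>s. gaussian s * tf_shift r gaussian s"
  have [measurable]: "?B \<in> borel_measurable borel" by measurable
  have intB: "integrable lborel ?B"
  proof -
    have "integrable lborel (\<lambda>s. gaussian (s - 0) * gaussian (s - fst r))" by (rule integrable_gaussian_mult)
    then show ?thesis
      by (rule Bochner_Integration.integrable_bound) (auto simp: norm_mult tf_shift_apply)
  qed
  have B: "(LINT s|lborel. ?B s) = gker r 0"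
    unfolding gker_def gst_def by (subst L2_inner_borel) (simp_all add: mult.commute)
  \<comment> \<open>What remains is a function of \<open>t\<close> times a function of
    \<open>t - x\<close>; integrating over \<open>x\<close> first splits off the constant
    \<open>gker r 0\<close>.\<close>
  let ?g = "\<lambda>(t, x). w' t * cnj (tf_shift y gaussian t) * ?B (t - x)"
  have intg: "integrable (lborel \<Otimes>\<^sub>M lborel) ?g"
  proof (rule lborel_pair.Fubini_integrable)
    have "(LINT x|lborel. norm (?g (t, x))) = norm (w' t * cnj (tf_shift y gaussian t)) * (LINT s|lborel. norm (?B s))" for t
      using integral_lborel_reflect[of "\<lambda>s. norm (?B s)" t] by (simp add: norm_mult)
    moreover have "integrable lborel (\<lambda>t. norm (w' t * cnj (tf_shift y gaussian t)) * (LINT s|lborel. norm (?B s)))"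
      by (rule integrable_mult_left, rule integrable_norm, rule inty)
    ultimately show "integrable lborel (\<lambda>t. LINT x|lborel. norm (?g (t, x)))"
      by (simp only:)
    show "AE t in lborel. integrable lborel (\<lambda>x. ?g (t, x))"
      using integrable_lborel_reflect[OF intB] by (intro AE_I2) (simp only: split integrable_mult_right)
  qed measurable
  have "(LINT u|lborel. gst w u * (phase (- (snd r \<bullet> fst u)) * gker (u + r) y))
    = (LINT x|lborel. LINT \<omega>|lborel. gst w (x, \<omega>) * ?k x \<omega>)"
    using lborel_pair.integral_fst'[of "\<lambda>u. gst w u * (phase (- (snd r \<bullet> fst u)) * gker (u + r) y)"]
      integrable_gst_gker[OF w, of r y] by (simp add: lborel_prod)
  also have "\<dots> = (LINT x|lborel. LINT t|lborel. w' t * cnj (tf_shift y gaussian t) * ?B (t - x))"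
    by (simp add: inner mult_ac)
  also have "\<dots> = (LINT t|lborel. LINT x|lborel. w' t * cnj (tf_shift y gaussian t) * ?B (t - x))"
    using lborel_pair.Fubini_integral[OF intg] by simp
  also have "\<dots> = (LINT t|lborel. w' t * cnj (tf_shift y gaussian t) * gker r 0)"
    using integral_lborel_reflect[of ?B] by (simp add: B)
  also have "\<dots> = gst w y * gker r 0"
    by (simp add: gst_def eq)
  finally show ?thesis by (simp add: gker_shift)
qed

lemma gst_reproducing:
  fixes w :: "real^'d::finite \<Rightarrow> complex"
  assumes w: "w \<in> L2_space"
  shows "integrable lborel (\<lambda>u. gst w u * gker u y)"
    and "(LINT u|lborel. gst w u * gker u y) = gst w y / sqrt 2 ^ CARD('d)"
  using integrable_gst_gker[OF w, of 0 y] gst_moyal[OF w, of 0 y]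
  by (simp_all only: gker_shift) (simp_all add: gker_self)

text \<open>Without this phase, \<open>gker u z\<close> oscillates in \<open>u\<close> at a rate growing with \<open>z\<close>; it is the factor between
  \<open>\<pi>(u')\<close> and \<open>\<pi>(u)\<pi>(u' - u)\<close>.\<close>

definition osc_phase :: "'d::finite tfplane \<Rightarrow> 'd tfplane \<Rightarrow> complex" where
  "osc_phase u u' = phase ((snd u - snd u') \<bullet> fst u)"

lemma norm_osc_phase [simp]: "cmod (osc_phase u u') = 1"
  by (simp add: osc_phase_def)

text \<open>Both terms are transforms of \<open>\<pi>(u)\<close> applied to a vector, to
  \<open>\<phi>\<close> and to \<open>\<pi>(u' - u)\<phi>\<close> respectively. Covariance strips
  off \<open>\<pi>(u)\<close> at the cost of a common phase, so that estimates near the origin hold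
  uniformly.\<close>

lemma gker_diff_covariant:
  "gker u z - osc_phase u u' * gker u' z
    = phase ((snd u - snd z) \<bullet> fst u) * (gker 0 (z - u) - gker (u' - u) (z - u))"
proof -
  have "osc_phase u u' * gker u' z = gst (tf_shift u (tf_shift (u' - u) gaussian)) z"
    using gker_shift[of u "u' - u" z] by (simp add: gst_def osc_phase_def inner_diff_left)
  also have "\<dots> = phase ((snd u - snd z) \<bullet> fst u) * gker (u' - u) (z - u)"
    by (simp add: gst_tf_shift gker_def)
  finally have "osc_phase u u' * gker u' z = phase ((snd u - snd z) \<bullet> fst u) * gker (u' - u) (z - u)" .
  moreover have "gker u z = phase ((snd u - snd z) \<bullet> fst u) * gker 0 (z - u)"
    by (simp add: gker_def gst_tf_shift L2_space_gaussian)
  ultimately show ?thesis by (simp add: right_diff_distrib)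
qed

text \<open>The right-hand side tends to 0 with \<open>\<eta>\<close> because \<open>gker\<close> is
  continuous: strong continuity of the shifts, tested on the Gaussian.\<close>

lemma LINT_norm2_gaussian_diff:
  fixes \<eta> :: "'d::finite tfplane"
  shows "(LINT t|lebesgue. (cmod (gaussian t + (- 1) * tf_shift \<eta> gaussian t))\<^sup>2)
    = 2 / sqrt 2 ^ CARD('d) - 2 * Re (gker 0 \<eta>)"
proof -
  have int: "integrable lebesgue (\<lambda>t::real^'d. (cmod (gaussian t))\<^sup>2)"
    "integrable lebesgue (\<lambda>t. (cmod (tf_shift \<eta> gaussian t))\<^sup>2)"
    using L2_space_gaussian L2_space_gaussian_shift[of \<eta>] by (auto simp: L2_space_def)
  have int3: "integrable lebesgue (\<lambda>t. gaussian t * cnj (tf_shift \<eta> gaussian t))"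
    by (rule integrable_L2_mult) (simp_all add: L2_space_gaussian)
  have "(cmod (a + (- 1) * b))\<^sup>2 = (cmod a)\<^sup>2 + (cmod b)\<^sup>2 - 2 * Re (a * cnj b)" for a b
    unfolding cmod_power2 by (simp add: power2_eq_square algebra_simps)
  then have "(LINT t|lebesgue. (cmod (gaussian t + (- 1) * tf_shift \<eta> gaussian t))\<^sup>2)
    = (LINT t|lebesgue. (cmod (gaussian t))\<^sup>2 + (cmod (tf_shift \<eta> gaussian t))\<^sup>2
        - 2 * Re (gaussian t * cnj (tf_shift \<eta> gaussian t)))"
    by simp
  also have "\<dots> = (LINT t::real^'d|lebesgue. (cmod (gaussian t))\<^sup>2) + (LINT t|lebesgue. (cmod (tf_shift \<eta> gaussian t))\<^sup>2)
        - 2 * (LINT t|lebesgue. Re (gaussian t * cnj (tf_shift \<eta> gaussian t)))"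
  proof -
    define R where "R = (\<lambda>t. Re (gaussian t * cnj (tf_shift \<eta> gaussian t)))"
    have "integrable lebesgue R" unfolding R_def using int3 by (rule integrable_Re)
    moreover have "Re (gaussian t * cnj (tf_shift \<eta> gaussian t)) = R t" for t by (simp only: R_def)
    ultimately show ?thesis using int by (simp only:) simp
  qed
  also have "(LINT t|lebesgue. Re (gaussian t * cnj (tf_shift \<eta> gaussian t))) = Re (gker 0 \<eta>)"
    by (subst integral_Re[OF int3]) (simp add: gker_def gst_def L2_inner_def)
  finally show ?thesis
    using LINT_norm2_gaussian_shift[of "0::'d tfplane"] LINT_norm2_gaussian_shift[of \<eta>] by simp
qed

text \<open>The difference is uniformly small by Cauchy-Schwarz, and it has Gaussian decay because
  both kernels do. The geometric mean of the two bounds is small and decaying at once, with half the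
  exponent; \<open>pi / 8 \<ge> 1 / 4\<close> leaves the Gaussian of the statement.\<close>

lemma gker_osc:
  fixes \<theta> :: real
  assumes "0 < \<theta>"
  obtains \<epsilon> where "0 < \<epsilon>"
    "\<And>u u' z :: 'd::finite tfplane. norm (u' - u) \<le> \<epsilon> \<Longrightarrow>
      cmod (gker u z - osc_phase u u' * gker u' z) \<le> \<theta> * exp (- (norm (z - u))\<^sup>2 / 4)"
proof -
  define C where "C = 2 * exp (pi / 2)"
  \<comment> \<open>Chosen so that \<open>\<delta> * C = \<theta>\<^sup>2\<close>, the square of the
    target constant.\<close>
  define \<delta> where "\<delta> = \<theta>\<^sup>2 / C"
  have C: "0 < C" and \<delta>: "0 < \<delta>" using assms by (simp_all add: C_def \<delta>_def)
  let ?N = "\<lambda>\<eta>::'d tfplane. 2 / sqrt 2 ^ CARD('d) - 2 * Re (gker 0 \<eta>)"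
  have "continuous_on UNIV ?N"
    unfolding gker_eq by (intro continuous_intros) auto
  then have "isCont ?N 0" by (rule continuous_on_interior) simp
  then have "(?N \<longlongrightarrow> 0) (at 0)" by (simp add: isCont_def gker_self)
  then obtain e where e: "0 < e" "\<And>\<eta>. \<eta> \<noteq> 0 \<Longrightarrow> norm \<eta> < e \<Longrightarrow> \<bar>?N \<eta>\<bar> < \<delta>\<^sup>2"
    using \<delta> tendstoD[of ?N 0 "at 0" "\<delta>\<^sup>2"] by (auto simp: eventually_at dist_norm)
  have e': "?N \<eta> \<le> \<delta>\<^sup>2" if "norm \<eta> < e" for \<eta>
    using e(2)[OF _ that] by (cases "\<eta> = 0") (force simp: gker_self)+
  show thesis
  proof (rule that[of "min 1 (e / 2)"])
    show "0 < min 1 (e / 2)" using e by simp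
    fix u u' z :: "'d tfplane"
    assume u: "norm (u' - u) \<le> min 1 (e / 2)"
    define \<eta> where "\<eta> = u' - u"
    define y where "y = z - u"
    have \<eta>: "norm \<eta> \<le> 1" "norm \<eta> < e" using u e by (auto simp: \<eta>_def)
    define x where "x = cmod (gker 0 y - gker \<eta> y)"
    have x_eq: "cmod (gker u z - osc_phase u u' * gker u' z) = x"
      by (simp add: gker_diff_covariant norm_mult x_def \<eta>_def y_def)
    have x1: "x \<le> \<delta>"
    proof -
      have L: "(\<lambda>t. gaussian t + (- 1) * tf_shift \<eta> gaussian t) \<in> L2_space"
        by (intro L2_space_add L2_space_cmult L2_space_gaussian L2_space_gaussian_shift)
      have "gst (\<lambda>t. gaussian t + (- 1) * tf_shift \<eta> gaussian t) y = gst gaussian y + (- 1) * gst (tf_shift \<eta> gaussian) y"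
        by (subst gst_add) (simp_all only: gst_cmult L2_space_cmult L2_space_gaussian L2_space_gaussian_shift)
      then have "gker 0 y - gker \<eta> y = L2_inner (\<lambda>t. gaussian t + (- 1) * tf_shift \<eta> gaussian t) (tf_shift y gaussian)"
        by (simp add: gker_def gst_def)
      \<comment> \<open>With the weight \<open>1 / \<delta>\<close> both terms of
        \<open>norm_L2_inner_le\<close> are at most \<open>\<delta>\<close>, as
        \<open>?N \<eta> \<le> \<delta>\<^sup>2\<close>.\<close>
      then have "x \<le> ((1 / \<delta>) * ?N \<eta> + (1 / sqrt 2 ^ CARD('d)) / (1 / \<delta>)) / 2"
        unfolding x_def
        using norm_L2_inner_le[OF L L2_space_gaussian_shift, of "1 / \<delta>" y] \<delta>
        by (simp only: LINT_norm2_gaussian_diff LINT_norm2_gaussian_shift) simp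
      also have "\<dots> \<le> ((1 / \<delta>) * \<delta>\<^sup>2 + 1 / (1 / \<delta>)) / 2"
        using \<delta> e'[OF \<eta>(2)]
        by (intro divide_right_mono add_mono mult_left_mono) (auto simp: divide_le_eq_1 one_le_power)
      also have "\<dots> = \<delta>" using \<delta> by (simp add: power2_eq_square)
      finally show ?thesis .
    qed
    have x2: "x \<le> C * exp (- pi / 4 * (norm y)\<^sup>2)"
    proof -
      \<comment> \<open>As \<open>norm \<eta> \<le> 1\<close>, recentring the Gaussian at 0 costs
        half of the exponent and the factor \<open>exp (pi / 2)\<close>.\<close>
      have "(norm y)\<^sup>2 \<le> (norm (y - \<eta>) + norm \<eta>)\<^sup>2"
        using norm_triangle_sub[of y \<eta>] by (intro power_mono) (auto simp: add.commute)
      also have "\<dots> \<le> 2 * (norm (y - \<eta>))\<^sup>2 + 2 * (norm \<eta>)\<^sup>2"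
        using sum_squares_bound[of "norm (y - \<eta>)" "norm \<eta>"] by (simp add: power2_sum)
      also have "\<dots> \<le> 2 * (norm (y - \<eta>))\<^sup>2 + 2"
        using \<eta>(1) by (simp add: power_le_one)
      finally have n: "(norm y)\<^sup>2 / 2 - 1 \<le> (norm (y - \<eta>))\<^sup>2" by simp
      have "exp (- pi / 2 * (norm (\<eta> - y))\<^sup>2) \<le> exp (pi / 2) * exp (- pi / 4 * (norm y)\<^sup>2)"
        using mult_left_mono[OF n, of "pi / 2"]
        by (simp add: norm_minus_commute[of \<eta>] algebra_simps flip: exp_add)
      moreover have "exp (- pi / 2 * (norm (0 - y))\<^sup>2) \<le> exp (pi / 2) * exp (- pi / 4 * (norm y)\<^sup>2)"
      proof -
        have "0 \<le> pi * (norm y)\<^sup>2" by simp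
        then have "- (pi * (norm y)\<^sup>2 / 2) \<le> pi / 2 - pi * (norm y)\<^sup>2 / 4"
          using pi_ge_zero by linarith
        then show ?thesis by (simp flip: exp_add)
      qed
      moreover have "x \<le> cmod (gker 0 y) + cmod (gker \<eta> y)"
        unfolding x_def by (rule norm_triangle_ineq4)
      ultimately show ?thesis
        using norm_gker_le[of 0 y] norm_gker_le[of \<eta> y] by (simp add: C_def)
    qed
    have "x * x \<le> \<delta> * (C * exp (- pi / 4 * (norm y)\<^sup>2))"
      using x1 x2 \<delta> by (intro mult_mono) (auto simp: x_def)
    then have "x\<^sup>2 \<le> \<delta> * (C * exp (- pi / 4 * (norm y)\<^sup>2))"
      by (simp add: power2_eq_square[of x])
    also have "\<dots> = (\<theta> * exp (- pi / 8 * (norm y)\<^sup>2))\<^sup>2"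
      using C by (simp add: \<delta>_def power_mult_distrib flip: exp_double)
    finally have "x \<le> \<theta> * exp (- pi / 8 * (norm y)\<^sup>2)"
      by (rule power2_le_imp_le) (use assms in simp)
    also have "\<dots> \<le> \<theta> * exp (- (norm y)\<^sup>2 / 4)"
    proof -
      have "(norm y)\<^sup>2 * 2 \<le> (norm y)\<^sup>2 * pi"
        using pi_ge_two by (intro mult_left_mono) auto
      then show ?thesis using assms by (simp add: mult.commute)
    qed
    finally show "cmod (gker u z - osc_phase u u' * gker u' z) \<le> \<theta> * exp (- (norm (z - u))\<^sup>2 / 4)"
      unfolding x_eq y_def .
  qed
qed

subsection \<open>Injectivity of the transform\<close>

lemma integral_lborel_affine:
  fixes f :: "'a::euclidean_space \<Rightarrow> 'b::{banach, second_countable_topology}"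
  assumes [measurable]: "f \<in> borel_measurable borel" and c: "c \<noteq> 0"
  shows "(LINT x|lborel. f x) = \<bar>c\<bar> ^ DIM('a) *\<^sub>R (LINT x|lborel. f (t + c *\<^sub>R x))"
  by (subst lborel_affine[OF c, of t])
    (simp add: integral_density integral_distr)

text \<open>Boxes form an intersection-stable generator of the Borel sets, so a Dynkin argument
  extends the vanishing to all of them; the assumption on the total integral handles
  complements.\<close>

lemma AE_eq_0_if_integral_boxes_eq_0:
  fixes a :: "'a::euclidean_space \<Rightarrow> real"
  assumes int: "integrable lborel a" and 0: "(LINT t|lborel. a t) = 0"
    and box: "\<And>b c. (LINT t:box b c|lborel. a t) = 0"
  shows "AE t in lborel. a t = 0"
proof -
  have *: "(LINT t:A|lborel. a t) = 0" if "A \<in> sets lborel" for A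
  proof -
    have "Int_stable (range (\<lambda>(a::'a, b). box a b))"
      by (auto simp: Int_stable_def box_Int_box)
    moreover have "range (\<lambda>(a::'a, b). box a b) \<subseteq> Pow UNIV" by simp
    moreover have "A \<in> sigma_sets UNIV (range (\<lambda>(a::'a, b). box a b))"
      using that unfolding sets_lborel borel_eq_box by (simp add: sets_measure_of)
    ultimately show ?thesis
    proof (induction rule: sigma_sets_induct_disjoint)
      case (basic A)
      then show ?case using box by auto
    next
      case empty
      then show ?case by (simp add: set_lebesgue_integral_def)
    next
      case (compl A)
      then have A: "A \<in> sets lborel" unfolding sets_lborel borel_eq_box by (simp add: sets_measure_of)
      have "(LINT t|lborel. a t) = (LINT t|lborel. indicator A t *\<^sub>R a t + indicator (- A) t *\<^sub>R a t)"
        by (intro Bochner_Integration.integral_cong) (auto simp: indicator_def)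
      also have "\<dots> = (LINT t:A|lborel. a t) + (LINT t:- A|lborel. a t)"
        unfolding set_lebesgue_integral_def
        using A int by (intro Bochner_Integration.integral_add integrable_mult_indicator) auto
      finally show ?case using compl 0 by (simp add: Compl_eq_Diff_UNIV)
    next
      case (union A)
      then have A: "A i \<in> sets lborel" for i
        unfolding sets_lborel borel_eq_box by (auto simp: sets_measure_of)
      have "set_integrable lborel (\<Union>i. A i) a"
        unfolding set_integrable_def using A int by (intro integrable_mult_indicator) auto
      then have "(LINT t:(\<Union>i. A i)|lborel. a t) = (\<Sum>i. (LINT t:(A i)|lborel. a t))"
        using A union by (intro lebesgue_integral_countable_add) (auto simp: disjoint_family_on_def)
      then show ?case using union by simp
    qed
  qed
  have "AE t in lborel. a t = (\<lambda>_. 0) t"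
    by (rule density_unique_real) (use int * in \<open>auto simp: set_lebesgue_integral_def\<close>)
  then show ?thesis by simp
qed

text \<open>A function with vanishing Fourier transform annihilates every translate and dilate of
  the Gaussian, since these are Fourier transforms of integrable functions. Superposing them over a
  box gives the indicator of the box smoothed at scale \<open>1 / n\<close>.\<close>

lemma integral_gauss_box_eq_0:
  fixes a :: "'a::euclidean_space \<Rightarrow> complex"
  assumes int: "integrable lborel a"
    and 0: "\<And>w. (LINT t|lborel. a t * phase (w \<bullet> t)) = 0"
    and n: "0 < n"
  shows "(LINT t|lborel. a t * of_real (LINT s|lborel. indicator (box b c) (t + (1 / n) *\<^sub>R s) * exp (- pi * (s \<bullet> s)))) = 0"
proof -
  have [measurable]: "a \<in> borel_measurable borel" using int by auto
  let ?e = "\<lambda>x t. exp (- pi * n\<^sup>2 * ((x - t) \<bullet> (x - t)))"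
  have gauss0: "(LINT t|lborel. a t * of_real (?e x t)) = 0" for x
  proof -
    \<comment> \<open>The Gaussian with parameter \<open>1 / n\<^sup>2\<close> has
      \<open>exp (- pi * n\<^sup>2 * (x \<bullet> x))\<close> as its Fourier transform, up to the
      factor \<open>K\<close>.\<close>
    define \<alpha> where "\<alpha> = 1 / n\<^sup>2"
    have \<alpha>: "0 < \<alpha>" using n by (simp add: \<alpha>_def)
    define K where "K = complex_of_real (1 / sqrt \<alpha> ^ DIM('a))"
    have K: "K \<noteq> 0" using \<alpha> by (simp add: K_def)
    let ?g = "\<lambda>w::'a. complex_of_real (exp (- pi * \<alpha> * (w \<bullet> w)))"
    have intg: "integrable lborel ?g" using integrable_gauss[OF \<alpha>] by (simp add: complex_of_real_integrable_eq)
    have FT: "(LINT w|lborel. ?g w * phase ((t - x) \<bullet> w)) = K * of_real (?e x t)" for t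
      using has_bochner_integral_integral_eq[OF has_bochner_integral_gauss[OF \<alpha>, of "t - x"]]
      by (simp add: K_def \<alpha>_def inner_diff_left inner_diff_right inner_commute mult_ac)
    let ?f = "\<lambda>(t, w). a t * (?g w * phase ((t - x) \<bullet> w))"
    have "integrable (lborel \<Otimes>\<^sub>M lborel) ?f"
    proof (rule lborel_pair.Fubini_integrable)
      have "(LINT w|lborel. norm (?f (t, w))) = norm (a t) * (LINT w|lborel. norm (?g w))" for t
        by (simp add: norm_mult)
      moreover have "integrable lborel (\<lambda>t. norm (a t) * (LINT w|lborel. norm (?g w)))"
        by (rule integrable_mult_left, rule integrable_norm, rule int)
      ultimately show "integrable lborel (\<lambda>t. LINT w|lborel. norm (?f (t, w)))"
        by (simp only:)
      show "AE t in lborel. integrable lborel (\<lambda>w. ?f (t, w))"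
      proof (intro AE_I2)
        fix t
        have "integrable lborel (\<lambda>w. ?g w * phase ((t - x) \<bullet> w))"
          by (rule Bochner_Integration.integrable_bound[OF intg]) (auto simp: norm_mult)
        then show "integrable lborel (\<lambda>w. ?f (t, w))" by (simp only: split integrable_mult_right)
      qed
    qed measurable
    from lborel_pair.Fubini_integral[OF this]
    have "(LINT t|lborel. LINT w|lborel. a t * (?g w * phase ((t - x) \<bullet> w)))
      = (LINT w|lborel. LINT t|lborel. a t * (?g w * phase ((t - x) \<bullet> w)))" by simp
    also have "\<dots> = (LINT w|lborel. ?g w * phase (- (x \<bullet> w)) * (LINT t|lborel. a t * phase (w \<bullet> t)))"
    proof (intro Bochner_Integration.integral_cong refl)
      fix w
      have "a t * (?g w * phase ((t - x) \<bullet> w)) = ?g w * phase (- (x \<bullet> w)) * (a t * phase (w \<bullet> t))" for t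
      proof -
        have "phase ((t - x) \<bullet> w) = phase (- (x \<bullet> w)) * phase (w \<bullet> t)"
          by (simp add: inner_diff_left inner_commute[of w] flip: phase_add)
        then show ?thesis by (simp only: mult_ac)
      qed
      then show "(LINT t|lborel. a t * (?g w * phase ((t - x) \<bullet> w)))
        = ?g w * phase (- (x \<bullet> w)) * (LINT t|lborel. a t * phase (w \<bullet> t))"
        by (simp only: integral_mult_right_zero)
    qed
    also have "\<dots> = 0" by (simp add: 0)
    finally have "(LINT t|lborel. a t * (K * of_real (?e x t))) = 0"
      by (simp only: integral_mult_right_zero FT)
    then have "K * (LINT t|lborel. a t * of_real (?e x t)) = 0"
      by (simp only: mult.left_commute integral_mult_right_zero)
    then show ?thesis using K by simp
  qed
  let ?I = "\<lambda>x. indicator (box b c) x :: real"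
  have [measurable]: "?I \<in> borel_measurable borel" by simp
  have intI: "integrable lborel ?I" by (simp add: integrable_real_indicator emeasure_lborel_box_eq)
  have scale: "(LINT s|lborel. ?I (t + (1 / n) *\<^sub>R s) * exp (- pi * (s \<bullet> s)))
      = n ^ DIM('a) * (LINT x|lborel. ?I x * ?e x t)" for t
    using n by (subst integral_lborel_affine[of _ n "- (n *\<^sub>R t)"])
      (auto simp: algebra_simps inner_diff_left inner_diff_right power2_eq_square inner_commute)
  let ?f = "\<lambda>(t, x). a t * of_real (?I x * ?e x t)"
  have "integrable (lborel \<Otimes>\<^sub>M lborel) ?f"
  proof (rule Bochner_Integration.integrable_bound)
    show "integrable (lborel \<Otimes>\<^sub>M lborel) (\<lambda>(t, x). a t * of_real (?I x))"
    proof (rule lborel_pair.Fubini_integrable)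
      have "integrable lborel (\<lambda>t. norm (a t) * (LINT x|lborel. norm (complex_of_real (?I x))))"
        by (rule integrable_mult_left, rule integrable_norm, rule int)
      then show "integrable lborel (\<lambda>t. LINT x|lborel. norm (case (t, x) of (t, x) \<Rightarrow> a t * complex_of_real (?I x)))"
        by (simp add: norm_mult)
      have "integrable lborel (\<lambda>x. complex_of_real (?I x))"
        using intI by (subst complex_of_real_integrable_eq)
      then show "AE t in lborel. integrable lborel (\<lambda>x. case (t, x) of (t, x) \<Rightarrow> a t * complex_of_real (?I x))"
        by (intro AE_I2) (simp only: split integrable_mult_right)
    qed measurable
    have "norm (?f p) \<le> norm (case p of (t, x) \<Rightarrow> a t * complex_of_real (?I x))" for p
      by (cases p) (simp add: norm_mult indicator_def mult_left_le)
    then show "AE p in lborel \<Otimes>\<^sub>M lborel. norm (?f p) \<le> norm (case p of (t, x) \<Rightarrow> a t * complex_of_real (?I x))"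
      by simp
  qed measurable
  from lborel_pair.Fubini_integral[OF this]
  have "(LINT t|lborel. LINT x|lborel. a t * of_real (?I x * ?e x t))
    = (LINT x|lborel. LINT t|lborel. a t * of_real (?I x * ?e x t))" by simp
  also have "\<dots> = (LINT x|lborel. of_real (?I x) * (LINT t|lborel. a t * of_real (?e x t)))"
  proof -
    have "a t * of_real (?I x * ?e x t) = of_real (?I x) * (a t * of_real (?e x t))" for t x
      by (simp add: mult_ac)
    then show ?thesis by (simp only: integral_mult_right_zero)
  qed
  also have "\<dots> = 0" by (simp only: gauss0) simp
  finally have "(LINT t|lborel. a t * of_real (LINT x|lborel. ?I x * ?e x t)) = 0"
    by (simp only: integral_mult_right_zero integral_complex_of_real)
  then have "of_real (n ^ DIM('a)) * (LINT t|lborel. a t * of_real (LINT x|lborel. ?I x * ?e x t)) = 0" by simp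
  moreover have "a t * of_real (n ^ DIM('a) * (LINT x|lborel. ?I x * ?e x t))
    = of_real (n ^ DIM('a)) * (a t * of_real (LINT x|lborel. ?I x * ?e x t))" for t
    by (simp only: of_real_mult mult.left_commute)
  ultimately show ?thesis
    by (simp only: scale integral_mult_right_zero)
qed

text \<open>On the frequency axis the transform is the Fourier transform of the integrable function
  \<open>w' t * gaussian t\<close>. Uniqueness for such Fourier transforms, obtained from integrals
  over boxes, makes this product vanish, and the Gaussian has no zeros.\<close>

theorem gst_injective:
  fixes w :: "real^'d::finite \<Rightarrow> complex"
  assumes w: "w \<in> L2_space" and 0: "\<And>u. gst w u = 0"
  shows "AE t in lebesgue. w t = 0"
proof -
  obtain w' where w'[measurable]: "w' \<in> borel_measurable borel" and "w' \<in> L2_space"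
    and ae: "AE t in lborel. w t = w' t"
    and eq: "\<And>g. g \<in> borel_measurable borel \<Longrightarrow> L2_inner w g = (LINT t|lborel. w' t * cnj (g t))"
    using L2_space_obtain_borel[OF w] by metis
  define a where "a = (\<lambda>t. w' t * gaussian t)"
  have [measurable]: "a \<in> borel_measurable borel" unfolding a_def by measurable
  have int: "integrable lborel a"
    using integrable_L2_mult[OF \<open>w' \<in> L2_space\<close> L2_space_gaussian]
    by (subst (asm) integrable_completion) (auto simp: a_def)
  have a0: "(LINT t|lborel. a t * phase (x \<bullet> t)) = 0" for x
    using 0[of "(0, - x)"] by (simp add: gst_def eq a_def tf_shift_apply phase_cnj mult_ac)
  have box: "(LINT t:box b c|lborel. a t) = 0" for b c
  proof -
    let ?I = "\<lambda>x. indicator (box b c) x :: real"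
    let ?P = "\<lambda>n t. LINT s|lborel. ?I (t + (1 / real (Suc n)) *\<^sub>R s) * exp (- pi * (s \<bullet> s))"
    have [measurable]: "?I \<in> borel_measurable borel" by simp
    have intE: "integrable lborel (\<lambda>s::real^'d. exp (- pi * (s \<bullet> s)))"
      using integrable_gauss[of 1] by simp
    have E1: "(LINT s|lborel. exp (- pi * ((s::real^'d) \<bullet> s))) = 1"
      using has_bochner_integral_integral_eq[OF has_bochner_integral_gauss[of 1 "0::real^'d"]]
      by simp
    have tends: "(\<lambda>n. t + (1 / real (Suc n)) *\<^sub>R s) \<longlonglongrightarrow> t + 0 *\<^sub>R s" for t s :: "real^'d"
      by (intro tendsto_intros lim_1_over_n LIMSEQ_Suc)
    \<comment> \<open>The smoothed indicator converges off the boundary of the box, which is a null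
      set.\<close>
    have Plim: "(\<lambda>n. ?P n t) \<longlonglongrightarrow> ?I t" if t: "t \<notin> cbox b c - box b c" for t
    proof -
      have "(\<lambda>n. ?P n t) \<longlonglongrightarrow> (LINT s::real^'d|lborel. ?I t * exp (- pi * (s \<bullet> s)))"
      proof (rule integral_dominated_convergence[where w = "\<lambda>s::real^'d. exp (- pi * (s \<bullet> s))"])
        show "AE s in lborel. (\<lambda>n. ?I (t + (1 / real (Suc n)) *\<^sub>R s) * exp (- pi * (s \<bullet> s)))
            \<longlonglongrightarrow> ?I t * exp (- pi * (s \<bullet> s))"
        proof (intro AE_I2 tendsto_mult tendsto_const tendsto_eventually)
          fix s :: "real^'d"
          have "eventually (\<lambda>n. t + (1 / real (Suc n)) *\<^sub>R s \<in> box b c) sequentially" if "t \<in> box b c"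
            using topological_tendstoD[OF tends[of t s] open_box] that by simp
          moreover have "eventually (\<lambda>n. t + (1 / real (Suc n)) *\<^sub>R s \<in> - cbox b c) sequentially" if "t \<notin> cbox b c"
            using topological_tendstoD[OF tends[of t s] open_Compl[OF closed_cbox[of b c]]] that by simp
          ultimately show "\<forall>\<^sub>F n in sequentially. ?I (t + (1 / real (Suc n)) *\<^sub>R s) = ?I t"
            using t box_subset_cbox[of b c]
            by (cases "t \<in> box b c") (auto elim!: eventually_mono simp: indicator_def)
        qed
      qed (use intE in \<open>auto simp: indicator_def\<close>)
      then show ?thesis by (simp only: integral_mult_right_zero E1 mult_1_right)
    qed
    have Pnorm: "norm (?P n t) \<le> 1" for n t
    proof -
      have "norm (?P n t) \<le> (LINT s|lborel. norm (?I (t + (1 / real (Suc n)) *\<^sub>R s) * exp (- pi * (s \<bullet> s))))"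
        by (rule integral_norm_bound)
      also have "\<dots> \<le> (LINT s|lborel. exp (- pi * ((s::real^'d) \<bullet> s)))"
        by (rule integral_mono'[OF intE]) (auto simp: indicator_def)
      finally show ?thesis by (simp only: E1)
    qed
    have [measurable]: "?P n \<in> borel_measurable borel" for n by measurable
    have "(\<lambda>n. LINT t|lborel. a t * of_real (?P n t)) \<longlonglongrightarrow> (LINT t|lborel. a t * of_real (?I t))"
    proof (rule integral_dominated_convergence[where w = "\<lambda>t. norm (a t)"])
      show "AE t in lborel. (\<lambda>n. a t * of_real (?P n t)) \<longlonglongrightarrow> a t * of_real (?I t)"
        using AE_not_in[OF null_sets_cbox_Diff_box[of b c]]
        by eventually_elim (intro tendsto_intros Plim)
      show "AE t in lborel. norm (a t * of_real (?P n t)) \<le> norm (a t)" for n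
        using Pnorm[where n = n] by (intro AE_I2) (simp add: norm_mult mult_left_le)
    qed (use int in simp_all)
    moreover have "(LINT t|lborel. a t * of_real (?P n t)) = 0" for n
      by (rule integral_gauss_box_eq_0[OF int a0]) simp
    ultimately have "(LINT t|lborel. a t * of_real (?I t)) = 0"
      by (simp add: LIMSEQ_const_iff)
    then show ?thesis
      by (simp add: set_lebesgue_integral_def scaleR_conv_of_real mult.commute)
  qed
  have box': "set_integrable lborel (box b c) a" for b c
    unfolding set_integrable_def using int by (intro integrable_mult_indicator) auto
  have int0: "(LINT t|lborel. a t) = 0" using a0[of 0] by simp
  have "AE t in lborel. Re (a t) = 0"
  proof (rule AE_eq_0_if_integral_boxes_eq_0)
    fix b c
    show "(LINT t:box b c|lborel. Re (a t)) = 0"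
      using arg_cong[OF box[of b c], of Re] box'[of b c]
      by (simp add: set_lebesgue_integral_def set_integrable_def flip: integral_Re)
  qed (use int int0 in \<open>simp_all add: integral_Re\<close>)
  moreover have "AE t in lborel. Im (a t) = 0"
  proof (rule AE_eq_0_if_integral_boxes_eq_0)
    fix b c
    show "(LINT t:box b c|lborel. Im (a t)) = 0"
      using arg_cong[OF box[of b c], of Im] box'[of b c]
      by (simp add: set_lebesgue_integral_def set_integrable_def flip: integral_Im)
  qed (use int int0 in \<open>simp_all add: integral_Im\<close>)
  ultimately have "AE t in lborel. w t = 0"
    using ae
  proof eventually_elim
    case (elim t)
    then have "w' t * gaussian t = 0" by (simp add: a_def complex_eq_iff)
    with elim show ?case by (simp add: gaussian_def)
  qed
  then show ?thesis by (simp add: AE_completion_iff)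
qed

subsection \<open>Weights\<close>

text \<open>Inner regularity gives a compact \<open>K\<close> of positive measure inside
  \<open>A\<close>, outer regularity an open \<open>U\<close> around \<open>K\<close> of less than
  twice its measure. A small translate of \<open>K\<close> stays in \<open>U\<close>, where there is
  no room for two disjoint copies.\<close>

lemma steinhaus:
  fixes A :: "'a::euclidean_space set"
  assumes A: "A \<in> sets lebesgue" and pos: "A \<notin> null_sets lebesgue"
  obtains e where "0 < e" "\<And>h. norm h < e \<Longrightarrow> \<exists>x\<in>A. \<exists>y\<in>A. h = x - y"
proof -
  have "A = (\<Union>n::nat. A \<inter> cball 0 (real n))"
    using real_arch_simple by (auto simp: dist_norm)
  then obtain n :: nat where n: "A \<inter> cball 0 (real n) \<notin> null_sets lebesgue"
    using null_sets_UN[of "\<lambda>n. A \<inter> cball 0 (real n)" lebesgue] pos by metis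
  define B where "B = A \<inter> cball 0 (real n)"
  have B: "B \<in> sets lebesgue" "bounded B" "B \<in> lmeasurable"
    using A by (auto simp: B_def intro!: bounded_set_imp_lmeasurable)
  have Bpos: "0 < measure lebesgue B"
  proof (rule ccontr)
    assume "\<not> 0 < measure lebesgue B"
    then have "emeasure lebesgue B = 0"
      using emeasure_eq_measure2[OF B(3)] by (simp add: not_less ennreal_neg)
    then show False using n B(1) by (simp add: B_def null_sets_def)
  qed
  obtain K where K: "closed K" "K \<subseteq> B" "B - K \<in> lmeasurable" "emeasure lebesgue (B - K) < ennreal (measure lebesgue B)"
    using sets_lebesgue_inner_closed[OF B(1) Bpos] by blast
  have "compact K" using K(1,2) B(2) bounded_subset compact_eq_bounded_closed by blast
  then have Km: "K \<in> lmeasurable" by (rule lmeasurable_compact)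
  have "measure lebesgue (B - K) < measure lebesgue B"
    using K(3,4) by (simp add: emeasure_eq_measure2 ennreal_less_iff)
  then have Kpos: "0 < measure lebesgue K"
    using measurable_measure_Diff[OF B(3) fmeasurableD[OF Km] K(2)] by simp
  obtain U where U: "open U" "K \<subseteq> U" "U - K \<in> lmeasurable" "emeasure lebesgue (U - K) < ennreal (measure lebesgue K)"
    using sets_lebesgue_outer_open[OF fmeasurableD[OF Km] Kpos] by blast
  have "U = K \<union> (U - K)" using U(2) by auto
  then have Um: "U \<in> lmeasurable" using fmeasurable.Un[OF Km U(3)] by simp
  have "measure lebesgue (U - K) < measure lebesgue K"
    using U(3,4) by (simp add: emeasure_eq_measure2 ennreal_less_iff)
  then have U2: "measure lebesgue U < 2 * measure lebesgue K"
    using measurable_measure_Diff[OF Um fmeasurableD[OF Km] U(2)] by simp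
  obtain e where e: "0 < e" "(\<Union>x\<in>K. ball x e) \<subseteq> U"
    using compact_subset_open_imp_ball_epsilon_subset[OF \<open>compact K\<close> U(1,2)] by blast
  show thesis
  proof (rule that[OF e(1)])
    fix h :: 'a assume h: "norm h < e"
    have sub: "(+) h ` K \<subseteq> U"
    proof
      fix y assume "y \<in> (+) h ` K"
      then obtain x where "x \<in> K" "y = h + x" by auto
      then have "y \<in> ball x e" using h by (simp add: dist_norm)
      then show "y \<in> U" using e(2) \<open>x \<in> K\<close> by blast
    qed
    have hK: "(+) h ` K \<in> lmeasurable" by (rule measurable_translation) fact
    have "K \<inter> (+) h ` K \<noteq> {}"
    proof
      assume dis: "K \<inter> (+) h ` K = {}"
      have "measure lebesgue (K \<union> (+) h ` K) = 2 * measure lebesgue K"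
        using dis Km hK measure_Un3[OF Km hK] by (simp add: measure_translation)
      moreover have "measure lebesgue (K \<union> (+) h ` K) \<le> measure lebesgue U"
        using Km hK Um sub U(2) by (intro measure_mono_fmeasurable) auto
      ultimately show False using U2 by simp
    qed
    then obtain x y where "x \<in> K" "y \<in> K" "x = h + y" by auto
    then show "\<exists>x\<in>A. \<exists>y\<in>A. h = x - y"
      using K(2) by (intro bexI[of _ x] bexI[of _ y]) (auto simp: B_def)
  qed
qed

text \<open>Some sublevel set of \<open>v\<close> has positive measure. By Steinhaus its differences
  fill a ball, on which submultiplicativity and evenness bound \<open>v\<close>; cutting
  \<open>z\<close> into steps inside this ball turns the local bound into exponential
  growth.\<close>

lemma weight_exp_bound:
  fixes v :: "'a::finite tfplane \<Rightarrow> real"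
  assumes v: "is_weight v"
  obtains a K where "0 \<le> a" "1 \<le> K" "\<And>z. v z \<le> K * exp (a * norm z)"
proof -
  have [measurable]: "v \<in> borel_measurable lebesgue" using v by (simp add: is_weight_def)
  have sub: "v (z + w) \<le> v z * v w" and ge1: "1 \<le> v z" and sym: "v (- z) = v z" for z w
    using v unfolding is_weight_def by blast+
  have v0: "0 \<le> v z" for z using ge1[of z] by simp
  define A where "A n = {z. v z \<le> real n}" for n :: nat
  have A: "A n \<in> sets lebesgue" for n
  proof -
    have "{z \<in> space lebesgue. v z \<le> real n} \<in> sets lebesgue" by measurable
    then show ?thesis by (simp add: A_def)
  qed
  have "(\<Union>n. A n) = UNIV" using real_arch_simple by (auto simp: A_def)
  moreover have "(UNIV :: 'a tfplane set) \<notin> null_sets lebesgue"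
    by (simp add: null_sets_def emeasure_lborel_UNIV)
  ultimately obtain n where "A n \<notin> null_sets lebesgue"
    using null_sets_UN[of A lebesgue] by metis
  then obtain e where e: "0 < e" "\<And>h. norm h < e \<Longrightarrow> \<exists>x\<in>A n. \<exists>y\<in>A n. h = x - y"
    using steinhaus[OF A] by metis
  define N where "N = max 1 ((real n)\<^sup>2)"
  have N: "1 \<le> N" by (simp add: N_def)
  have small: "v h \<le> N" if h: "norm h < e" for h
  proof -
    obtain x y where xy: "v x \<le> real n" "v y \<le> real n" "h = x - y"
      using e(2)[OF h] by (auto simp: A_def)
    have "v h \<le> v x * v y" using sub[of x "- y"] by (simp add: xy sym)
    also have "\<dots> \<le> real n * real n" by (intro mult_mono xy v0) simp
    finally show ?thesis by (simp add: N_def power2_eq_square)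
  qed
  have pow: "v (real (Suc k) *\<^sub>R h) \<le> v h ^ Suc k" for h k
  proof (induction k)
    case (Suc k)
    have "real (Suc (Suc k)) *\<^sub>R h = h + real (Suc k) *\<^sub>R h"
      by (simp only: of_nat_Suc[of "Suc k"] scaleR_add_left scaleR_one)
    then have "v (real (Suc (Suc k)) *\<^sub>R h) \<le> v h * v (real (Suc k) *\<^sub>R h)"
      using sub[of h "real (Suc k) *\<^sub>R h"] by simp
    also have "\<dots> \<le> v h * v h ^ Suc k" by (intro mult_left_mono Suc v0)
    finally show ?case by simp
  qed simp
  define a where "a = ln N / e"
  show thesis
  proof (rule that[of a N])
    show "0 \<le> a" using N e(1) by (simp add: a_def)
    show "1 \<le> N" by (rule N)
    fix z :: "'a tfplane"
    \<comment> \<open>Each of \<open>Suc k\<close> equal steps is shorter than \<open>e\<close>, and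
      \<open>Suc k \<le> norm z / e + 1\<close>. Hence the bound \<open>N ^ Suc k\<close> is at most
      \<open>N * exp (a * norm z)\<close> with \<open>a = ln N / e\<close>.\<close>
    define k where "k = nat \<lfloor>norm z / e\<rfloor>"
    have k: "real k \<le> norm z / e" "norm z / e < real (Suc k)"
      using e(1) by (auto simp: k_def) linarith
    have "norm ((1 / real (Suc k)) *\<^sub>R z) < e"
      using k(2) e(1) by (simp add: field_simps)
    then have "v ((1 / real (Suc k)) *\<^sub>R z) ^ Suc k \<le> N ^ Suc k"
      by (intro power_mono small v0)
    moreover have "v z \<le> v ((1 / real (Suc k)) *\<^sub>R z) ^ Suc k"
      using pow[of k "(1 / real (Suc k)) *\<^sub>R z"] by (simp del: of_nat_Suc)
    moreover have "N ^ Suc k = N powr real (Suc k)" using N by (subst powr_realpow) auto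
    moreover have "\<dots> \<le> N powr (norm z / e + 1)" using N k(1) by (intro powr_mono) auto
    moreover have "\<dots> = N * exp (a * norm z)" using N by (simp add: a_def powr_def exp_add algebra_simps)
    ultimately show "v z \<le> N * exp (a * norm z)" by linarith
  qed
qed

text \<open>A moderate weight is equivalent to a continuous one which is moderate with respect to
  \<open>exp (a * norm z)\<close> with constant 1. This is what makes the sampling density below independent
  of the constant of moderateness.\<close>

lemma moderate_weight_regularise:
  fixes v m :: "'d::finite tfplane \<Rightarrow> real"
  assumes v: "is_weight v" and m: "moderate_weight v m"
    and a: "0 \<le> a" and K: "\<And>z. v z \<le> K * exp (a * norm z)"
  obtains \<mu> c where "continuous_on UNIV \<mu>" "\<And>z. 0 < \<mu> z" "0 < c"
    "\<And>z. m z \<le> c * \<mu> z" "\<And>z. \<mu> z \<le> c * m z"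
    "\<And>z u. \<mu> (z + u) \<le> exp (a * norm u) * \<mu> z"
    "\<And>z u. \<mu> (z + u) \<le> c * v z * \<mu> u"
proof -
  obtain C where C: "0 < C" "\<And>z w. m (z + w) \<le> C * v z * m w" and mpos: "\<And>z. 0 < m z"
    using m unfolding moderate_weight_def by blast
  have v1: "1 \<le> v z" for z using v unfolding is_weight_def by blast
  \<comment> \<open>The supremum of these functions is the least majorant of \<open>m\<close> that
    is moderate for \<open>exp (a * norm z)\<close> with constant 1. The growth bound on
    \<open>v\<close> keeps it finite and comparable to \<open>m\<close>.\<close>
  define g where "g z w = m w * exp (- a * norm (w - z))" for z w
  define \<mu> where "\<mu> z = (SUP w. g z w)" for z
  have K1: "1 \<le> K" using order_trans[OF v1 K, of 0] by simp
  have g_le: "g z w \<le> C * K * m z" for z w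
  proof -
    have "m w \<le> C * v (w - z) * m z" using C(2)[of "w - z" z] by simp
    also have "\<dots> \<le> C * (K * exp (a * norm (w - z))) * m z"
      using C(1) mpos[of z] by (intro mult_right_mono mult_left_mono K) auto
    finally have "g z w \<le> C * (K * exp (a * norm (w - z))) * m z * exp (- a * norm (w - z))"
      unfolding g_def by (intro mult_right_mono) auto
    also have "\<dots> = C * K * m z" by (simp add: exp_minus)
    finally show ?thesis .
  qed
  have bdd: "bdd_above (range (g z))" for z
    by (rule bdd_aboveI2[OF g_le])
  have \<mu>_ge: "m z \<le> \<mu> z" for z
    using cSUP_upper[OF UNIV_I bdd[of z], of z] by (simp add: \<mu>_def g_def)
  have \<mu>_le: "\<mu> z \<le> C * K * m z" for z
    unfolding \<mu>_def by (rule cSUP_least[OF _ g_le]) simp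
  have \<mu>_pos: "0 < \<mu> z" for z using \<mu>_ge[of z] mpos[of z] by linarith
  have mod: "\<mu> (z + u) \<le> exp (a * norm u) * \<mu> z" for z u
    unfolding \<mu>_def[of "z + u"]
  proof (rule cSUP_least)
    fix w
    have "norm (w - z) \<le> norm (w - (z + u)) + norm u"
      using norm_triangle_ineq[of "w - (z + u)" u] by (simp add: algebra_simps)
    from mult_left_mono[OF this a]
    have "exp (- a * norm (w - (z + u))) \<le> exp (a * norm u) * exp (- a * norm (w - z))"
      by (simp add: algebra_simps flip: exp_add)
    then have "g (z + u) w \<le> m w * (exp (a * norm u) * exp (- a * norm (w - z)))"
      unfolding g_def using mpos[of w] by (intro mult_left_mono) auto
    also have "\<dots> = exp (a * norm u) * g z w" by (simp add: g_def)
    also have "\<dots> \<le> exp (a * norm u) * \<mu> z"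
      unfolding \<mu>_def by (intro mult_left_mono cSUP_upper bdd) auto
    finally show "g (z + u) w \<le> exp (a * norm u) * \<mu> z" .
  qed simp
  have cont: "isCont \<mu> z" for z
  proof -
    \<comment> \<open>Because the constant is 1, moderateness read in both directions squeezes
      \<open>\<mu> (z + u)\<close> between two multiples of \<open>\<mu> z\<close> that tend to
      it.\<close>
    have lower: "exp (- (a * norm u)) * \<mu> z \<le> \<mu> (z + u)" for u
    proof -
      have "\<mu> z \<le> exp (a * norm u) * \<mu> (z + u)" using mod[of "z + u" "- u"] by simp
      then show ?thesis by (simp add: exp_minus field_simps)
    qed
    have c1: "isCont (\<lambda>u. exp (- (a * norm u)) * \<mu> z) (0 :: 'd tfplane)"
      by (intro continuous_intros)
    have c2: "isCont (\<lambda>u. exp (a * norm u) * \<mu> z) (0 :: 'd tfplane)"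
      by (intro continuous_intros)
    have "((\<lambda>u. \<mu> (z + u)) \<longlongrightarrow> \<mu> z) (at 0)"
    proof (rule tendsto_sandwich[of "\<lambda>u. exp (- (a * norm u)) * \<mu> z" _ _ "\<lambda>u. exp (a * norm u) * \<mu> z"])
      show "\<forall>\<^sub>F u in at 0. exp (- (a * norm u)) * \<mu> z \<le> \<mu> (z + u)"
        by (intro always_eventually allI lower)
      show "\<forall>\<^sub>F u in at 0. \<mu> (z + u) \<le> exp (a * norm u) * \<mu> z"
        by (intro always_eventually allI mod)
    qed (use c1 c2 in \<open>simp_all add: isCont_def\<close>)
    then show ?thesis by (simp add: isCont_iff)
  qed
  \<comment> \<open>The three entries serve \<open>m \<le> c * \<mu>\<close>,
    \<open>\<mu> \<le> c * m\<close> and the \<open>v\<close>-moderateness of \<open>\<mu>\<close>,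
    in this order.\<close>
  define c where "c = max 1 (max (C * K) (C * K * C))"
  show thesis
  proof (rule that[of \<mu> c])
    show "continuous_on UNIV \<mu>" using cont by (simp add: continuous_on_eq_continuous_at)
    show "0 < c" by (simp add: c_def)
    show "m z \<le> c * \<mu> z" for z
    proof -
      have "1 * \<mu> z \<le> c * \<mu> z" using \<mu>_pos[of z] by (intro mult_right_mono) (auto simp: c_def)
      then show ?thesis using \<mu>_ge[of z] by simp
    qed
    show "\<mu> z \<le> c * m z" for z
    proof -
      have "C * K * m z \<le> c * m z" using mpos[of z] by (intro mult_right_mono) (auto simp: c_def)
      then show ?thesis using \<mu>_le[of z] by simp
    qed
    show "\<mu> (z + u) \<le> c * v z * \<mu> u" for z u
    proof -
      have "\<mu> (z + u) \<le> C * K * (C * v z * m u)"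
        using C(1) K1 by (intro order_trans[OF \<mu>_le] mult_left_mono C(2)) auto
      also have "\<dots> = C * K * C * (v z * m u)" by (simp add: mult_ac)
      also have "\<dots> \<le> c * (v z * \<mu> u)"
      proof (intro mult_mono)
        show "C * K * C \<le> c" by (simp add: c_def)
        show "0 \<le> v z" using v1[of z] by simp
        show "0 \<le> v z * m u" using v1[of z] mpos[of u] by simp
      qed (simp_all add: \<mu>_ge c_def less_imp_le[OF mpos])
      finally show ?thesis by (simp add: mult_ac)
    qed
  qed (simp_all add: \<mu>_pos mod)
qed

subsection \<open>Lattices\<close>

text \<open>Translation carries the isolation of 0 to all lattice points with a common radius, so
  the lattice is uniformly discrete.\<close>

lemma lattice_finite_bounded:
  assumes L: "is_lattice \<Lambda>" and B: "bounded B"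
  shows "finite (\<Lambda> \<inter> B)"
proof -
  have 0: "0 \<in> \<Lambda>" and add: "\<And>z w. z \<in> \<Lambda> \<Longrightarrow> w \<in> \<Lambda> \<Longrightarrow> z + w \<in> \<Lambda>" and neg: "\<And>z. z \<in> \<Lambda> \<Longrightarrow> - z \<in> \<Lambda>"
    and iso: "\<And>l. l \<in> \<Lambda> \<Longrightarrow> l isolated_in \<Lambda>"
    using L unfolding is_lattice_def by blast+
  obtain r where r: "0 < r" "\<And>y. y \<in> \<Lambda> \<Longrightarrow> dist 0 y < r \<Longrightarrow> y = 0"
    using iso[OF 0] unfolding isolated_in_dist_Ex_iff by blast
  have "uniform_discrete \<Lambda>"
  proof (rule uniformI1[OF r(1)])
    fix x y assume "x \<in> \<Lambda>" "y \<in> \<Lambda>" "dist x y < r"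
    then show "x = y" using r(2)[of "x - y"] add[OF _ neg, of x y] by (simp add: dist_norm norm_minus_commute)
  qed
  then have "uniform_discrete (\<Lambda> \<inter> B)" by (auto simp: uniform_discrete_def)
  with B show ?thesis by (simp flip: uniform_discrete_finite_iff add: bounded_Int)
qed

lemma lattice_countable:
  assumes L: "is_lattice \<Lambda>"
  shows "countable \<Lambda>"
proof -
  have "\<Lambda> = (\<Union>n::nat. \<Lambda> \<inter> cball 0 (real n))"
    using real_arch_simple by (auto simp: dist_norm)
  also have "countable \<dots>"
    by (intro countable_UN countable_finite lattice_finite_bounded[OF L] bounded_cball countableI_type)
  finally show ?thesis .
qed

text \<open>The image of an \<open>\<epsilon>\<close>-ball is open in the quotient, as its preimage
  is a union of translated balls. Compactness leaves finitely many images; their centres become the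
  shifts of the windows.\<close>

lemma lattice_finite_cover:
  assumes L: "is_lattice \<Lambda>" and \<epsilon>: "0 < \<epsilon>"
  obtains F where "finite F" "\<And>x. \<exists>l\<in>\<Lambda>. \<exists>z\<in>F. dist x (l + z) < \<epsilon>"
proof -
  have 0: "0 \<in> \<Lambda>" and add: "\<And>z w. z \<in> \<Lambda> \<Longrightarrow> w \<in> \<Lambda> \<Longrightarrow> z + w \<in> \<Lambda>" and neg: "\<And>z. z \<in> \<Lambda> \<Longrightarrow> - z \<in> \<Lambda>"
    using L unfolding is_lattice_def by blast+
  let ?q = "\<lambda>z. (+) z ` \<Lambda>"
  obtain X where X: "quotient_map euclidean X ?q" "compact_space X"
    using L by (auto simp: is_lattice_def)
  have q: "?q x = ?q y \<longleftrightarrow> x - y \<in> \<Lambda>" for x y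
  proof
    assume "?q x = ?q y"
    moreover have "x \<in> ?q x" using 0 by force
    ultimately obtain l where "l \<in> \<Lambda>" "x = y + l" by auto
    then show "x - y \<in> \<Lambda>" by simp
  next
    have *: "?q x \<subseteq> ?q y" if "x - y \<in> \<Lambda>" for x y
    proof
      fix t assume "t \<in> ?q x"
      then obtain l where "l \<in> \<Lambda>" "t = x + l" by auto
      then show "t \<in> ?q y" using add[OF that, of l] by (intro image_eqI[of _ _ "(x - y) + l"]) auto
    qed
    assume "x - y \<in> \<Lambda>"
    with *[of x y] *[of y x] neg[of "x - y"] show "?q x = ?q y" by auto
  qed
  have top: "topspace X = range ?q" using X(1) by (auto simp: quotient_map_def)
  have op: "openin X (?q ` ball z \<epsilon>)" for z
  proof -
    have "{x. ?q x \<in> ?q ` ball z \<epsilon>} = (\<Union>l\<in>\<Lambda>. ball (z + l) \<epsilon>)"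
    proof (intro equalityI subsetI)
      fix x assume "x \<in> {x. ?q x \<in> ?q ` ball z \<epsilon>}"
      then obtain y where "y \<in> ball z \<epsilon>" "?q x = ?q y" by blast
      then have "y \<in> ball z \<epsilon>" "x - y \<in> \<Lambda>" unfolding q .
      then show "x \<in> (\<Union>l\<in>\<Lambda>. ball (z + l) \<epsilon>)"
        by (intro UN_I[of "x - y"]) (auto simp: dist_norm algebra_simps)
    next
      fix x assume "x \<in> (\<Union>l\<in>\<Lambda>. ball (z + l) \<epsilon>)"
      then obtain l where l: "l \<in> \<Lambda>" "x \<in> ball (z + l) \<epsilon>" by auto
      then have "x - l \<in> ball z \<epsilon>" by (simp add: dist_norm algebra_simps)
      moreover have "?q x = ?q (x - l)" using l(1) by (subst q) simp
      ultimately show "x \<in> {x. ?q x \<in> ?q ` ball z \<epsilon>}" by blast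
    qed
    then have "open {x. ?q x \<in> ?q ` ball z \<epsilon>}" by auto
    then show ?thesis using X(1) top by (auto simp: quotient_map_def image_subset_iff)
  qed
  have "compactin X (topspace X)" using X(2) by (simp add: compact_space_def)
  moreover have "topspace X \<subseteq> \<Union> (range (\<lambda>z. ?q ` ball z \<epsilon>))"
  proof
    fix t assume "t \<in> topspace X"
    then obtain z where "t = ?q z" unfolding top by blast
    moreover have "z \<in> ball z \<epsilon>" using \<epsilon> by simp
    ultimately show "t \<in> \<Union> (range (\<lambda>z. ?q ` ball z \<epsilon>))" by blast
  qed
  moreover have "openin X U" if "U \<in> range (\<lambda>z. ?q ` ball z \<epsilon>)" for U
    using that op by blast
  ultimately obtain \<F> where \<F>: "finite \<F>" "\<F> \<subseteq> range (\<lambda>z. ?q ` ball z \<epsilon>)" "topspace X \<subseteq> \<Union>\<F>"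
    using compactinD[of X "topspace X" "range (\<lambda>z. ?q ` ball z \<epsilon>)"] by metis
  obtain F where F: "finite F" "\<F> = (\<lambda>z. ?q ` ball z \<epsilon>) ` F"
    using finite_subset_image[OF \<F>(1,2)] by auto
  show thesis
  proof (rule that[OF F(1)])
    fix x
    have "?q x \<in> \<Union>\<F>" using subsetD[OF \<F>(3), of "?q x"] unfolding top by blast
    then obtain z where z: "z \<in> F" "?q x \<in> ?q ` ball z \<epsilon>" using F(2) by blast
    then obtain y where "y \<in> ball z \<epsilon>" "?q x = ?q y" by blast
    then have y: "y \<in> ball z \<epsilon>" "x - y \<in> \<Lambda>" unfolding q .
    have "dist x ((x - y) + z) < \<epsilon>" using y(1) by (simp add: dist_norm norm_minus_commute algebra_simps)
    then show "\<exists>l\<in>\<Lambda>. \<exists>z\<in>F. dist x (l + z) < \<epsilon>" using y(2) z(1) by blast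
  qed
qed

subsection \<open>The space \<open>M\<^sup>1\<^sub>v\<close>\<close>

text \<open>A common majorant: of the kernel itself and, with the factor \<open>\<theta>\<close>, of
  its oscillation. The exponent \<open>1 / 4\<close> is the one that \<open>gker_osc\<close>
  guarantees and is weaker than the true decay of \<open>gker\<close>.\<close>

abbreviation gauss_bound :: "'a::real_normed_vector \<Rightarrow> real" where
  "gauss_bound z \<equiv> exp (- (norm z)\<^sup>2 / 4)"

lemma norm_gker_le_gauss_bound: "cmod (gker u z) \<le> gauss_bound (z - u)"
proof -
  have "(norm (u - z))\<^sup>2 * 1 \<le> (norm (u - z))\<^sup>2 * (2 * pi)"
    using pi_ge_two by (intro mult_left_mono) auto
  then have "exp (- pi / 2 * (norm (u - z))\<^sup>2) \<le> gauss_bound (z - u)"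
    by (simp add: norm_minus_commute mult_ac)
  then show ?thesis using norm_gker_le[of u z] by (rule order_trans[rotated])
qed

lemma M1_norm_eq: "M1_norm v f = (\<integral>\<^sup>+ z. ennreal (cmod (gst f z) * v z) \<partial>lebesgue)"
  by (simp add: M1_norm_def gst_def)

definition gauss_mass :: "('d::finite tfplane \<Rightarrow> real) \<Rightarrow> ennreal" where
  "gauss_mass v = (\<integral>\<^sup>+ z. ennreal (gauss_bound z * v z) \<partial>lebesgue)"

text \<open>The transform of a functional, as \<open>gst\<close> is that of a square integrable
  function. No conjugation appears because the functionals are conjugate-linear.\<close>

abbreviation stft :: "((real^'d::finite \<Rightarrow> complex) \<Rightarrow> complex) \<Rightarrow> 'd tfplane \<Rightarrow> complex" where
  "stft f u \<equiv> f (tf_shift u gaussian)"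

lemma measurable_gst_lebesgue: "h \<in> L2_space \<Longrightarrow> gst h \<in> borel_measurable lebesgue"
  using measurable_gst[of h] by (intro measurable_completion) simp

context
  fixes v :: "'d::finite tfplane \<Rightarrow> real"
  assumes v: "is_weight v"
begin

lemma weight_measurable [measurable]: "v \<in> borel_measurable lebesgue"
  and weight_add: "v (z + w) \<le> v z * v w"
  and weight_ge_1: "1 \<le> v z"
  and weight_minus: "v (- z) = v z"
  using v unfolding is_weight_def by blast+

lemma weight_nonneg: "0 \<le> v z" and weight_pos: "0 < v z"
  using weight_ge_1[of z] by auto

lemma weight_diff: "v z \<le> v (z - u) * v u"
  using weight_add[of "z - u" u] by simp

lemma M1_spaceD: "h \<in> M1_space v \<Longrightarrow> h \<in> L2_space" "h \<in> M1_space v \<Longrightarrow> M1_norm v h < \<infinity>"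
  by (simp_all add: M1_space_def)

lemma M1_norm_add:
  assumes "h \<in> L2_space" "k \<in> L2_space"
  shows "M1_norm v (\<lambda>t. h t + k t) \<le> M1_norm v h + M1_norm v k"
proof -
  note [measurable] = assms[THEN measurable_gst_lebesgue]
  have "M1_norm v (\<lambda>t. h t + k t)
    \<le> (\<integral>\<^sup>+ z. ennreal (cmod (gst h z) * v z) + ennreal (cmod (gst k z) * v z) \<partial>lebesgue)"
    unfolding M1_norm_eq
  proof (rule nn_integral_mono)
    fix z
    have "cmod (gst h z + gst k z) * v z \<le> (cmod (gst h z) + cmod (gst k z)) * v z"
      by (intro mult_right_mono norm_triangle_ineq weight_nonneg)
    then show "ennreal (cmod (gst (\<lambda>t. h t + k t) z) * v z)
      \<le> ennreal (cmod (gst h z) * v z) + ennreal (cmod (gst k z) * v z)"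
      by (simp add: gst_add assms distrib_right weight_nonneg flip: ennreal_plus)
  qed
  also have "\<dots> = M1_norm v h + M1_norm v k"
    unfolding M1_norm_eq by (rule nn_integral_add) measurable
  finally show ?thesis .
qed

lemma M1_norm_cmult:
  assumes "h \<in> L2_space"
  shows "M1_norm v (\<lambda>t. c * h t) = ennreal (cmod c) * M1_norm v h"
proof -
  note [measurable] = assms[THEN measurable_gst_lebesgue]
  have "M1_norm v (\<lambda>t. c * h t) = (\<integral>\<^sup>+ z. ennreal (cmod c) * ennreal (cmod (gst h z) * v z) \<partial>lebesgue)"
    by (simp add: M1_norm_eq gst_cmult norm_mult mult.assoc weight_nonneg ennreal_mult)
  also have "\<dots> = ennreal (cmod c) * M1_norm v h"
    unfolding M1_norm_eq by (rule nn_integral_cmult) measurable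
  finally show ?thesis .
qed

lemma M1_norm_tf_shift:
  assumes "h \<in> L2_space"
  shows "M1_norm v (tf_shift z h) \<le> ennreal (v z) * M1_norm v h"
proof -
  note [measurable] = assms[THEN measurable_gst_lebesgue]
  have "M1_norm v (tf_shift z h) \<le> (\<integral>\<^sup>+ u. ennreal (v z) * ennreal (cmod (gst h (u + - z)) * v (u + - z)) \<partial>lebesgue)"
    unfolding M1_norm_eq
  proof (rule nn_integral_mono)
    fix u
    have "cmod (gst h (u - z)) * v u \<le> cmod (gst h (u - z)) * (v (u - z) * v z)"
      by (intro mult_left_mono weight_diff) simp
    then show "ennreal (cmod (gst (tf_shift z h) u) * v u) \<le> ennreal (v z) * ennreal (cmod (gst h (u + - z)) * v (u + - z))"
      by (simp add: norm_gst_tf_shift assms mult_ac weight_nonneg flip: ennreal_mult)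
  qed
  also have "\<dots> = (\<integral>\<^sup>+ u. ennreal (v z) * ennreal (cmod (gst h u) * v u) \<partial>lebesgue)"
    by (rule nn_integral_lebesgue_translate[of "\<lambda>u. ennreal (v z) * ennreal (cmod (gst h u) * v u)"]) measurable
  also have "\<dots> = ennreal (v z) * M1_norm v h"
    unfolding M1_norm_eq by (rule nn_integral_cmult) measurable
  finally show ?thesis .
qed

lemma M1_space_add: "h \<in> M1_space v \<Longrightarrow> k \<in> M1_space v \<Longrightarrow> (\<lambda>t. h t + k t) \<in> M1_space v"
  using M1_norm_add[of h k] by (auto simp: M1_space_def L2_space_add intro: le_less_trans)

lemma M1_space_cmult: "h \<in> M1_space v \<Longrightarrow> (\<lambda>t. c * h t) \<in> M1_space v"
  using M1_norm_cmult[of h c] by (auto simp: M1_space_def L2_space_cmult ennreal_mult_less_top)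

lemma M1_space_0: "(\<lambda>t. 0) \<in> M1_space v"
  by (simp add: M1_space_def L2_space_0 M1_norm_eq)

lemma M1_space_tf_shift: "h \<in> M1_space v \<Longrightarrow> tf_shift z h \<in> M1_space v"
  using M1_norm_tf_shift[of h z]
  by (auto simp: M1_space_def L2_space_tf_shift ennreal_mult_less_top intro: le_less_trans)

lemma M1_space_sum: "finite I \<Longrightarrow> (\<And>k. k \<in> I \<Longrightarrow> h k \<in> M1_space v) \<Longrightarrow> (\<lambda>t. \<Sum>k\<in>I. h k t) \<in> M1_space v"
  by (induction I rule: finite_induct) (simp_all add: M1_space_0 M1_space_add)

text \<open>Gaussian decay beats the at most exponential growth of a weight. This puts the shifted
  Gaussians into \<open>M\<^sup>1\<^sub>v\<close>.\<close>

lemma gauss_mass_finite: "gauss_mass v < \<top>"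
proof -
  obtain a K where a: "0 \<le> a" "1 \<le> K" "\<And>z. v z \<le> K * exp (a * norm z)"
    using weight_exp_bound[OF v] by metis
  have "integrable lborel (\<lambda>z::'d tfplane. K * exp (- (1/4) * (norm z)\<^sup>2 + a * norm z))"
    by (intro integrable_mult_right integrable_gauss_exp_norm) simp
  then have "(\<integral>\<^sup>+ z. ennreal (K * exp (- (1/4) * (norm (z :: 'd tfplane))\<^sup>2 + a * norm z)) \<partial>lborel) < \<top>"
    using a(2) by (subst nn_integral_eq_integral) auto
  moreover have "gauss_mass v \<le> (\<integral>\<^sup>+ z. ennreal (K * exp (- (1/4) * (norm (z :: 'd tfplane))\<^sup>2 + a * norm z)) \<partial>lborel)"
    unfolding gauss_mass_def nn_integral_completion
  proof (intro nn_integral_mono ennreal_leI)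
    fix z :: "'d tfplane"
    have "gauss_bound z * v z \<le> gauss_bound z * (K * exp (a * norm z))"
      by (intro mult_left_mono a(3)) simp
    also have "\<dots> = K * exp (- (1/4) * (norm z)\<^sup>2 + a * norm z)"
      by (simp flip: exp_add)
    finally show "gauss_bound z * v z \<le> K * exp (- (1/4) * (norm z)\<^sup>2 + a * norm z)" .
  qed
  ultimately show ?thesis by (rule le_less_trans[rotated])
qed

lemma nn_integral_gauss_bound_shift:
  "(\<integral>\<^sup>+ z. ennreal (gauss_bound (z - u) * v z) \<partial>lebesgue) \<le> ennreal (v u) * gauss_mass v"
proof -
  have [measurable]: "(\<lambda>z::'d tfplane. gauss_bound z) \<in> borel_measurable lebesgue"
    by (intro measurable_completion) measurable
  have "(\<integral>\<^sup>+ z. ennreal (gauss_bound (z - u) * v z) \<partial>lebesgue)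
    \<le> (\<integral>\<^sup>+ z. ennreal (v u) * ennreal (gauss_bound (z + - u) * v (z + - u)) \<partial>lebesgue)"
  proof (rule nn_integral_mono)
    fix z
    have "gauss_bound (z - u) * v z \<le> gauss_bound (z - u) * (v (z - u) * v u)"
      by (intro mult_left_mono weight_diff) simp
    then show "ennreal (gauss_bound (z - u) * v z) \<le> ennreal (v u) * ennreal (gauss_bound (z + - u) * v (z + - u))"
      by (simp add: mult_ac weight_nonneg flip: ennreal_mult)
  qed
  also have "\<dots> = (\<integral>\<^sup>+ z. ennreal (v u) * ennreal (gauss_bound z * v z) \<partial>lebesgue)"
    by (rule nn_integral_lebesgue_translate[of "\<lambda>z. ennreal (v u) * ennreal (gauss_bound z * v z)"]) measurable
  also have "\<dots> = ennreal (v u) * gauss_mass v"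
    unfolding gauss_mass_def by (rule nn_integral_cmult) measurable
  finally show ?thesis .
qed

lemma M1_norm_gaussian_le: "M1_norm v (tf_shift u gaussian) \<le> ennreal (v u) * gauss_mass v"
proof -
  have "M1_norm v (tf_shift u gaussian) \<le> (\<integral>\<^sup>+ z. ennreal (gauss_bound (z - u) * v z) \<partial>lebesgue)"
    unfolding M1_norm_eq gker_def[symmetric]
    by (intro nn_integral_mono ennreal_leI mult_right_mono norm_gker_le_gauss_bound weight_nonneg)
  then show ?thesis using nn_integral_gauss_bound_shift by (rule order_trans)
qed

lemma M1_space_gaussian [simp]: "tf_shift u gaussian \<in> M1_space v"
  using le_less_trans[OF M1_norm_gaussian_le[of u]] gauss_mass_finite
  by (simp add: M1_space_def ennreal_mult_less_top)

text \<open>Turns the pointwise oscillation of the kernel into an estimate in the norm of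
  \<open>M\<^sup>1\<^sub>v\<close>, the form in which a bounded functional can use it.\<close>

lemma M1_norm_gaussian_diff_le:
  assumes osc: "\<And>z. cmod (gker u z - osc_phase u u' * gker u' z) \<le> \<theta> * gauss_bound (z - u)" and "0 \<le> \<theta>"
  shows "M1_norm v (\<lambda>t. tf_shift u gaussian t + (- osc_phase u u') * tf_shift u' gaussian t)
    \<le> ennreal (\<theta> * v u) * gauss_mass v"
proof -
  have [measurable]: "(\<lambda>z. gauss_bound (z - u)) \<in> borel_measurable lebesgue"
    by (intro measurable_completion) measurable
  have "gst (\<lambda>t. tf_shift u gaussian t + (- osc_phase u u') * tf_shift u' gaussian t) z
      = gker u z - osc_phase u u' * gker u' z" for z
    by (subst gst_add[OF L2_space_gaussian_shift L2_space_cmult[OF L2_space_gaussian_shift]])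
      (simp only: gst_cmult gker_def, simp)
  then have "M1_norm v (\<lambda>t. tf_shift u gaussian t + (- osc_phase u u') * tf_shift u' gaussian t)
    = (\<integral>\<^sup>+ z. ennreal (cmod (gker u z - osc_phase u u' * gker u' z) * v z) \<partial>lebesgue)"
    by (simp add: M1_norm_eq)
  also have "\<dots> \<le> (\<integral>\<^sup>+ z. ennreal \<theta> * ennreal (gauss_bound (z - u) * v z) \<partial>lebesgue)"
  proof (rule nn_integral_mono)
    fix z
    show "ennreal (cmod (gker u z - osc_phase u u' * gker u' z) * v z) \<le> ennreal \<theta> * ennreal (gauss_bound (z - u) * v z)"
      using mult_right_mono[OF osc[of z] weight_nonneg[of z]] \<open>0 \<le> \<theta>\<close>
      by (simp add: mult_ac weight_nonneg flip: ennreal_mult)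
  qed
  also have "\<dots> = ennreal \<theta> * (\<integral>\<^sup>+ z. ennreal (gauss_bound (z - u) * v z) \<partial>lebesgue)"
    by (rule nn_integral_cmult) measurable
  also have "\<dots> \<le> ennreal \<theta> * (ennreal (v u) * gauss_mass v)"
    by (intro mult_left_mono nn_integral_gauss_bound_shift) simp
  finally show ?thesis
    using \<open>0 \<le> \<theta>\<close> by (simp add: ennreal_mult weight_nonneg mult_ac)
qed

subsection \<open>Bounded conjugate-linear functionals\<close>

lemma M1_dualD:
  assumes "f \<in> M1_dual v"
  shows M1_dual_add: "h \<in> M1_space v \<Longrightarrow> k \<in> M1_space v \<Longrightarrow> f (\<lambda>t. h t + k t) = f h + f k"
    and M1_dual_cmult: "h \<in> M1_space v \<Longrightarrow> f (\<lambda>t. c * h t) = cnj c * f h"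
    and M1_dual_outside: "h \<notin> M1_space v \<Longrightarrow> f h = 0"
  using assms by (auto simp: M1_dual_def)

lemma M1_dual_bound:
  assumes "f \<in> M1_dual v"
  obtains C where "0 \<le> C" "\<And>h. h \<in> M1_space v \<Longrightarrow> ennreal (cmod (f h)) \<le> ennreal C * M1_norm v h"
proof -
  obtain C where C: "\<And>h. h \<in> M1_space v \<Longrightarrow> ennreal (cmod (f h)) \<le> ennreal C * M1_norm v h"
    using assms unfolding M1_dual_def by blast
  show thesis
    by (rule that[of "max 0 C"]) (use C in \<open>auto simp: max_def ennreal_neg split: if_splits\<close>)
qed

lemma M1_dual_sum:
  assumes f: "f \<in> M1_dual v" and "finite I" "\<And>k. k \<in> I \<Longrightarrow> h k \<in> M1_space v"
  shows "f (\<lambda>t. \<Sum>k\<in>I. c k * h k t) = (\<Sum>k\<in>I. cnj (c k) * f (h k))"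
  using assms(2,3)
proof (induction I rule: finite_induct)
  case empty
  then show ?case using M1_dual_cmult[OF f M1_space_0, of 0] by simp
next
  case (insert k I)
  have "f (\<lambda>t. c k * h k t + (\<Sum>k\<in>I. c k * h k t)) = f (\<lambda>t. c k * h k t) + f (\<lambda>t. \<Sum>k\<in>I. c k * h k t)"
    using insert by (intro M1_dual_add[OF f] M1_space_cmult M1_space_sum) auto
  with insert show ?case by (simp add: M1_dual_cmult[OF f])
qed

text \<open>Boundedness of \<open>f\<close> tested on shifted Gaussians and on phase-corrected
  differences of them. The constant is independent of \<open>\<theta>\<close>, so
  \<open>\<theta>\<close> may be chosen, or sent to 0, afterwards.\<close>

lemma stft_bound:
  assumes f: "f \<in> M1_dual v"
  obtains C where "0 \<le> C" "\<And>u. cmod (stft f u) \<le> C * v u"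
    "\<And>\<theta> u u'. 0 \<le> \<theta> \<Longrightarrow> (\<And>z. cmod (gker u z - osc_phase u u' * gker u' z) \<le> \<theta> * gauss_bound (z - u)) \<Longrightarrow>
      cmod (stft f u - cnj (osc_phase u u') * stft f u') \<le> \<theta> * (C * v u)"
proof -
  obtain C where C: "0 \<le> C" "\<And>h. h \<in> M1_space v \<Longrightarrow> ennreal (cmod (f h)) \<le> ennreal C * M1_norm v h"
    using M1_dual_bound[OF f] by metis
  obtain I where I: "gauss_mass v = ennreal I" "0 \<le> I"
    using gauss_mass_finite by (cases "gauss_mass v") auto
  show thesis
  proof (rule that[of "C * I"])
    show "0 \<le> C * I" using C I by simp
    fix u
    have "ennreal (cmod (stft f u)) \<le> ennreal C * (ennreal (v u) * ennreal I)"
      using C(2)[of "tf_shift u gaussian"] mult_left_mono[OF M1_norm_gaussian_le[of u], of "ennreal C"]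
      unfolding I by (auto intro: order_trans)
    then show "cmod (stft f u) \<le> C * I * v u"
      using C(1) I(2) weight_nonneg[of u] by (simp add: mult_ac flip: ennreal_mult)
  next
    fix \<theta> :: real and u u' :: "'d tfplane" assume \<theta>: "0 \<le> \<theta>"
      and osc: "\<And>z. cmod (gker u z - osc_phase u u' * gker u' z) \<le> \<theta> * gauss_bound (z - u)"
    let ?h = "\<lambda>t :: real^'d. tf_shift u gaussian t + (- osc_phase u u') * tf_shift u' gaussian t"
    have "f ?h = stft f u - cnj (osc_phase u u') * stft f u'"
      by (subst M1_dual_add[OF f M1_space_gaussian M1_space_cmult[OF M1_space_gaussian]])
        (simp only: M1_dual_cmult[OF f M1_space_gaussian], simp)
    moreover have "ennreal (cmod (f ?h)) \<le> ennreal C * (ennreal (\<theta> * v u) * ennreal I)"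
      using C(2)[OF M1_space_add[OF M1_space_gaussian M1_space_cmult[OF M1_space_gaussian]], of u "- osc_phase u u'" u']
        mult_left_mono[OF M1_norm_gaussian_diff_le[OF osc \<theta>], of "ennreal C"]
      unfolding I by (auto intro: order_trans)
    ultimately show "cmod (stft f u - cnj (osc_phase u u') * stft f u') \<le> \<theta> * (C * I * v u)"
      using C(1) I(2) weight_nonneg[of u] \<theta> by (simp add: mult_ac flip: ennreal_mult)
  qed
qed

text \<open>Continuity up to the phase is contained in \<open>stft_bound\<close>, and the phase
  itself is continuous. The purpose is Borel measurability of the transform.\<close>

lemma continuous_stft:
  assumes f: "f \<in> M1_dual v"
  shows "continuous_on UNIV (stft f)"
proof -
  obtain C where C: "0 \<le> C"
    "\<And>\<theta> u u'. 0 \<le> \<theta> \<Longrightarrow> (\<And>z. cmod (gker u z - osc_phase u u' * gker u' z) \<le> \<theta> * gauss_bound (z - u)) \<Longrightarrow>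
      cmod (stft f u - cnj (osc_phase u u') * stft f u') \<le> \<theta> * (C * v u)"
    using stft_bound[OF f] by metis
  have "isCont (stft f) u" for u
  proof -
    have osc: "((\<lambda>u'. osc_phase u u') \<longlongrightarrow> osc_phase u u) (at u)"
      unfolding osc_phase_def by (intro tendsto_intros)
    have "((\<lambda>u'. cnj (osc_phase u u') * stft f u' - stft f u) \<longlongrightarrow> 0) (at u)"
    proof (rule tendstoI)
      fix e :: real assume e: "0 < e"
      \<comment> \<open>The added 1 keeps the denominator positive when
        \<open>C = 0\<close>.\<close>
      define \<theta> where "\<theta> = e / (2 * (C * v u + 1))"
      have pos: "0 < C * v u + 1" using C(1) weight_nonneg[of u] by (simp add: add_nonneg_pos)
      have \<theta>: "0 < \<theta>" using e pos by (simp add: \<theta>_def)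
      obtain \<epsilon> where \<epsilon>: "0 < \<epsilon>" "\<And>u u' z :: 'd tfplane. norm (u' - u) \<le> \<epsilon> \<Longrightarrow>
          cmod (gker u z - osc_phase u u' * gker u' z) \<le> \<theta> * gauss_bound (z - u)"
        using gker_osc[OF \<theta>] by metis
      have "\<theta> * (C * v u) < e"
      proof -
        have "\<theta> * (C * v u) \<le> \<theta> * (C * v u + 1)" using \<theta> by (intro mult_left_mono) auto
        also have "\<dots> = e / 2" using pos by (simp add: \<theta>_def field_simps)
        finally show ?thesis using e by simp
      qed
      moreover have "cmod (cnj (osc_phase u u') * stft f u' - stft f u) \<le> \<theta> * (C * v u)" if "norm (u' - u) \<le> \<epsilon>" for u'
        using C(2)[of \<theta> u u', OF _ \<epsilon>(2)[OF that]] \<theta> by (simp add: norm_minus_commute)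
      ultimately show "\<forall>\<^sub>F u' in at u. dist (cnj (osc_phase u u') * stft f u' - stft f u) 0 < e"
        unfolding eventually_at dist_norm diff_0_right using \<epsilon>(1)
        by (intro exI[of _ \<epsilon>] conjI ballI impI) (blast intro: less_imp_le le_less_trans)+
    qed
    then have "((\<lambda>u'. cnj (osc_phase u u') * stft f u') \<longlongrightarrow> stft f u) (at u)"
      by (rule LIM_zero_cancel)
    from tendsto_mult[OF osc this]
    have "((\<lambda>u'. osc_phase u u' * (cnj (osc_phase u u') * stft f u')) \<longlongrightarrow> stft f u) (at u)"
      by (simp add: osc_phase_def)
    moreover have "osc_phase u u' * (cnj (osc_phase u u') * stft f u') = stft f u'" for u'
      by (simp add: osc_phase_def phase_cnj flip: mult.assoc)
    ultimately show ?thesis by (simp add: isCont_def)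
  qed
  then show ?thesis by (simp add: continuous_on_eq_continuous_at)
qed

lemma measurable_stft: "f \<in> M1_dual v \<Longrightarrow> stft f \<in> borel_measurable borel"
  by (intro borel_measurable_continuous_onI continuous_stft)

end

section \<open>Synthesis of functionals and their representation by the transform\<close>

lemma norm_integral_le_nn_integral:
  fixes f :: "'a \<Rightarrow> 'b::{banach, second_countable_topology}"
  shows "ennreal (norm (integral\<^sup>L M f)) \<le> (\<integral>\<^sup>+ x. ennreal (norm (f x)) \<partial>M)"
  \<comment> \<open>In the non-integrable case the Bochner integral is 0 by convention.\<close>
  using integral_norm_bound_ennreal[of M f]
  by (cases "integrable M f") (simp_all add: not_integrable_integral_eq)

text \<open>The weak form of the superposition of the vectors \<open>\<pi>(u)\<phi>\<close> with
  density \<open>G\<close>, divided by the squared norm of the Gaussian. The value 0 outside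
  \<open>M1_space v\<close> follows the convention of \<open>M1_dual\<close>.\<close>

definition synth :: "('d::finite tfplane \<Rightarrow> real) \<Rightarrow> ('d tfplane \<Rightarrow> complex) \<Rightarrow> (real^'d \<Rightarrow> complex) \<Rightarrow> complex" where
  "synth v G h = (if h \<in> M1_space v
     then of_real (sqrt 2 ^ CARD('d)) * (LINT u|lborel. G u * cnj (gst h u)) else 0)"

context
  fixes v :: "'d::finite tfplane \<Rightarrow> real"
  assumes v: "is_weight v"
begin

lemmas [measurable] = weight_measurable[OF v]

text \<open>The triangle inequality for a continuous superposition in
  \<open>M\<^sup>1\<^sub>v\<close>, phrased through transforms so that it applies to the error of a
  Riemann sum. The proof is Tonelli, for which \<open>b\<close> replaces \<open>v\<close> by a Borel
  function.\<close>

lemma M1_norm_superposition: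
  assumes \<Phi>[measurable]: "\<Phi> \<in> borel_measurable borel"
    and \<rho>[measurable]: "\<rho> \<in> borel_measurable borel" and \<rho>0: "\<And>u. 0 \<le> \<rho> u"
    and R: "\<And>u z. cmod (R u z) \<le> \<rho> u * gauss_bound (z - u)"
    and E: "\<And>z. gst E z = c * (LINT u|lborel. \<Phi> u * R u z)"
  shows "M1_norm v E \<le> ennreal (cmod c) * ((\<integral>\<^sup>+ u. ennreal (cmod (\<Phi> u) * \<rho> u * v u) \<partial>lebesgue) * gauss_mass v)"
proof -
  obtain b where b[measurable]: "b \<in> borel_measurable lborel" and vb: "AE z in lborel. ennreal (v z) = b z"
    using completion_ex_borel_measurable[of "\<lambda>z. ennreal (v z)" lborel] by auto
  have [measurable]: "b \<in> borel_measurable borel" using b by simp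
  have [measurable]: "(\<lambda>u. ennreal (cmod (\<Phi> u) * \<rho> u)) \<in> borel_measurable borel" by measurable
  have "M1_norm v E = (\<integral>\<^sup>+ z. ennreal (cmod (gst E z)) * b z \<partial>lborel)"
    unfolding M1_norm_eq nn_integral_completion
    by (rule nn_integral_cong_AE) (use vb in \<open>auto elim!: eventually_mono simp: ennreal_mult weight_nonneg[OF v]\<close>)
  also have "\<dots> \<le> (\<integral>\<^sup>+ z. (\<integral>\<^sup>+ u. ennreal (cmod c) * ennreal (cmod (\<Phi> u) * \<rho> u) * ennreal (gauss_bound (z - u)) \<partial>lborel) * b z \<partial>lborel)"
  proof (intro nn_integral_mono mult_right_mono)
    fix z
    have "ennreal (cmod (gst E z)) = ennreal (cmod c) * ennreal (cmod (LINT u|lborel. \<Phi> u * R u z))"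
      by (simp add: E norm_mult ennreal_mult)
    also have "\<dots> \<le> ennreal (cmod c) * (\<integral>\<^sup>+ u. ennreal (cmod (\<Phi> u * R u z)) \<partial>lborel)"
      by (intro mult_left_mono norm_integral_le_nn_integral) simp
    also have "\<dots> \<le> ennreal (cmod c) * (\<integral>\<^sup>+ u. ennreal (cmod (\<Phi> u) * \<rho> u) * ennreal (gauss_bound (z - u)) \<partial>lborel)"
    proof (intro mult_left_mono nn_integral_mono)
      fix u
      show "ennreal (cmod (\<Phi> u * R u z)) \<le> ennreal (cmod (\<Phi> u) * \<rho> u) * ennreal (gauss_bound (z - u))"
        using mult_left_mono[OF R[of u z], of "cmod (\<Phi> u)"] \<rho>0[of u]
        by (simp add: norm_mult mult.assoc flip: ennreal_mult)
    qed simp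
    also have "\<dots> = (\<integral>\<^sup>+ u. ennreal (cmod c) * ennreal (cmod (\<Phi> u) * \<rho> u) * ennreal (gauss_bound (z - u)) \<partial>lborel)"
      by (subst nn_integral_cmult[symmetric]) (auto simp: mult.assoc)
    finally show "ennreal (cmod (gst E z)) \<le> (\<integral>\<^sup>+ u. ennreal (cmod c) * ennreal (cmod (\<Phi> u) * \<rho> u) * ennreal (gauss_bound (z - u)) \<partial>lborel)" .
  qed simp
  also have "\<dots> = (\<integral>\<^sup>+ z. (\<integral>\<^sup>+ u. ennreal (cmod c) * ennreal (cmod (\<Phi> u) * \<rho> u) * ennreal (gauss_bound (z - u)) * b z \<partial>lborel) \<partial>lborel)"
    by (intro nn_integral_cong nn_integral_multc[symmetric]) measurable
  also have "\<dots> = (\<integral>\<^sup>+ u. (\<integral>\<^sup>+ z. ennreal (cmod c) * ennreal (cmod (\<Phi> u) * \<rho> u) * ennreal (gauss_bound (z - u)) * b z \<partial>lborel) \<partial>lborel)"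
    by (rule lborel_pair.Fubini') measurable
  also have "\<dots> = (\<integral>\<^sup>+ u. ennreal (cmod c) * ennreal (cmod (\<Phi> u) * \<rho> u) * (\<integral>\<^sup>+ z. ennreal (gauss_bound (z - u)) * b z \<partial>lborel) \<partial>lborel)"
    by (subst nn_integral_cmult[symmetric]) (auto simp: mult.assoc)
  also have "\<dots> \<le> (\<integral>\<^sup>+ u. ennreal (cmod c) * ennreal (cmod (\<Phi> u) * \<rho> u) * (ennreal (v u) * gauss_mass v) \<partial>lborel)"
  proof (intro nn_integral_mono mult_left_mono)
    fix u
    have "(\<integral>\<^sup>+ z. ennreal (gauss_bound (z - u)) * b z \<partial>lborel) = (\<integral>\<^sup>+ z. ennreal (gauss_bound (z - u) * v z) \<partial>lebesgue)"
      unfolding nn_integral_completion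
      by (rule nn_integral_cong_AE) (use vb in \<open>auto elim!: eventually_mono simp: ennreal_mult weight_nonneg[OF v]\<close>)
    then show "(\<integral>\<^sup>+ z. ennreal (gauss_bound (z - u)) * b z \<partial>lborel) \<le> ennreal (v u) * gauss_mass v"
      using nn_integral_gauss_bound_shift[OF v, of u] by simp
  qed simp
  also have "\<dots> = (\<integral>\<^sup>+ u. ennreal (cmod c) * (ennreal (cmod (\<Phi> u) * \<rho> u * v u) * gauss_mass v) \<partial>lebesgue)"
    unfolding nn_integral_completion
    by (intro nn_integral_cong) (simp add: mult.assoc ennreal_mult weight_nonneg[OF v] \<rho>0)
  also have "\<dots> = ennreal (cmod c) * ((\<integral>\<^sup>+ u. ennreal (cmod (\<Phi> u) * \<rho> u * v u) \<partial>lebesgue) * gauss_mass v)"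
  proof -
    have [measurable]: "\<Phi> \<in> borel_measurable lebesgue" "\<rho> \<in> borel_measurable lebesgue"
      by (auto intro: measurable_completion)
    show ?thesis
      by (subst nn_integral_cmult, measurable) (subst nn_integral_multc, measurable)
  qed
  finally show ?thesis .
qed

text \<open>Duality between functions bounded by a multiple of \<open>v\<close> and functions
  integrable against \<open>v\<close>; it makes \<open>synth\<close> a bounded functional.\<close>

lemma pairing:
  assumes G[measurable]: "G \<in> borel_measurable borel" and bound: "\<And>u. cmod (G u) \<le> C * v u" and h: "h \<in> M1_space v"
  shows "integrable lborel (\<lambda>u. G u * cnj (gst h u))"
    and "ennreal (cmod (LINT u|lborel. G u * cnj (gst h u))) \<le> ennreal C * M1_norm v h"
proof -
  note [measurable] = measurable_gst[OF M1_spaceD(1)[OF v h]] measurable_gst_lebesgue[OF M1_spaceD(1)[OF v h]]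
  have "0 \<le> C * v 0" using order_trans[OF norm_ge_zero bound[of 0]] .
  then have C: "0 \<le> C" using weight_pos[OF v, of 0] by (simp add: zero_le_mult_iff)
  have le: "(\<integral>\<^sup>+ u. ennreal (cmod (G u * cnj (gst h u))) \<partial>lborel) \<le> ennreal C * M1_norm v h"
  proof -
    have "(\<integral>\<^sup>+ u. ennreal (cmod (G u * cnj (gst h u))) \<partial>lborel)
      \<le> (\<integral>\<^sup>+ u. ennreal C * ennreal (cmod (gst h u) * v u) \<partial>lebesgue)"
      unfolding nn_integral_completion
    proof (rule nn_integral_mono)
      fix u
      show "ennreal (cmod (G u * cnj (gst h u))) \<le> ennreal C * ennreal (cmod (gst h u) * v u)"
        using mult_right_mono[OF bound[of u] norm_ge_zero[of "gst h u"]] C weight_nonneg[OF v, of u]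
        by (simp add: norm_mult mult_ac flip: ennreal_mult)
    qed
    also have "\<dots> = ennreal C * M1_norm v h"
      unfolding M1_norm_eq by (rule nn_integral_cmult) measurable
    finally show ?thesis .
  qed
  show "integrable lborel (\<lambda>u. G u * cnj (gst h u))"
    unfolding integrable_iff_bounded
    using le M1_spaceD(2)[OF v h] by (auto intro: le_less_trans simp: ennreal_mult_less_top)
  show "ennreal (cmod (LINT u|lborel. G u * cnj (gst h u))) \<le> ennreal C * M1_norm v h"
    using norm_integral_le_nn_integral le by (rule order_trans)
qed

lemma synth_M1_dual:
  assumes G: "G \<in> borel_measurable borel" and bound: "\<And>u. cmod (G u) \<le> C * v u"
  shows "synth v G \<in> M1_dual v"
proof -
  note int = pairing(1)[OF G bound]
  have add: "synth v G (\<lambda>t. h t + k t) = synth v G h + synth v G k"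
    if h: "h \<in> M1_space v" and k: "k \<in> M1_space v" for h k
    using int[OF h] int[OF k]
    by (simp add: synth_def h k M1_space_add[OF v] gst_add M1_spaceD[OF v] distrib_left)
  have scale: "synth v G (\<lambda>t. c * h t) = cnj c * synth v G h" if h: "h \<in> M1_space v" for c h
    using int[OF h] by (simp add: synth_def h M1_space_cmult[OF v] gst_cmult mult.left_commute[of _ "cnj c"])
  have bnd: "ennreal (cmod (synth v G h)) \<le> ennreal (sqrt 2 ^ CARD('d) * C) * M1_norm v h"
    if h: "h \<in> M1_space v" for h
  proof -
    have "ennreal (cmod (synth v G h)) = ennreal (sqrt 2 ^ CARD('d)) * ennreal (cmod (LINT u|lborel. G u * cnj (gst h u)))"
      by (simp add: synth_def h norm_mult norm_power ennreal_mult)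
    also have "\<dots> \<le> ennreal (sqrt 2 ^ CARD('d)) * (ennreal C * M1_norm v h)"
      by (intro mult_left_mono pairing(2)[OF G bound h]) simp
    finally show ?thesis by (simp add: ennreal_mult' mult.assoc)
  qed
  have outside: "synth v G h = 0" if "h \<notin> M1_space v" for h using that by (simp add: synth_def)
  show ?thesis unfolding M1_dual_def using add scale bnd outside by blast
qed

lemma stft_synth: "stft (synth v G) z = of_real (sqrt 2 ^ CARD('d)) * (LINT u|lborel. G u * gker u z)"
  by (simp add: synth_def M1_space_gaussian[OF v] gker_cnj flip: gker_def)

text \<open>The identity \<open>f = synth v (stft f)\<close> is proved by Riemann sums in \<open>M\<^sup>1\<^sub>v\<close>: no Bochner integral with
  values in that space is available.\<close>

lemma M1_dual_partition_bound:
  assumes f: "f \<in> M1_dual v" and h: "h \<in> M1_space v"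
  obtains D where "0 \<le> D"
    "\<And>\<theta> (B :: nat \<Rightarrow> 'd tfplane set) p n. 0 \<le> \<theta> \<Longrightarrow> disjoint_family B \<Longrightarrow> (\<And>k. B k \<in> sets borel) \<Longrightarrow>
      (\<And>k u z. u \<in> B k \<Longrightarrow> cmod (gker u z - osc_phase u (p k) * gker (p k) z) \<le> \<theta> * gauss_bound (z - u)) \<Longrightarrow>
      ennreal (cmod (f h - synth v (stft f) h)) \<le>
        ennreal D * (\<integral>\<^sup>+ u. ennreal (cmod (gst h u) * (\<theta> + indicator (- (\<Union>k<n. B k)) u) * v u) \<partial>lebesgue)"
proof -
  let ?c = "sqrt 2 ^ CARD('d)"
  let ?\<Phi> = "gst h"
  have hL: "h \<in> L2_space" using M1_spaceD[OF v h] by simp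
  note [measurable] = measurable_gst[OF hL] measurable_gst_lebesgue[OF hL] measurable_stft[OF v f]
  obtain C where C: "0 \<le> C" "\<And>u. cmod (stft f u) \<le> C * v u"
    "\<And>\<theta> u u'. 0 \<le> \<theta> \<Longrightarrow> (\<And>z. cmod (gker u z - osc_phase u u' * gker u' z) \<le> \<theta> * gauss_bound (z - u)) \<Longrightarrow>
      cmod (stft f u - cnj (osc_phase u u') * stft f u') \<le> \<theta> * (C * v u)"
    using stft_bound[OF v f] by metis
  obtain C' where C': "0 \<le> C'" "\<And>h. h \<in> M1_space v \<Longrightarrow> ennreal (cmod (f h)) \<le> ennreal C' * M1_norm v h"
    using M1_dual_bound[OF v f] by metis
  obtain I where I: "gauss_mass v = ennreal I" "0 \<le> I"
    using gauss_mass_finite[OF v] by (cases "gauss_mass v") auto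
  have int\<Phi>: "integrable lborel ?\<Phi>"
    using pairing(1)[of "\<lambda>_. 1" 1 h] weight_ge_1[OF v] h by (simp add: complex_integrable_cnj)
  have intF: "integrable lborel (\<lambda>u. stft f u * cnj (?\<Phi> u))"
    by (rule pairing(1)[OF measurable_stft[OF v f] C(2) h])
  show thesis
  proof (rule that[of "C' * ?c * I + ?c * C"])
    show "0 \<le> C' * ?c * I + ?c * C" using C C' I by simp
    fix \<theta> :: real and B :: "nat \<Rightarrow> 'd tfplane set" and p n
    assume \<theta>: "0 \<le> \<theta>" and disj: "disjoint_family B" and B[measurable]: "\<And>k. B k \<in> sets borel"
      and osc: "\<And>k u z. u \<in> B k \<Longrightarrow> cmod (gker u z - osc_phase u (p k) * gker (p k) z) \<le> \<theta> * gauss_bound (z - u)"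
    define S where "S = (\<Union>k<n. B k)"
    have [measurable]: "S \<in> sets borel" unfolding S_def by measurable
    \<comment> \<open>The local relative error: \<open>\<theta>\<close> on the first
      \<open>n\<close> cells, and an additional 1 off them, where the whole kernel is lost.\<close>
    define \<rho> where "\<rho> u = \<theta> + indicator (- S) u" for u :: "'d tfplane"
    have \<rho>0: "0 \<le> \<rho> u" for u using \<theta> by (simp add: \<rho>_def)
    have [measurable]: "\<rho> \<in> borel_measurable borel" unfolding \<rho>_def by measurable
    have [measurable]: "(\<lambda>u. osc_phase u y) \<in> borel_measurable borel" for y :: "'d tfplane"
      unfolding osc_phase_def by (intro borel_measurable_continuous_onI continuous_intros)
    define J where "J = (\<integral>\<^sup>+ u. ennreal (cmod (?\<Phi> u) * \<rho> u * v u) \<partial>lebesgue)"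
    \<comment> \<open>Coefficients of a Riemann sum for the reproducing formula of \<open>h\<close>,
      with the phase that aligns \<open>u\<close> with the sample point \<open>p k\<close>. The
      vector \<open>E\<close> below is what the first \<open>n\<close> cells miss of
      \<open>h\<close>.\<close>
    define \<alpha> where "\<alpha> k = of_real ?c * (LINT u|lborel. ?\<Phi> u * (indicator (B k) u * osc_phase u (p k)))" for k
    define E where "E t = h t + (\<Sum>k<n. (- \<alpha> k) * tf_shift (p k) gaussian t)" for t
    have sel: "(\<Sum>k<n. indicator (B k) u * g k) = (if u \<in> B j then g j else 0)" if "j < n" "u \<in> B j" for u j and g :: "nat \<Rightarrow> complex"
    proof -
      have "u \<notin> B k" if "k \<noteq> j" for k
        using disj that \<open>u \<in> B j\<close> by (auto simp: disjoint_family_on_def)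
      then have "(\<Sum>k<n. indicator (B k) u * g k) = (\<Sum>k<n. if k = j then g j else 0)"
        using \<open>u \<in> B j\<close> by (intro sum.cong) auto
      then show ?thesis using that by simp
    qed
    have int\<alpha>: "integrable lborel (\<lambda>u. ?\<Phi> u * (indicator (B k) u * osc_phase u (p k)))" for k
      by (rule Bochner_Integration.integrable_bound[OF int\<Phi>]) (auto simp: norm_mult indicator_def)
    have EM: "E \<in> M1_space v"
      unfolding E_def by (intro M1_space_add[OF v] h M1_space_sum[OF v] M1_space_cmult[OF v] M1_space_gaussian[OF v]) auto
    have gst_sum: "gst (\<lambda>t. \<Sum>k<m. (- \<alpha> k) * tf_shift (p k) gaussian t) z = (\<Sum>k<m. (- \<alpha> k) * gker (p k) z)
        \<and> (\<lambda>t. \<Sum>k<m. (- \<alpha> k) * tf_shift (p k) gaussian t) \<in> L2_space" for m z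
    proof (induction m)
      case (Suc m)
      have "(\<lambda>t. (- \<alpha> m) * tf_shift (p m) gaussian t) \<in> L2_space" by (intro L2_space_cmult L2_space_gaussian_shift)
      with Suc show ?case
        by (simp only: sum.lessThan_Suc) (simp only: gst_add gst_cmult gker_def L2_space_add)
    qed (simp add: L2_space_0)
    define R where "R u z = gker u z - (\<Sum>k<n. indicator (B k) u * (osc_phase u (p k) * gker (p k) z))" for u z
    have Rb: "cmod (R u z) \<le> \<rho> u * gauss_bound (z - u)" for u z
    proof (cases "u \<in> S")
      case True
      then obtain j where j: "j < n" "u \<in> B j" by (auto simp: S_def)
      have "R u z = gker u z - osc_phase u (p j) * gker (p j) z"
        unfolding R_def sel[OF j] using j by simp
      then show ?thesis using osc[OF j(2), of z] True by (simp add: \<rho>_def)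
    next
      case False
      then have "R u z = gker u z" by (auto simp: R_def S_def intro!: sum.neutral)
      moreover have "1 * gauss_bound (z - u) \<le> \<rho> u * gauss_bound (z - u)"
        using False \<theta> by (intro mult_right_mono) (auto simp: \<rho>_def)
      ultimately show ?thesis using norm_gker_le_gauss_bound[of u z] by (simp only: mult_1 order_trans)
    qed
    have gstE: "gst E z = of_real ?c * (LINT u|lborel. ?\<Phi> u * R u z)" for z
    proof -
      have "?\<Phi> u * R u z = ?\<Phi> u * gker u z
          - (\<Sum>k<n. ?\<Phi> u * (indicator (B k) u * osc_phase u (p k)) * gker (p k) z)" for u
        by (simp only: R_def right_diff_distrib sum_distrib_left mult.assoc)
      then have "(LINT u|lborel. ?\<Phi> u * R u z) = (LINT u|lborel. ?\<Phi> u * gker u z)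
          - (\<Sum>k<n. (LINT u|lborel. ?\<Phi> u * (indicator (B k) u * osc_phase u (p k))) * gker (p k) z)"
        using gst_reproducing(1)[OF hL, of z] int\<alpha> by simp
      then have "of_real ?c * (LINT u|lborel. ?\<Phi> u * R u z) = ?\<Phi> z - (\<Sum>k<n. \<alpha> k * gker (p k) z)"
        unfolding gst_reproducing(2)[OF hL] \<alpha>_def
        by (simp add: right_diff_distrib sum_distrib_left mult.assoc)
      moreover have "gst E z = ?\<Phi> z + (\<Sum>k<n. (- \<alpha> k) * gker (p k) z)"
        unfolding E_def using gst_sum[of n z] by (subst gst_add) (use hL in auto)
      ultimately show ?thesis by (simp add: sum_negf)
    qed
    have 1: "ennreal (cmod (f E)) \<le> ennreal (C' * ?c * I) * J"
    proof -
      have "M1_norm v E \<le> ennreal ?c * (J * gauss_mass v)"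
        using M1_norm_superposition[OF _ _ \<rho>0 Rb gstE] unfolding J_def by (simp add: norm_power)
      then have "ennreal (cmod (f E)) \<le> ennreal C' * (ennreal ?c * (J * gauss_mass v))"
        using C'(2)[OF EM] by (meson mult_left_mono order_trans zero_le)
      then show ?thesis using C' I by (simp add: ennreal_mult mult_ac)
    qed
    \<comment> \<open>The error of the same Riemann sum when \<open>f\<close> is applied under the
      integral. The claimed difference is \<open>f E\<close> minus a multiple of the integral of
      \<open>?Y\<close>, and \<open>\<rho>\<close> controls both.\<close>
    let ?Y = "\<lambda>u. stft f u * cnj (?\<Phi> u) - (\<Sum>k<n. cnj (?\<Phi> u * (indicator (B k) u * osc_phase u (p k))) * stft f (p k))"
    have fE: "f E - (f h - synth v (stft f) h) = of_real ?c * (LINT u|lborel. ?Y u)"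
    proof -
      have "f E = f h + f (\<lambda>t. \<Sum>k<n. (- \<alpha> k) * tf_shift (p k) gaussian t)"
        unfolding E_def
        by (intro M1_dual_add[OF v f h] M1_space_sum[OF v] M1_space_cmult[OF v] M1_space_gaussian[OF v]) auto
      also have "f (\<lambda>t. \<Sum>k<n. (- \<alpha> k) * tf_shift (p k) gaussian t) = (\<Sum>k<n. cnj (- \<alpha> k) * stft f (p k))"
        by (intro M1_dual_sum[OF v f] M1_space_gaussian[OF v]) simp
      finally have "f E = f h - (\<Sum>k<n. cnj (\<alpha> k) * stft f (p k))" by (simp add: sum_negf)
      moreover have "(LINT u|lborel. ?Y u) = (LINT u|lborel. stft f u * cnj (?\<Phi> u))
          - (\<Sum>k<n. cnj (LINT u|lborel. ?\<Phi> u * (indicator (B k) u * osc_phase u (p k))) * stft f (p k))"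
        using intF int\<alpha> by (simp add: complex_integrable_cnj del: complex_cnj_mult)
      ultimately show ?thesis
        by (simp add: synth_def h \<alpha>_def right_diff_distrib sum_distrib_left mult.assoc)
    qed
    have Yb: "cmod (?Y u) \<le> C * (cmod (?\<Phi> u) * \<rho> u * v u)" for u
    proof (cases "u \<in> S")
      case True
      then obtain j where j: "j < n" "u \<in> B j" by (auto simp: S_def)
      have "(\<Sum>k<n. cnj (?\<Phi> u * (indicator (B k) u * osc_phase u (p k))) * stft f (p k))
          = (\<Sum>k<n. indicator (B k) u * (cnj (?\<Phi> u) * (cnj (osc_phase u (p k)) * stft f (p k))))"
        by (intro sum.cong) (auto simp: indicator_def)
      also have "\<dots> = cnj (?\<Phi> u) * (cnj (osc_phase u (p j)) * stft f (p j))"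
        using sel[OF j] j by simp
      finally have "?Y u = cnj (?\<Phi> u) * (stft f u - cnj (osc_phase u (p j)) * stft f (p j))"
        by (simp add: right_diff_distrib mult.commute)
      then have "cmod (?Y u) \<le> cmod (?\<Phi> u) * (\<theta> * (C * v u))"
        using C(3)[OF \<theta> osc[OF j(2)]] by (simp only: norm_mult complex_mod_cnj) (intro mult_left_mono, auto)
      then show ?thesis using True by (simp add: \<rho>_def mult_ac)
    next
      case False
      then have "(\<Sum>k<n. cnj (?\<Phi> u * (indicator (B k) u * osc_phase u (p k))) * stft f (p k)) = 0"
        by (auto simp: S_def intro!: sum.neutral)
      then have "cmod (?Y u) = cmod (?\<Phi> u) * cmod (stft f u)" by (simp add: norm_mult mult.commute)
      also have "\<dots> \<le> cmod (?\<Phi> u) * (C * v u)" by (intro mult_left_mono C(2)) simp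
      also have "\<dots> \<le> cmod (?\<Phi> u) * (C * v u) * \<rho> u"
        using mult_left_mono[of 1 "\<rho> u" "cmod (?\<Phi> u) * (C * v u)"] False \<theta> C(1) weight_nonneg[OF v, of u]
        by (simp add: \<rho>_def)
      finally show ?thesis by (simp add: mult_ac)
    qed
    have 2: "ennreal (cmod (of_real ?c * (LINT u|lborel. ?Y u))) \<le> ennreal (?c * C) * J"
    proof -
      have "ennreal (cmod (LINT u|lborel. ?Y u)) \<le> (\<integral>\<^sup>+ u. ennreal (cmod (?Y u)) \<partial>lborel)"
        by (rule norm_integral_le_nn_integral)
      also have "\<dots> \<le> (\<integral>\<^sup>+ u. ennreal C * ennreal (cmod (?\<Phi> u) * \<rho> u * v u) \<partial>lebesgue)"
        unfolding nn_integral_completion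
        using Yb C(1) \<rho>0 weight_nonneg[OF v] by (intro nn_integral_mono) (simp flip: ennreal_mult)
      also have "\<dots> = ennreal C * J"
      proof -
        have [measurable]: "\<rho> \<in> borel_measurable lebesgue" by (auto intro: measurable_completion)
        show ?thesis unfolding J_def by (rule nn_integral_cmult) measurable
      qed
      finally have "ennreal ?c * ennreal (cmod (LINT u|lborel. ?Y u)) \<le> ennreal ?c * (ennreal C * J)"
        by (rule mult_left_mono) simp
      then show ?thesis using C(1) by (simp add: norm_mult norm_power ennreal_mult mult.assoc)
    qed
    have "f h - synth v (stft f) h = f E - of_real ?c * (LINT u|lborel. ?Y u)"
      using fE by (simp add: algebra_simps)
    then have "cmod (f h - synth v (stft f) h) \<le> cmod (f E) + cmod (of_real ?c * (LINT u|lborel. ?Y u))"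
      by (simp only: norm_triangle_ineq4)
    then have "ennreal (cmod (f h - synth v (stft f) h)) \<le> ennreal (cmod (f E)) + ennreal (cmod (of_real ?c * (LINT u|lborel. ?Y u)))"
      by (simp flip: ennreal_plus)
    also have "\<dots> \<le> ennreal (C' * ?c * I) * J + ennreal (?c * C) * J" by (intro add_mono 1 2)
    also have "\<dots> = ennreal (C' * ?c * I + ?c * C) * J"
      using C C' I by (simp add: distrib_right)
    finally show "ennreal (cmod (f h - synth v (stft f) h)) \<le> ennreal (C' * ?c * I + ?c * C)
       * (\<integral>\<^sup>+ u. ennreal (cmod (gst h u) * (\<theta> + indicator (- (\<Union>k<n. B k)) u) * v u) \<partial>lebesgue)"
      by (simp add: J_def \<rho>_def S_def)
  qed
qed

end

text \<open>Balls of radius \<open>\<epsilon>\<close> around a countable dense set, made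
  disjoint.\<close>

lemma ball_partition:
  fixes \<epsilon> :: real
  assumes \<epsilon>: "0 < \<epsilon>"
  obtains B :: "nat \<Rightarrow> 'a::euclidean_space set" and p where
    "disjoint_family B" "\<And>k. B k \<in> sets borel" "(\<Union>k. B k) = UNIV" "\<And>k u. u \<in> B k \<Longrightarrow> norm (p k - u) \<le> \<epsilon>"
proof -
  obtain D :: "'a set" where D: "countable D" "\<And>X. open X \<Longrightarrow> X \<noteq> {} \<Longrightarrow> \<exists>d\<in>D. d \<in> X"
    using countable_dense_setE by blast
  have "D \<noteq> {}" using D(2)[of UNIV] by auto
  define p where "p = from_nat_into D"
  have p: "range p = D" unfolding p_def using D(1) \<open>D \<noteq> {}\<close> by (rule range_from_nat_into[rotated])
  define A where "A = (\<lambda>k. ball (p k) \<epsilon>)"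
  show thesis
  proof (rule that[of "disjointed A" p])
    show "disjoint_family (disjointed A)" by (rule disjoint_family_disjointed)
    show "disjointed A k \<in> sets borel" for k
      unfolding disjointed_def A_def by auto
    show "(\<Union>k. disjointed A k) = UNIV"
    proof -
      have "\<exists>k. x \<in> A k" for x
      proof -
        obtain d where "d \<in> D" "d \<in> ball x \<epsilon>" using D(2)[of "ball x \<epsilon>"] \<epsilon> by force
        then show ?thesis using p unfolding A_def by (metis dist_commute imageE mem_ball)
      qed
      then show ?thesis by (auto simp: UN_disjointed_eq)
    qed
    show "norm (p k - u) \<le> \<epsilon>" if "u \<in> disjointed A k" for k u
      using disjointed_subset[of A k] that by (auto simp: A_def dist_norm)
  qed
qed

context
  fixes v :: "'d::finite tfplane \<Rightarrow> real"
  assumes v: "is_weight v"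
begin

lemmas [measurable] = weight_measurable[OF v]

theorem M1_dual_representation:
  assumes f: "f \<in> M1_dual v"
  shows "synth v (stft f) = f"
proof
  fix h
  show "synth v (stft f) h = f h"
  proof (cases "h \<in> M1_space v")
    case False
    then show ?thesis using M1_dual_outside[OF v f] by (simp add: synth_def)
  next
    case h: True
    have hL: "h \<in> L2_space" using M1_spaceD[OF v h] by simp
    note [measurable] = measurable_gst_lebesgue[OF hL]
    obtain D where D: "0 \<le> D"
      "\<And>\<theta> (B :: nat \<Rightarrow> 'd tfplane set) p n. 0 \<le> \<theta> \<Longrightarrow> disjoint_family B \<Longrightarrow> (\<And>k. B k \<in> sets borel) \<Longrightarrow>
        (\<And>k u z. u \<in> B k \<Longrightarrow> cmod (gker u z - osc_phase u (p k) * gker (p k) z) \<le> \<theta> * gauss_bound (z - u)) \<Longrightarrow>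
        ennreal (cmod (f h - synth v (stft f) h)) \<le>
          ennreal D * (\<integral>\<^sup>+ u. ennreal (cmod (gst h u) * (\<theta> + indicator (- (\<Union>k<n. B k)) u) * v u) \<partial>lebesgue)"
      using M1_dual_partition_bound[OF v f h] by blast
    let ?T = "ennreal (cmod (f h - synth v (stft f) h))"
    obtain J where J: "M1_norm v h = ennreal J" "0 \<le> J"
      using M1_spaceD(2)[OF v h] by (cases "M1_norm v h") auto
    have *: "?T \<le> ennreal (D * \<theta> * J)" if \<theta>: "0 < \<theta>" for \<theta>
    proof -
      obtain \<epsilon> where \<epsilon>: "0 < \<epsilon>" "\<And>u u' z :: 'd tfplane. norm (u' - u) \<le> \<epsilon> \<Longrightarrow>
          cmod (gker u z - osc_phase u u' * gker u' z) \<le> \<theta> * gauss_bound (z - u)"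
        using gker_osc[OF \<theta>] by metis
      obtain B :: "nat \<Rightarrow> 'd tfplane set" and p where B: "disjoint_family B" "\<And>k. B k \<in> sets borel"
        "(\<Union>k. B k) = UNIV" "\<And>k u. u \<in> B k \<Longrightarrow> norm (p k - u) \<le> \<epsilon>"
        using ball_partition[OF \<epsilon>(1)] by blast
      let ?I = "\<lambda>n u. indicator (- (\<Union>k<n. B k)) u :: real"
      have [measurable]: "?I n \<in> borel_measurable lebesgue" for n
      proof (rule borel_measurable_indicator)
        have "(\<Union>k<n. B k) \<in> sets lebesgue"
          using B(2) by (intro sets.finite_UN) (auto intro: sets_completionI_sets)
        from sets.compl_sets[OF this] show "- (\<Union>k<n. B k) \<in> sets lebesgue"
          by (simp only: Compl_eq_Diff_UNIV space_completion space_lborel space_borel)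
      qed
      have bound: "?T \<le> ennreal D * (\<integral>\<^sup>+ u. ennreal (cmod (gst h u) * (\<theta> + ?I n u) * v u) \<partial>lebesgue)" for n
        by (rule D(2)[OF less_imp_le[OF \<theta>] B(1,2) \<epsilon>(2)[OF B(4)]])
      \<comment> \<open>The order of limits matters, since the partition depends on
        \<open>\<theta>\<close>: \<open>n\<close> tends to infinity first, removing the uncovered
        part by dominated convergence, and only then \<open>\<theta>\<close> tends to 0.\<close>
      have "(\<lambda>n. \<integral>\<^sup>+ u. ennreal (cmod (gst h u) * (\<theta> + ?I n u) * v u) \<partial>lebesgue)
          \<longlonglongrightarrow> (\<integral>\<^sup>+ u. ennreal (cmod (gst h u) * (\<theta> + 0) * v u) \<partial>lebesgue)"
      proof (rule nn_integral_dominated_convergence[where w = "\<lambda>u. ennreal (\<theta> + 1) * ennreal (cmod (gst h u) * v u)"])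
        show "AE u in lebesgue. ennreal (cmod (gst h u) * (\<theta> + ?I n u) * v u) \<le> ennreal (\<theta> + 1) * ennreal (cmod (gst h u) * v u)" for n
        proof (rule AE_I2)
          fix u
          have "(\<theta> + ?I n u) * (cmod (gst h u) * v u) \<le> (\<theta> + 1) * (cmod (gst h u) * v u)"
            using weight_nonneg[OF v, of u] by (intro mult_right_mono) (auto simp: indicator_def)
          then have "ennreal (cmod (gst h u) * (\<theta> + ?I n u) * v u) \<le> ennreal ((\<theta> + 1) * (cmod (gst h u) * v u))"
            by (intro ennreal_leI) (simp only: mult_ac)
          also have "\<dots> = ennreal (\<theta> + 1) * ennreal (cmod (gst h u) * v u)"
            using \<theta> weight_nonneg[OF v, of u] by (intro ennreal_mult) auto
          finally show "ennreal (cmod (gst h u) * (\<theta> + ?I n u) * v u) \<le> ennreal (\<theta> + 1) * ennreal (cmod (gst h u) * v u)" .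
        qed
        have "(\<integral>\<^sup>+ u. ennreal (\<theta> + 1) * ennreal (cmod (gst h u) * v u) \<partial>lebesgue) = ennreal (\<theta> + 1) * M1_norm v h"
          unfolding M1_norm_eq by (rule nn_integral_cmult) measurable
        then show "(\<integral>\<^sup>+ u. ennreal (\<theta> + 1) * ennreal (cmod (gst h u) * v u) \<partial>lebesgue) < \<infinity>"
          by (simp add: J ennreal_mult_less_top)
        show "AE u in lebesgue. (\<lambda>n. ennreal (cmod (gst h u) * (\<theta> + ?I n u) * v u))
            \<longlonglongrightarrow> ennreal (cmod (gst h u) * (\<theta> + 0) * v u)"
        proof (rule AE_I2)
          fix u
          obtain k where "u \<in> B k" using B(3) by auto
          then have "?I n u = 0" if "n > k" for n using that by (auto simp: indicator_def)
          then have "\<forall>\<^sub>F n in sequentially. ?I n u = 0"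
            unfolding eventually_sequentially by (intro exI[of _ "Suc k"]) auto
          then have "(\<lambda>n. ?I n u) \<longlonglongrightarrow> 0" by (rule tendsto_eventually)
          then show "(\<lambda>n. ennreal (cmod (gst h u) * (\<theta> + ?I n u) * v u))
            \<longlonglongrightarrow> ennreal (cmod (gst h u) * (\<theta> + 0) * v u)"
            by (intro tendsto_ennrealI tendsto_intros)
        qed
      qed measurable
      then have "(\<lambda>n. ennreal D * (\<integral>\<^sup>+ u. ennreal (cmod (gst h u) * (\<theta> + ?I n u) * v u) \<partial>lebesgue))
          \<longlonglongrightarrow> ennreal D * (\<integral>\<^sup>+ u. ennreal (cmod (gst h u) * (\<theta> + 0) * v u) \<partial>lebesgue)"
        by (intro ennreal_tendsto_cmult) simp_all
      then have "?T \<le> ennreal D * (\<integral>\<^sup>+ u. ennreal (cmod (gst h u) * (\<theta> + 0) * v u) \<partial>lebesgue)"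
        by (rule LIMSEQ_le_const) (use bound in auto)
      also have "(\<integral>\<^sup>+ u. ennreal (cmod (gst h u) * (\<theta> + 0) * v u) \<partial>lebesgue)
          = (\<integral>\<^sup>+ u. ennreal \<theta> * ennreal (cmod (gst h u) * v u) \<partial>lebesgue)"
        using \<theta> weight_nonneg[OF v] by (intro nn_integral_cong) (simp add: mult_ac flip: ennreal_mult)
      also have "\<dots> = ennreal \<theta> * M1_norm v h"
        unfolding M1_norm_eq by (rule nn_integral_cmult) measurable
      finally show ?thesis using D(1) \<theta> J by (simp add: mult.assoc flip: ennreal_mult)
    qed
    have "cmod (f h - synth v (stft f) h) \<le> 0 + e" if e: "0 < e" for e
    proof -
      define \<theta> where "\<theta> = e / (D * J + 1)"
      have DJ: "0 \<le> D * J" using D(1) J(2) by simp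
      have \<theta>: "0 < \<theta>" using e DJ by (simp add: \<theta>_def)
      have "cmod (f h - synth v (stft f) h) \<le> D * \<theta> * J"
        using *[OF \<theta>] D(1) \<theta> J(2) by (simp add: ennreal_le_iff)
      also have "\<dots> = \<theta> * (D * J)" by simp
      also have "\<dots> \<le> \<theta> * (D * J + 1)" using \<theta> by (intro mult_left_mono) auto
      also have "\<dots> = e" using DJ by (simp add: \<theta>_def)
      finally show ?thesis by simp
    qed
    then have "cmod (f h - synth v (stft f) h) \<le> 0" by (rule field_le_epsilon)
    then show ?thesis by simp
  qed
qed

lemma M1_dual_eq_integral:
  assumes f: "f \<in> M1_dual v" and h: "h \<in> M1_space v"
  shows "f h = of_real (sqrt 2 ^ CARD('d)) * (LINT u|lborel. stft f u * cnj (gst h u))"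
  using fun_cong[OF M1_dual_representation[OF f], of h] h by (simp add: synth_def)

lemma stft_reproducing:
  assumes f: "f \<in> M1_dual v"
  shows "stft f z = of_real (sqrt 2 ^ CARD('d)) * (LINT u|lborel. stft f u * gker u z)"
  using M1_dual_eq_integral[OF f M1_space_gaussian[OF v], of z] by (simp add: gker_cnj flip: gker_def)

subsection \<open>Change of window\<close>

lemma STFT_eq_integral:
  assumes f: "f \<in> M1_dual v" and w: "w \<in> M1_space v"
  shows "STFT w f z = of_real (sqrt 2 ^ CARD('d)) *
    (LINT u|lborel. stft f u * cnj (phase ((snd z - snd u) \<bullet> fst z) * gst w (u - z)))"
  unfolding STFT_def M1_dual_eq_integral[OF f M1_space_tf_shift[OF v w]]
  by (simp add: gst_tf_shift M1_spaceD[OF v w])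

lemma measurable_phase_pair [measurable]:
  "(\<lambda>(z, u). phase ((snd z - snd u) \<bullet> fst z)) \<in> borel_measurable (borel \<Otimes>\<^sub>M (borel :: 'd tfplane measure))"
  unfolding borel_prod split_beta' by (intro borel_measurable_continuous_onI continuous_intros)

lemma measurable_STFT:
  assumes f: "f \<in> M1_dual v" and w: "w \<in> M1_space v"
  shows "STFT w f \<in> borel_measurable borel"
proof -
  note [measurable] = measurable_stft[OF v f] measurable_gst[OF M1_spaceD(1)[OF v w]]
  show ?thesis unfolding STFT_eq_integral[OF f w, abs_def] by measurable
qed

lemma STFT_le_convolution:
  assumes f: "f \<in> M1_dual v" and w: "w \<in> M1_space v"
  shows "ennreal (cmod (STFT w f z))
    \<le> ennreal (sqrt 2 ^ CARD('d)) * (\<integral>\<^sup>+ u. ennreal (cmod (stft f u) * cmod (gst w (u - z))) \<partial>lborel)"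
proof -
  have "ennreal (cmod (STFT w f z)) = ennreal (sqrt 2 ^ CARD('d)) *
    ennreal (cmod (LINT u|lborel. stft f u * cnj (phase ((snd z - snd u) \<bullet> fst z) * gst w (u - z))))"
    unfolding STFT_eq_integral[OF f w] by (simp add: norm_mult norm_power ennreal_mult)
  also have "\<dots> \<le> ennreal (sqrt 2 ^ CARD('d)) *
    (\<integral>\<^sup>+ u. ennreal (cmod (stft f u * cnj (phase ((snd z - snd u) \<bullet> fst z) * gst w (u - z)))) \<partial>lborel)"
    by (intro mult_left_mono norm_integral_le_nn_integral) simp
  finally show ?thesis by (simp add: norm_mult)
qed

text \<open>After the substitution \<open>u = y - s\<close> in the inversion formula for a general
  window, covariance brings the integrand into the form required by \<open>gst_moyal\<close>; what
  has to be checked is that the phases agree.\<close>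

lemma gst_gker_covariance:
  assumes w: "w \<in> L2_space"
  shows "gst (tf_shift (y - s) w) y * cnj (L2_inner (tf_shift (y - s) (tf_shift r gaussian)) (tf_shift z gaussian))
    = phase ((snd z - snd y) \<bullet> fst y) *
      (gst w s * L2_inner (tf_shift s (tf_shift (z - y) gaussian)) (tf_shift r gaussian))"
proof -
  have n: "norm (y - s + r - z) = norm (s + (z - y) - r)"
    by (metis (no_types, opaque_lifting) add_diff_eq diff_add_eq diff_diff_eq2 minus_diff_eq norm_minus_cancel add.commute)
  define s1 s2 y1 y2 r1 r2 z1 z2 where
    defs: "s1 = fst s" "s2 = snd s" "y1 = fst y" "y2 = snd y" "r1 = fst r" "r2 = snd r" "z1 = fst z" "z2 = snd z"
  have ph: "phase ((y2 - s2 - y2) \<bullet> (y1 - s1)) * cnj (phase (- (r2 \<bullet> (y1 - s1)))) *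
      cnj (phase ((y2 - s2 + r2 - z2) \<bullet> ((1/2) *\<^sub>R (y1 - s1 + r1 + z1))))
    = phase ((z2 - y2) \<bullet> y1) * (phase (- ((z2 - y2) \<bullet> s1)) *
       phase ((s2 + (z2 - y2) - r2) \<bullet> ((1/2) *\<^sub>R (s1 + (z1 - y1) + r1))))"
    unfolding phase_cnj phase_add[symmetric]
    by (rule arg_cong[of _ _ phase])
      (simp add: inner_diff_left inner_diff_right inner_add_left inner_add_right, simp add: field_simps)
  show ?thesis
    unfolding gker_shift gst_tf_shift[OF w] gker_eq n using ph
    by (simp add: defs mult_ac)
qed

text \<open>Inversion with analysis window \<open>w\<close> and synthesis window
  \<open>\<pi>(r)\<phi>\<close>, carried from vectors to functionals by inserting the integral
  representation of \<open>f\<close>. For \<open>r\<close> with \<open>gst w r \<noteq> 0\<close> it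
  recovers \<open>stft f\<close> from \<open>STFT w f\<close>.\<close>

lemma stft_window_inversion:
  assumes f: "f \<in> M1_dual v" and w: "w \<in> M1_space v"
  shows "cnj (gst w r) * stft f z
    = (LINT u|lborel. STFT w f u * L2_inner (tf_shift u (tf_shift r gaussian)) (tf_shift z gaussian))"
proof -
  let ?c = "complex_of_real (sqrt 2 ^ CARD('d))"
  have wL: "w \<in> L2_space" using M1_spaceD[OF v w] by simp
  note [measurable] = measurable_stft[OF v f] measurable_gst[OF wL]
  define K where "K u = L2_inner (tf_shift u (tf_shift r gaussian)) (tf_shift z gaussian)" for u
  have K_eq: "K u = phase (- (snd r \<bullet> fst u)) * gker (u + r) z" for u by (simp add: K_def gker_shift)
  have [measurable]: "(\<lambda>u. phase (- (snd r \<bullet> fst (u :: 'd tfplane)))) \<in> borel_measurable borel"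
    by (intro borel_measurable_continuous_onI continuous_intros)
  have [measurable]: "(\<lambda>u. gker (u + r) z) \<in> borel_measurable borel" by measurable
  have [measurable]: "K \<in> borel_measurable borel" unfolding K_eq[abs_def] by measurable
  have g_eq: "gst (tf_shift u w) y = phase ((snd u - snd y) \<bullet> fst u) * gst w (y - u)" for u y
    by (rule gst_tf_shift[OF wL])
  have g_meas[measurable]: "(\<lambda>(u, y). gst (tf_shift u w) y) \<in> borel_measurable (borel \<Otimes>\<^sub>M borel)"
    unfolding g_eq by measurable
  obtain C where C: "0 \<le> C" "\<And>u. cmod (stft f u) \<le> C * v u"
    using stft_bound[OF v f] by metis
  let ?f = "\<lambda>(u, y). K u * (stft f y * cnj (gst (tf_shift u w) y))"
  have fm: "?f \<in> borel_measurable (lborel \<Otimes>\<^sub>M lborel)" by measurable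
  have "integrable (lborel \<Otimes>\<^sub>M lborel) ?f"
    unfolding integrable_iff_bounded
  proof (intro conjI fm)
    have "(\<integral>\<^sup>+ x. ennreal (norm (?f x)) \<partial>(lborel \<Otimes>\<^sub>M lborel))
        = (\<integral>\<^sup>+ u. \<integral>\<^sup>+ y. ennreal (norm (?f (u, y))) \<partial>lborel \<partial>lborel)"
      by (rule lborel.nn_integral_fst[symmetric]) (use fm in measurable)
    \<comment> \<open>Absolute integrability: shifting \<open>w\<close> by \<open>u\<close> costs a
      factor \<open>v u\<close> in the norm, which the Gaussian in \<open>u\<close> absorbs.\<close>
    also have "\<dots> \<le> (\<integral>\<^sup>+ u. (ennreal C * M1_norm v w) * ennreal (gauss_bound (u - (z - r)) * v u) \<partial>lborel)"
    proof (rule nn_integral_mono)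
      fix u
      have [measurable]: "(\<lambda>y. gst (tf_shift u w) y) \<in> borel_measurable borel" by measurable
      have "(\<integral>\<^sup>+ y. ennreal (norm (?f (u, y))) \<partial>lborel)
          = ennreal (cmod (K u)) * (\<integral>\<^sup>+ y. ennreal (cmod (stft f y * cnj (gst (tf_shift u w) y))) \<partial>lborel)"
        by (subst nn_integral_cmult[symmetric]) (auto simp: norm_mult ennreal_mult)
      also have "\<dots> \<le> ennreal (gauss_bound (u - (z - r))) * (ennreal C * (ennreal (v u) * M1_norm v w))"
      proof (intro mult_mono)
        have "cmod (K u) = cmod (gker (u + r) z)" by (simp add: K_eq norm_mult)
        also have "\<dots> \<le> gauss_bound (z - (u + r))" by (rule norm_gker_le_gauss_bound)
        also have "norm (z - (u + r)) = norm (u - (z - r))"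
          using norm_minus_commute[of "z - r" u] by (simp add: algebra_simps)
        finally show "ennreal (cmod (K u)) \<le> ennreal (gauss_bound (u - (z - r)))" by (rule ennreal_leI)
        have "(\<integral>\<^sup>+ y. ennreal (cmod (stft f y * cnj (gst (tf_shift u w) y))) \<partial>lborel)
            \<le> (\<integral>\<^sup>+ y. ennreal C * ennreal (cmod (gst (tf_shift u w) y) * v y) \<partial>lebesgue)"
          unfolding nn_integral_completion
        proof (rule nn_integral_mono)
          fix y
          show "ennreal (cmod (stft f y * cnj (gst (tf_shift u w) y))) \<le> ennreal C * ennreal (cmod (gst (tf_shift u w) y) * v y)"
            using mult_right_mono[OF C(2)[of y] norm_ge_zero[of "gst (tf_shift u w) y"]] C weight_nonneg[OF v, of y]
            by (simp add: norm_mult mult_ac flip: ennreal_mult)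
        qed
        also have "\<dots> = ennreal C * M1_norm v (tf_shift u w)"
        proof -
          have [measurable]: "gst (tf_shift u w) \<in> borel_measurable lebesgue"
            by (intro measurable_gst_lebesgue L2_space_tf_shift wL)
          show ?thesis unfolding M1_norm_eq by (rule nn_integral_cmult) measurable
        qed
        also have "\<dots> \<le> ennreal C * (ennreal (v u) * M1_norm v w)"
          by (intro mult_left_mono M1_norm_tf_shift[OF v] wL) simp
        finally show "(\<integral>\<^sup>+ y. ennreal (cmod (stft f y * cnj (gst (tf_shift u w) y))) \<partial>lborel)
          \<le> ennreal C * (ennreal (v u) * M1_norm v w)" .
      qed simp_all
      also have "\<dots> = (ennreal C * M1_norm v w) * ennreal (gauss_bound (u - (z - r)) * v u)"
        using weight_nonneg[OF v, of u] by (simp add: ennreal_mult mult_ac)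
      finally show "(\<integral>\<^sup>+ y. ennreal (norm (?f (u, y))) \<partial>lborel)
        \<le> (ennreal C * M1_norm v w) * ennreal (gauss_bound (u - (z - r)) * v u)" .
    qed
    also have "\<dots> = (ennreal C * M1_norm v w) * (\<integral>\<^sup>+ u. ennreal (gauss_bound (u - (z - r)) * v u) \<partial>lebesgue)"
    proof -
      have [measurable]: "(\<lambda>u. gauss_bound (u - (z - r))) \<in> borel_measurable lebesgue"
        by (intro measurable_completion) measurable
      show ?thesis
        by (subst nn_integral_completion[symmetric], rule nn_integral_cmult) measurable
    qed
    also have "\<dots> \<le> (ennreal C * M1_norm v w) * (ennreal (v (z - r)) * gauss_mass v)"
      by (intro mult_left_mono nn_integral_gauss_bound_shift[OF v]) simp
    also have "\<dots> < \<infinity>"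
      using M1_spaceD(2)[OF v w] gauss_mass_finite[OF v] by (simp add: ennreal_mult_less_top)
    finally show "(\<integral>\<^sup>+ x. ennreal (norm (?f x)) \<partial>(lborel \<Otimes>\<^sub>M lborel)) < \<infinity>" .
  qed
  from lborel_pair.Fubini_integral[OF this]
  have swap: "(LINT u|lborel. LINT y|lborel. K u * (stft f y * cnj (gst (tf_shift u w) y)))
     = (LINT y|lborel. LINT u|lborel. K u * (stft f y * cnj (gst (tf_shift u w) y)))" by simp
  \<comment> \<open>With \<open>u\<close> integrated first, Moyal's relation for \<open>w\<close>
    leaves the kernel of the reproducing formula for \<open>f\<close>.\<close>
  have inner: "(LINT u|lborel. gst (tf_shift u w) y * cnj (K u)) = gst w r * gker z y" for y
  proof -
    have gy: "(\<lambda>u. gst (tf_shift u w) y) \<in> borel_measurable borel" by measurable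
    have "(LINT u|lborel. gst (tf_shift u w) y * cnj (K u))
        = (LINT s|lborel. gst (tf_shift (y - s) w) y * cnj (K (y - s)))"
      by (rule integral_lborel_reflect[symmetric]) (use gy in measurable)
    also have "\<dots> = phase ((snd z - snd y) \<bullet> fst y) *
        (LINT s|lborel. gst w s * L2_inner (tf_shift s (tf_shift (z - y) gaussian)) (tf_shift r gaussian))"
      unfolding K_def gst_gker_covariance[OF wL] by (rule integral_mult_right_zero)
    also have "\<dots> = gst w r * (phase ((snd z - snd y) \<bullet> fst y) * gker (z - y) 0)"
      unfolding gst_moyal[OF wL] by (simp only: mult_ac)
    also have "phase ((snd z - snd y) \<bullet> fst y) * gker (z - y) 0 = gker z y"
    proof -
      have "phase ((snd z - snd y) \<bullet> fst y) * phase ((snd z - snd y) \<bullet> ((1/2) *\<^sub>R (fst z - fst y)))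
        = phase ((snd z - snd y) \<bullet> ((1/2) *\<^sub>R (fst z + fst y)))"
        unfolding phase_add[symmetric] inner_add_right[symmetric]
        by (rule arg_cong[of _ _ "\<lambda>x. phase ((snd z - snd y) \<bullet> x)"])
          (simp add: vec_eq_iff field_simps)
      then show ?thesis by (simp add: gker_eq mult_ac)
    qed
    finally show ?thesis .
  qed
  have "(LINT u|lborel. STFT w f u * K u)
      = ?c * (LINT u|lborel. LINT y|lborel. K u * (stft f y * cnj (gst (tf_shift u w) y)))"
  proof -
    have "STFT w f u * K u = ?c * (LINT y|lborel. K u * (stft f y * cnj (gst (tf_shift u w) y)))" for u
      unfolding STFT_def M1_dual_eq_integral[OF f M1_space_tf_shift[OF v w]] integral_mult_right_zero
      by (simp only: mult_ac)
    then show ?thesis by (simp only: integral_mult_right_zero)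
  qed
  also have "\<dots> = ?c * (LINT y|lborel. stft f y * cnj (LINT u|lborel. gst (tf_shift u w) y * cnj (K u)))"
  proof -
    have "(LINT u|lborel. K u * (stft f y * cnj (gst (tf_shift u w) y)))
      = stft f y * (LINT u|lborel. cnj (gst (tf_shift u w) y * cnj (K u)))" for y
      by (subst integral_mult_right_zero[symmetric]) (simp add: mult_ac)
    then show ?thesis unfolding swap by (simp only: Bochner_Integration.integral_cnj)
  qed
  also have "\<dots> = ?c * (LINT y|lborel. cnj (gst w r) * (stft f y * gker y z))"
    unfolding inner by (simp add: gker_cnj mult_ac)
  also have "\<dots> = cnj (gst w r) * (?c * (LINT y|lborel. stft f y * gker y z))"
    by simp
  also have "\<dots> = cnj (gst w r) * stft f z"
    by (simp only: stft_reproducing[OF f, of z])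
  finally show ?thesis by (simp add: K_def)
qed

lemma stft_le_convolution:
  assumes f: "f \<in> M1_dual v" and w: "w \<in> M1_space v"
  shows "ennreal (cmod (gst w r)) * ennreal (cmod (stft f z))
    \<le> (\<integral>\<^sup>+ u. ennreal (cmod (STFT w f u) * gauss_bound (z - u - r)) \<partial>lborel)"
proof -
  have "ennreal (cmod (gst w r)) * ennreal (cmod (stft f z)) = ennreal (cmod (cnj (gst w r) * stft f z))"
    by (simp add: norm_mult ennreal_mult)
  also have "\<dots> \<le> (\<integral>\<^sup>+ u. ennreal (cmod (STFT w f u * L2_inner (tf_shift u (tf_shift r gaussian)) (tf_shift z gaussian))) \<partial>lborel)"
    unfolding stft_window_inversion[OF f w] by (rule norm_integral_le_nn_integral)
  also have "\<dots> \<le> (\<integral>\<^sup>+ u. ennreal (cmod (STFT w f u) * gauss_bound (z - u - r)) \<partial>lborel)"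
  proof (intro nn_integral_mono ennreal_leI)
    fix u
    show "cmod (STFT w f u * L2_inner (tf_shift u (tf_shift r gaussian)) (tf_shift z gaussian))
      \<le> cmod (STFT w f u) * gauss_bound (z - u - r)"
      using mult_left_mono[OF norm_gker_le_gauss_bound[of "u + r" z], of "cmod (STFT w f u)"]
      by (simp add: gker_shift norm_mult diff_diff_eq)
  qed
  finally show ?thesis .
qed

end

subsection \<open>Weighted mixed norms with a regular weight\<close>

text \<open>The class of weights to which \<open>moderate_weight_regularise\<close> reduces. The
  constant 1 and the fixed rate \<open>a\<close> make the bounds for convolution with Gaussian
  kernels depend on \<open>a\<close> alone.\<close>

definition regular_weight :: "real \<Rightarrow> ('d::finite tfplane \<Rightarrow> real) \<Rightarrow> bool" where
  "regular_weight a \<mu> \<longleftrightarrow> continuous_on UNIV \<mu> \<and> (\<forall>z. 0 < \<mu> z) \<and>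
    (\<forall>z u. \<mu> (z + u) \<le> exp (a * norm u) * \<mu> z)"

definition wnorm :: "('d::finite tfplane \<Rightarrow> real) \<Rightarrow> ennreal \<Rightarrow> ennreal \<Rightarrow> ('d tfplane \<Rightarrow> ennreal) \<Rightarrow> ennreal" where
  "wnorm \<mu> p q A = mnorm p q (\<lambda>z. A z * ennreal (\<mu> z))"

lemma regular_weight_measurable: "regular_weight a \<mu> \<Longrightarrow> \<mu> \<in> borel_measurable borel"
  unfolding regular_weight_def by (blast intro: borel_measurable_continuous_onI)

lemma regular_weight_pos: "regular_weight a \<mu> \<Longrightarrow> 0 < \<mu> z"
  unfolding regular_weight_def by blast

lemma regular_weight_le: "regular_weight a \<mu> \<Longrightarrow> \<mu> z \<le> exp (a * norm (z - u)) * \<mu> u"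
  unfolding regular_weight_def by (metis add_diff_cancel_left' add_diff_eq)

text \<open>The transform of every functional in the dual is bounded with respect to this weight if
  \<open>a\<close> is the growth rate of \<open>v\<close>; so sampling can be inverted for the whole
  dual, whatever \<open>m\<close> is.\<close>

lemma regular_weight_exp: "0 \<le> a \<Longrightarrow> regular_weight a (\<lambda>z. exp (- (a * norm z)))"
proof -
  assume a: "0 \<le> a"
  have "- (a * norm (z + u)) \<le> a * norm u - a * norm z" for z u :: "'a tfplane"
    using mult_left_mono[OF norm_triangle_ineq4[of "z + u" u] a] by (simp add: algebra_simps)
  then show ?thesis
    unfolding regular_weight_def by (auto intro!: continuous_intros simp flip: exp_add)
qed

context
  fixes a :: real and \<mu> :: "'d::finite tfplane \<Rightarrow> real" and p q :: ennreal
  assumes reg: "regular_weight a \<mu>" and p: "1 \<le> p" and q: "1 \<le> q"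
begin

lemmas [measurable] = regular_weight_measurable[OF reg]

lemma wnorm_mono_AE:
  assumes [measurable]: "A \<in> borel_measurable borel" "B \<in> borel_measurable borel"
    and "AE z in lborel. A z \<le> B z"
  shows "wnorm \<mu> p q A \<le> wnorm \<mu> p q B"
  unfolding wnorm_def using assms(3)
  by (intro mnorm_mono_AE p q) (measurable, auto elim!: eventually_mono intro: mult_right_mono)

lemma wnorm_cmult:
  assumes [measurable]: "A \<in> borel_measurable borel" and "c \<noteq> \<top>"
  shows "wnorm \<mu> p q (\<lambda>z. c * A z) = c * wnorm \<mu> p q A"
  unfolding wnorm_def mult.assoc by (rule mnorm_cmult[OF p q]) (use assms(2) in measurable)

lemma wnorm_sum_le:
  assumes "finite I" and [measurable]: "\<And>i. i \<in> I \<Longrightarrow> f i \<in> borel_measurable borel"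
  shows "wnorm \<mu> p q (\<lambda>z. \<Sum>i\<in>I. f i z) \<le> (\<Sum>i\<in>I. wnorm \<mu> p q (f i))"
  unfolding wnorm_def sum_distrib_right by (rule mnorm_sum[OF p q assms(1)]) measurable

lemma wnorm_suminf_le:
  assumes [measurable]: "\<And>n::nat. f n \<in> borel_measurable borel"
  shows "wnorm \<mu> p q (\<lambda>z. \<Sum>n. f n z) \<le> (\<Sum>n. wnorm \<mu> p q (f n))"
  unfolding wnorm_def ennreal_suminf_multc[symmetric] by (rule mnorm_suminf[OF p q]) measurable

text \<open>Here \<open>k\<close> is the kernel of the convolution and \<open>\<kappa>\<close> is
  \<open>k\<close> times a majorant of the quotient \<open>\<mu> z / \<mu> u\<close>. Up to a
  constant the majorant is \<open>v\<close> for a general window, and it is the exponential for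
  Gaussian kernels.\<close>

lemma wnorm_convolution:
  assumes [measurable]: "A \<in> borel_measurable borel" "B \<in> borel_measurable borel"
      "k \<in> borel_measurable borel" "\<kappa> \<in> borel_measurable borel"
    and le: "AE z in lborel. A z \<le> (\<integral>\<^sup>+ u. B u * k (z - u) \<partial>lborel)"
    and k: "\<And>z. AE u in lborel. ennreal (\<mu> z) * k (z - u) \<le> ennreal (\<mu> u) * \<kappa> (z - u)"
  shows "wnorm \<mu> p q A \<le> (\<integral>\<^sup>+ u. \<kappa> u \<partial>lborel) * wnorm \<mu> p q B"
  unfolding wnorm_def
proof (rule mnorm_young[OF p q])
  show "AE z in lborel. A z * ennreal (\<mu> z) \<le> (\<integral>\<^sup>+ u. B u * ennreal (\<mu> u) * \<kappa> (z - u) \<partial>lborel)"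
    using le
  proof eventually_elim
    case (elim z)
    have "A z * ennreal (\<mu> z) \<le> (\<integral>\<^sup>+ u. B u * k (z - u) \<partial>lborel) * ennreal (\<mu> z)"
      using elim by (rule mult_right_mono) simp
    also have "\<dots> = (\<integral>\<^sup>+ u. B u * (ennreal (\<mu> z) * k (z - u)) \<partial>lborel)"
      by (subst nn_integral_multc[symmetric]) (auto simp: mult_ac)
    also have "\<dots> \<le> (\<integral>\<^sup>+ u. B u * (ennreal (\<mu> u) * \<kappa> (z - u)) \<partial>lborel)"
      using k[of z] by (intro nn_integral_mono_AE) (auto elim!: eventually_mono intro: mult_left_mono)
    finally show ?case by (simp add: mult.assoc)
  qed
qed measurable

lemma wnorm_convolution_exp:
  assumes [measurable]: "A \<in> borel_measurable borel" "B \<in> borel_measurable borel" "k \<in> borel_measurable borel"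
    and le: "AE z in lborel. A z \<le> (\<integral>\<^sup>+ u. B u * k (z - u) \<partial>lborel)"
  shows "wnorm \<mu> p q A \<le> (\<integral>\<^sup>+ u. ennreal (exp (a * norm u)) * k u \<partial>lborel) * wnorm \<mu> p q B"
proof (rule wnorm_convolution[OF _ _ _ _ le])
  fix z
  show "AE u in lborel. ennreal (\<mu> z) * k (z - u) \<le> ennreal (\<mu> u) * (ennreal (exp (a * norm (z - u))) * k (z - u))"
  proof (rule AE_I2)
    fix u
    have "ennreal (\<mu> z) \<le> ennreal (\<mu> u) * ennreal (exp (a * norm (z - u)))"
      using regular_weight_le[OF reg, of z u] regular_weight_pos[OF reg, of u]
      by (simp add: mult.commute flip: ennreal_mult)
    from mult_right_mono[OF this, of "k (z - u)"]
    show "ennreal (\<mu> z) * k (z - u) \<le> ennreal (\<mu> u) * (ennreal (exp (a * norm (z - u))) * k (z - u))"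
      by (simp add: mult.assoc)
  qed
qed measurable

lemma wnorm_translate_le:
  assumes [measurable]: "A \<in> borel_measurable borel"
  shows "wnorm \<mu> p q (\<lambda>z. A (z + s)) \<le> ennreal (exp (a * norm s)) * wnorm \<mu> p q A"
proof -
  have "wnorm \<mu> p q (\<lambda>z. A (z + s)) \<le> mnorm p q (\<lambda>z. ennreal (exp (a * norm s)) * (A (z + s) * ennreal (\<mu> (z + s))))"
    unfolding wnorm_def
  proof (rule mnorm_mono[OF p q])
    fix z
    have "ennreal (\<mu> z) \<le> ennreal (exp (a * norm s)) * ennreal (\<mu> (z + s))"
      using regular_weight_le[OF reg, of z "z + s"] regular_weight_pos[OF reg, of "z + s"]
      by (simp flip: ennreal_mult)
    from mult_left_mono[OF this, of "A (z + s)"]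
    show "A (z + s) * ennreal (\<mu> z) \<le> ennreal (exp (a * norm s)) * (A (z + s) * ennreal (\<mu> (z + s)))"
      by (simp add: mult_ac)
  qed measurable
  also have "\<dots> = ennreal (exp (a * norm s)) * mnorm p q (\<lambda>z. A (z + s) * ennreal (\<mu> (z + s)))"
    by (rule mnorm_cmult[OF p q]) measurable
  also have "mnorm p q (\<lambda>z. A (z + s) * ennreal (\<mu> (z + s))) = wnorm \<mu> p q A"
    unfolding wnorm_def by (rule mnorm_translate[OF p q, of "\<lambda>z. A z * ennreal (\<mu> z)"]) measurable
  finally show ?thesis .
qed

text \<open>Exchanges the Lebesgue measurable \<open>m\<close> for the continuous
  \<open>\<mu>\<close> and \<open>F\<close> for a Borel representative, losing only the factor
  \<open>c\<close>.\<close>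

lemma mixed_norm_equiv:
  assumes m: "m \<in> borel_measurable lebesgue" and mpos: "\<And>z. 0 < m z"
    and c: "0 < c" "\<And>z. m z \<le> c * \<mu> z" "\<And>z. \<mu> z \<le> c * m z"
    and A[measurable]: "A \<in> borel_measurable borel" and ae: "AE z in lborel. F z = A z"
  shows "mixed_norm p q m F \<le> ennreal c * wnorm \<mu> p q A"
    and "wnorm \<mu> p q A \<le> ennreal c * mixed_norm p q m F"
proof -
  obtain b where b: "b \<in> borel_measurable lborel" and mb: "AE z in lborel. ennreal (m z) = b z"
    using completion_ex_borel_measurable[of "\<lambda>z. ennreal (m z)" lborel] m by auto
  have [measurable]: "b \<in> borel_measurable borel" using b by simp
  have eq: "mixed_norm p q m F = mnorm p q (\<lambda>z. A z * b z)"
    by (rule mixed_norm_eq_mnorm[OF _ p]) (measurable, use ae mb in eventually_elim, simp)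
  have "mnorm p q (\<lambda>z. A z * b z) \<le> mnorm p q (\<lambda>z. ennreal c * (A z * ennreal (\<mu> z)))"
  proof (rule mnorm_mono_AE[OF p q])
    show "AE z in lborel. A z * b z \<le> ennreal c * (A z * ennreal (\<mu> z))"
      using mb
    proof eventually_elim
      case (elim z)
      have "ennreal (m z) \<le> ennreal c * ennreal (\<mu> z)"
        using c(2)[of z] c(1) regular_weight_pos[OF reg, of z] by (simp flip: ennreal_mult)
      from mult_left_mono[OF this, of "A z"] show ?case by (simp add: elim mult_ac)
    qed
  qed measurable
  also have "\<dots> = ennreal c * wnorm \<mu> p q A"
    unfolding wnorm_def by (rule mnorm_cmult[OF p q]) measurable
  finally show "mixed_norm p q m F \<le> ennreal c * wnorm \<mu> p q A" unfolding eq .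
  have "wnorm \<mu> p q A \<le> mnorm p q (\<lambda>z. ennreal c * (A z * b z))"
    unfolding wnorm_def
  proof (rule mnorm_mono_AE[OF p q])
    show "AE z in lborel. A z * ennreal (\<mu> z) \<le> ennreal c * (A z * b z)"
      using mb
    proof eventually_elim
      case (elim z)
      have "ennreal (\<mu> z) \<le> ennreal c * ennreal (m z)"
        using c(3)[of z] c(1) mpos[of z] by (simp flip: ennreal_mult)
      from mult_left_mono[OF this, of "A z"] show ?case by (simp add: elim mult_ac)
    qed
  qed measurable
  also have "\<dots> = ennreal c * mnorm p q (\<lambda>z. A z * b z)"
    by (rule mnorm_cmult[OF p q]) measurable
  finally show "wnorm \<mu> p q A \<le> ennreal c * mixed_norm p q m F" unfolding eq .
qed

text \<open>The directions rest on different kinds of moderateness. The transform of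
  \<open>w\<close> is known to be integrable against \<open>v\<close> only, so the first uses
  \<open>v\<close>-moderateness of \<open>\<mu>\<close>; the kernel of the inversion formula is
  Gaussian, so the second can afford the exponential.\<close>

lemma wnorm_window_equiv:
  assumes v: "is_weight v" and mod: "\<And>z u. \<mu> (z + u) \<le> c * v z * \<mu> u" and c: "0 < c"
    and w: "is_window v w"
  obtains k1 k2 where "k1 < \<top>" "k2 < \<top>"
    "\<And>f. f \<in> M1_dual v \<Longrightarrow> wnorm \<mu> p q (\<lambda>z. ennreal (cmod (STFT w f z))) \<le> k1 * wnorm \<mu> p q (\<lambda>z. ennreal (cmod (stft f z)))"
    "\<And>f. f \<in> M1_dual v \<Longrightarrow> wnorm \<mu> p q (\<lambda>z. ennreal (cmod (stft f z))) \<le> k2 * wnorm \<mu> p q (\<lambda>z. ennreal (cmod (STFT w f z)))"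
proof -
  have wM: "w \<in> M1_space v" and wn: "\<not> (AE t in lebesgue. w t = 0)"
    using w by (auto simp: is_window_def)
  have wL: "w \<in> L2_space" using M1_spaceD[OF v wM] by simp
  obtain r where r: "gst w r \<noteq> 0" using gst_injective[OF wL] wn by blast
  note [measurable] = measurable_gst[OF wL] measurable_gst_lebesgue[OF wL] weight_measurable[OF v]
  obtain b where b: "b \<in> borel_measurable lborel" and vb: "AE z in lborel. ennreal (v z) = b z"
    using completion_ex_borel_measurable[of "\<lambda>z. ennreal (v z)" lborel] by auto
  have [measurable]: "b \<in> borel_measurable borel" using b by simp
  let ?d = "sqrt 2 ^ CARD('d)"
  define \<kappa> where "\<kappa> y = ennreal (?d * c) * (ennreal (cmod (gst w (- y))) * b y)" for y
  have [measurable]: "\<kappa> \<in> borel_measurable borel" unfolding \<kappa>_def by measurable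
  define k1 where "k1 = (\<integral>\<^sup>+ y. \<kappa> y \<partial>lborel)"
  have k1: "k1 < \<top>"
  proof -
    have "k1 = ennreal (?d * c) * (\<integral>\<^sup>+ y. ennreal (cmod (gst w (- y))) * b y \<partial>lborel)"
      unfolding k1_def \<kappa>_def by (rule nn_integral_cmult) measurable
    also have "(\<integral>\<^sup>+ y. ennreal (cmod (gst w (- y))) * b y \<partial>lborel) = (\<integral>\<^sup>+ y. ennreal (cmod (gst w (0 - (0 - y)))) * b (0 - y) \<partial>lborel)"
      using nn_integral_lborel_reflect[of "\<lambda>y. ennreal (cmod (gst w (- y))) * b y" 0] by simp
    also have "\<dots> = (\<integral>\<^sup>+ y. ennreal (cmod (gst w y) * v y) \<partial>lborel)"
      using AE_lborel_reflect[OF vb, of 0]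
      by (intro nn_integral_cong_AE) (auto elim!: eventually_mono simp: weight_minus[OF v] weight_nonneg[OF v] ennreal_mult)
    also have "\<dots> = M1_norm v w" by (simp add: M1_norm_eq nn_integral_completion)
    finally show ?thesis using M1_spaceD(2)[OF v wM] by (simp add: ennreal_mult_less_top)
  qed
  define k2 where "k2 = ennreal (1 / cmod (gst w r)) * (\<integral>\<^sup>+ u. ennreal (exp (a * norm (u :: 'd tfplane))) * ennreal (gauss_bound (u - r)) \<partial>lborel)"
  have k2: "k2 < \<top>"
  proof -
    have "integrable lborel (\<lambda>u::'d tfplane. exp (\<bar>a\<bar> * norm r) * exp (- (1/4) * (norm u)\<^sup>2 + \<bar>a\<bar> * norm u))"
      by (intro integrable_mult_right integrable_gauss_exp_norm) simp
    then have int: "integrable lborel (\<lambda>u::'d tfplane. exp (\<bar>a\<bar> * norm r) * exp (- (1/4) * (norm (u + - r))\<^sup>2 + \<bar>a\<bar> * norm (u + - r)))"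
      by (rule integrable_lborel_translate)
    have "(\<integral>\<^sup>+ u. ennreal (exp (a * norm (u :: 'd tfplane))) * ennreal (gauss_bound (u - r)) \<partial>lborel)
      \<le> (\<integral>\<^sup>+ u. ennreal (exp (\<bar>a\<bar> * norm r) * exp (- (1/4) * (norm (u + - r))\<^sup>2 + \<bar>a\<bar> * norm (u + - r))) \<partial>lborel)"
    proof (intro nn_integral_mono)
      fix u :: "'d tfplane"
      have "a * norm u \<le> \<bar>a\<bar> * norm r + \<bar>a\<bar> * norm (u - r)"
      proof -
        have "a * norm u \<le> \<bar>a\<bar> * norm u" by (intro mult_right_mono) auto
        also have "\<dots> \<le> \<bar>a\<bar> * (norm r + norm (u - r))"
          using norm_triangle_sub[of u r] by (intro mult_left_mono) auto
        finally show ?thesis by (simp add: distrib_left)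
      qed
      then have "exp (a * norm u) * gauss_bound (u - r) \<le> exp (\<bar>a\<bar> * norm r) * exp (- (1/4) * (norm (u + - r))\<^sup>2 + \<bar>a\<bar> * norm (u + - r))"
        by (simp flip: exp_add)
      then show "ennreal (exp (a * norm u)) * ennreal (gauss_bound (u - r)) \<le> ennreal (exp (\<bar>a\<bar> * norm r) * exp (- (1/4) * (norm (u + - r))\<^sup>2 + \<bar>a\<bar> * norm (u + - r)))"
        by (simp add: ennreal_leI flip: ennreal_mult)
    qed
    also have "\<dots> < \<infinity>"
      using int by (subst nn_integral_eq_integral) auto
    finally show ?thesis by (simp add: k2_def ennreal_mult_less_top)
  qed
  show thesis
  proof (rule that[OF k1 k2])
    fix f assume f: "f \<in> M1_dual v"
    note [measurable] = measurable_stft[OF v f] measurable_STFT[OF v f wM]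
    show "wnorm \<mu> p q (\<lambda>z. ennreal (cmod (STFT w f z))) \<le> k1 * wnorm \<mu> p q (\<lambda>z. ennreal (cmod (stft f z)))"
      unfolding k1_def
    proof (rule wnorm_convolution[where k = "\<lambda>y. ennreal ?d * ennreal (cmod (gst w (- y)))"])
      have "ennreal (cmod (STFT w f z)) \<le> (\<integral>\<^sup>+ u. ennreal (cmod (stft f u)) * (ennreal ?d * ennreal (cmod (gst w (- (z - u))))) \<partial>lborel)" for z
      proof -
        have "ennreal (cmod (STFT w f z)) \<le> ennreal ?d * (\<integral>\<^sup>+ u. ennreal (cmod (stft f u) * cmod (gst w (u - z))) \<partial>lborel)"
          by (rule STFT_le_convolution[OF v f wM])
        also have "\<dots> = (\<integral>\<^sup>+ u. ennreal ?d * ennreal (cmod (stft f u) * cmod (gst w (u - z))) \<partial>lborel)"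
          by (rule nn_integral_cmult[symmetric]) measurable
        finally show ?thesis by (simp add: ennreal_mult mult_ac)
      qed
      then show "AE z in lborel. ennreal (cmod (STFT w f z)) \<le> (\<integral>\<^sup>+ u. ennreal (cmod (stft f u)) * (ennreal ?d * ennreal (cmod (gst w (- (z - u))))) \<partial>lborel)"
        by simp
      fix z
      show "AE u in lborel. ennreal (\<mu> z) * (ennreal ?d * ennreal (cmod (gst w (- (z - u))))) \<le> ennreal (\<mu> u) * \<kappa> (z - u)"
        using AE_lborel_reflect[OF vb, of z]
      proof eventually_elim
        case (elim u)
        have "\<mu> z \<le> c * v (z - u) * \<mu> u" using mod[of "z - u" u] by simp
        then have "ennreal (\<mu> z) \<le> ennreal c * ennreal (v (z - u)) * ennreal (\<mu> u)"
          using c weight_nonneg[OF v, of "z - u"] regular_weight_pos[OF reg, of u] by (simp flip: ennreal_mult)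
        from mult_right_mono[OF this, of "ennreal ?d * ennreal (cmod (gst w (- (z - u))))"]
        show ?case using c by (simp add: \<kappa>_def elim ennreal_mult mult_ac)
      qed
    qed measurable
    show "wnorm \<mu> p q (\<lambda>z. ennreal (cmod (stft f z))) \<le> k2 * wnorm \<mu> p q (\<lambda>z. ennreal (cmod (STFT w f z)))"
    proof -
      let ?g = "cmod (gst w r)"
      have g: "ennreal (1 / ?g) * ennreal ?g = 1" using r by (simp flip: ennreal_mult)
      have "wnorm \<mu> p q (\<lambda>z. ennreal ?g * ennreal (cmod (stft f z)))
        \<le> (\<integral>\<^sup>+ u. ennreal (exp (a * norm u)) * ennreal (gauss_bound (u - r)) \<partial>lborel) * wnorm \<mu> p q (\<lambda>z. ennreal (cmod (STFT w f z)))"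
        by (rule wnorm_convolution_exp[where k = "\<lambda>y. ennreal (gauss_bound (y - r))"])
          (measurable, use stft_le_convolution[OF v f wM, of r] in \<open>simp add: ennreal_mult\<close>)
      then have "ennreal ?g * wnorm \<mu> p q (\<lambda>z. ennreal (cmod (stft f z)))
        \<le> (\<integral>\<^sup>+ u. ennreal (exp (a * norm u)) * ennreal (gauss_bound (u - r)) \<partial>lborel) * wnorm \<mu> p q (\<lambda>z. ennreal (cmod (STFT w f z)))"
        by (subst (asm) wnorm_cmult) auto
      from mult_left_mono[OF this, of "ennreal (1 / ?g)"]
      show ?thesis by (simp add: k2_def g mult.assoc flip: mult.assoc[of "ennreal (1 / ?g)" "ennreal ?g"])
    qed
  qed
qed

end

subsection \<open>Reconstruction from phase-corrected samples\<close>

definition proj :: "('d::finite tfplane \<Rightarrow> complex) \<Rightarrow> 'd tfplane \<Rightarrow> complex" where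
  "proj G z = of_real (sqrt 2 ^ CARD('d)) * (LINT u|lborel. G u * gker u z)"

definition sample :: "('d::finite tfplane \<Rightarrow> 'd tfplane) \<Rightarrow> ('d tfplane \<Rightarrow> complex) \<Rightarrow> 'd tfplane \<Rightarrow> complex" where
  "sample s F u = cnj (osc_phase u (s u)) * F (s u)"

text \<open>The operator \<open>(1 - S) P\<close>, where \<open>P\<close> is \<open>proj\<close> and
  \<open>S\<close> is \<open>sample s\<close>. On transforms of functionals \<open>P\<close> is the
  identity, so there \<open>1 - resid s\<close> is sampling; composing with \<open>P\<close> makes
  \<open>resid\<close> an integral operator that can be iterated.\<close>

definition resid :: "('d::finite tfplane \<Rightarrow> 'd tfplane) \<Rightarrow> ('d tfplane \<Rightarrow> complex) \<Rightarrow> 'd tfplane \<Rightarrow> complex" where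
  "resid s G u = proj G u - sample s (proj G) u"

text \<open>The inverse of \<open>1 - resid s\<close>, summed point by point and hence not tied to
  any of the norms.\<close>

definition neumann :: "('d::finite tfplane \<Rightarrow> 'd tfplane) \<Rightarrow> ('d tfplane \<Rightarrow> complex) \<Rightarrow> 'd tfplane \<Rightarrow> complex" where
  "neumann s G u = (\<Sum>k. (resid s ^^ k) G u)"

text \<open>The bound is required at every point, so that the Neumann series converges everywhere
  and identities between functions hold exactly.\<close>

definition bounded_by :: "('d::finite tfplane \<Rightarrow> real) \<Rightarrow> real \<Rightarrow> ('d tfplane \<Rightarrow> complex) \<Rightarrow> bool" where
  "bounded_by \<mu> M G \<longleftrightarrow> G \<in> borel_measurable borel \<and> (\<forall>u. \<mu> u * cmod (G u) \<le> M)"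

lemma bounded_by_measurable: "bounded_by \<mu> M G \<Longrightarrow> G \<in> borel_measurable borel"
  and bounded_byD: "bounded_by \<mu> M G \<Longrightarrow> \<mu> u * cmod (G u) \<le> M"
  unfolding bounded_by_def by blast+

lemma bounded_by_nonneg:
  assumes "bounded_by \<mu> M G" "0 < \<mu> u"
  shows "0 \<le> M"
  using order_trans[OF mult_nonneg_nonneg bounded_byD[OF assms(1)], of u] assms(2) by simp

text \<open>The constant in Young's inequality for convolution with \<open>gauss_bound\<close> under
  a regular weight of rate \<open>a\<close>. The type argument carries the dimension.\<close>

definition exp_gauss_mass :: "'a::euclidean_space itself \<Rightarrow> real \<Rightarrow> real" where
  "exp_gauss_mass T a = (LINT u::'a|lborel. exp (a * norm u) * gauss_bound u)"

lemma integrable_exp_gauss: "integrable lborel (\<lambda>u::'a::euclidean_space. exp (a * norm u) * gauss_bound u)"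
  using integrable_gauss_exp_norm[of "1/4" a, where 'a = 'a] by (simp flip: exp_add add: add.commute)

lemma nn_integral_exp_gauss:
  "(\<integral>\<^sup>+ u. ennreal (exp (a * norm u)) * ennreal (gauss_bound u) \<partial>(lborel :: 'a measure))
    = ennreal (exp_gauss_mass TYPE('a::euclidean_space) a)"
proof -
  have "(\<integral>\<^sup>+ u. ennreal (exp (a * norm u) * gauss_bound u) \<partial>(lborel :: 'a measure)) = ennreal (exp_gauss_mass TYPE('a) a)"
    unfolding exp_gauss_mass_def by (intro nn_integral_eq_integral integrable_exp_gauss) simp
  then show ?thesis by (simp add: ennreal_mult)
qed

lemma exp_gauss_mass_nonneg: "0 \<le> exp_gauss_mass TYPE('a::euclidean_space) a"
  unfolding exp_gauss_mass_def by simp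

lemma stft_eq_proj: "is_weight v \<Longrightarrow> f \<in> M1_dual v \<Longrightarrow> stft f = proj (stft f)"
  unfolding proj_def by (rule ext) (rule stft_reproducing)

lemma stft_synth_eq_proj: "is_weight v \<Longrightarrow> stft (synth v G) = proj G"
  unfolding proj_def by (rule ext) (rule stft_synth)

lemma proj_cmult: "proj (\<lambda>u. c * G u) z = c * proj G z"
  unfolding proj_def mult.assoc integral_mult_right_zero by (rule mult.left_commute)

lemma resid_cmult: "resid s (\<lambda>u. c * G u) = (\<lambda>u. c * resid s G u)"
  by (rule ext) (simp add: resid_def sample_def proj_cmult right_diff_distrib)

lemma measurable_proj:
  assumes [measurable]: "G \<in> borel_measurable borel"
  shows "proj G \<in> borel_measurable borel"
  unfolding proj_def[abs_def] by measurable

lemma norm_proj_le: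
  fixes G :: "'d::finite tfplane \<Rightarrow> complex"
  shows "ennreal (cmod (proj G z)) \<le> (\<integral>\<^sup>+ y. ennreal (cmod (G y)) * ennreal (sqrt 2 ^ CARD('d) * gauss_bound (z - y)) \<partial>lborel)"
proof -
  let ?d = "sqrt 2 ^ CARD('d)"
  have "proj G z = (LINT y|lborel. of_real ?d * (G y * gker y z))" by (simp add: proj_def)
  then have "ennreal (cmod (proj G z)) \<le> (\<integral>\<^sup>+ y. ennreal (cmod (of_real ?d * (G y * gker y z))) \<partial>lborel)"
    by (simp only: norm_integral_le_nn_integral)
  also have "\<dots> \<le> (\<integral>\<^sup>+ y. ennreal (cmod (G y)) * ennreal (?d * gauss_bound (z - y)) \<partial>lborel)"
  proof (rule nn_integral_mono)
    fix y
    have "cmod (of_real ?d * (G y * gker y z)) \<le> cmod (G y) * (?d * gauss_bound (z - y))"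
      using mult_left_mono[OF norm_gker_le_gauss_bound[of y z], of "cmod (G y) * ?d"]
      by (simp add: norm_mult norm_power mult_ac)
    then show "ennreal (cmod (of_real ?d * (G y * gker y z))) \<le> ennreal (cmod (G y)) * ennreal (?d * gauss_bound (z - y))"
      by (simp add: ennreal_leI flip: ennreal_mult)
  qed
  finally show ?thesis .
qed

section \<open>Inversion of the sampling operator by a Neumann series\<close>

context
  fixes a \<theta> :: real and s :: "'d::finite tfplane \<Rightarrow> 'd tfplane"
  assumes a: "0 \<le> a" and \<theta>: "0 < \<theta>"
    and contraction: "sqrt 2 ^ CARD('d) * \<theta> * exp_gauss_mass TYPE('d tfplane) a \<le> 1 / 2"
    and s[measurable]: "s \<in> borel_measurable borel"
    and osc: "\<And>u z. cmod (gker u z - osc_phase u (s u) * gker (s u) z) \<le> \<theta> * gauss_bound (z - u)"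
begin

context
  fixes \<mu> :: "'d tfplane \<Rightarrow> real"
  assumes reg: "regular_weight a \<mu>"
begin

lemmas [measurable] = regular_weight_measurable[OF reg]

lemma bounded_by_integrable:
  assumes G: "bounded_by \<mu> M G"
  shows "integrable lborel (\<lambda>u. G u * gker u z)"
proof (rule Bochner_Integration.integrable_bound)
  have [measurable]: "G \<in> borel_measurable borel" using G by (simp add: bounded_by_def)
  show "(\<lambda>u. G u * gker u z) \<in> borel_measurable lborel" by measurable
  show "integrable lborel (\<lambda>u. M / \<mu> z * (exp (a * norm (z - u)) * gauss_bound (z - u)))"
    by (intro integrable_mult_right integrable_lborel_reflect[OF integrable_exp_gauss])
  have M: "0 \<le> M" by (rule bounded_by_nonneg[OF G regular_weight_pos[OF reg]])
  have "cmod (G u * gker u z) \<le> M / \<mu> z * (exp (a * norm (z - u)) * gauss_bound (z - u))" for u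
  proof -
    have "\<mu> z * cmod (G u) \<le> exp (a * norm (z - u)) * \<mu> u * cmod (G u)"
      by (intro mult_right_mono regular_weight_le[OF reg]) simp
    also have "\<dots> \<le> exp (a * norm (z - u)) * M"
      using bounded_byD[OF G, of u] by (simp add: mult.assoc)
    finally have "cmod (G u) \<le> M / \<mu> z * exp (a * norm (z - u))"
      using regular_weight_pos[OF reg, of z] by (simp add: field_simps)
    then have "cmod (G u) * cmod (gker u z) \<le> M / \<mu> z * exp (a * norm (z - u)) * gauss_bound (z - u)"
      using M regular_weight_pos[OF reg, of z] by (intro mult_mono norm_gker_le_gauss_bound) auto
    then show ?thesis by (simp add: norm_mult mult.assoc)
  qed
  then show "AE u in lborel. norm (G u * gker u z) \<le> norm (M / \<mu> z * (exp (a * norm (z - u)) * gauss_bound (z - u)))"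
    using M regular_weight_pos[OF reg, of z] by (intro AE_I2) (auto intro: order_trans)
qed

text \<open>The reproducing integrals at \<open>u\<close> and at \<open>s u\<close> combine into one
  integral against the oscillation of the kernel. Every norm bound for \<open>resid\<close> follows
  from this pointwise domination.\<close>

lemma norm_resid_le:
  assumes G: "bounded_by \<mu> M G"
  shows "ennreal (cmod (resid s G u))
    \<le> (\<integral>\<^sup>+ y. ennreal (cmod (G y)) * ennreal (sqrt 2 ^ CARD('d) * \<theta> * gauss_bound (u - y)) \<partial>lborel)"
proof -
  let ?d = "sqrt 2 ^ CARD('d)"
  have "resid s G u = (LINT y|lborel. of_real ?d * (G y * cnj (gker u y - osc_phase u (s u) * gker (s u) y)))"
  proof -
    have "G y * cnj (gker u y - osc_phase u (s u) * gker (s u) y)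
        = G y * gker y u - cnj (osc_phase u (s u)) * (G y * gker y (s u))" for y
      by (simp add: gker_cnj right_diff_distrib)
    then show ?thesis
      using bounded_by_integrable[OF G, of u] bounded_by_integrable[OF G, of "s u"]
      by (simp add: resid_def sample_def proj_def right_diff_distrib)
  qed
  then have "ennreal (cmod (resid s G u)) \<le> (\<integral>\<^sup>+ y. ennreal (cmod (of_real ?d * (G y * cnj (gker u y - osc_phase u (s u) * gker (s u) y)))) \<partial>lborel)"
    by (simp only: norm_integral_le_nn_integral)
  also have "\<dots> \<le> (\<integral>\<^sup>+ y. ennreal (cmod (G y)) * ennreal (?d * \<theta> * gauss_bound (u - y)) \<partial>lborel)"
  proof (rule nn_integral_mono)
    fix y
    have "cmod (of_real ?d * (G y * cnj (gker u y - osc_phase u (s u) * gker (s u) y)))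
      = cmod (G y) * ?d * cmod (gker u y - osc_phase u (s u) * gker (s u) y)"
      by (simp only: norm_mult complex_mod_cnj norm_of_real) simp
    also have "\<dots> \<le> cmod (G y) * ?d * (\<theta> * gauss_bound (y - u))"
      by (intro mult_left_mono osc) simp
    finally have "cmod (of_real ?d * (G y * cnj (gker u y - osc_phase u (s u) * gker (s u) y)))
      \<le> cmod (G y) * (?d * \<theta> * gauss_bound (u - y))" by (simp add: norm_minus_commute mult_ac)
    then show "ennreal (cmod (of_real ?d * (G y * cnj (gker u y - osc_phase u (s u) * gker (s u) y))))
      \<le> ennreal (cmod (G y)) * ennreal (?d * \<theta> * gauss_bound (u - y))"
      using \<theta> by (simp add: ennreal_leI flip: ennreal_mult)
  qed
  finally show ?thesis .
qed

lemma measurable_resid: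
  assumes [measurable]: "G \<in> borel_measurable borel"
  shows "resid s G \<in> borel_measurable borel"
proof -
  have [measurable]: "proj G \<in> borel_measurable borel" by (rule measurable_proj) simp
  have "(\<lambda>(u, u'). osc_phase u (u' :: 'd tfplane)) \<in> borel_measurable (borel \<Otimes>\<^sub>M borel)"
    unfolding osc_phase_def borel_prod split_beta' by (intro borel_measurable_continuous_onI continuous_intros)
  then have [measurable]: "(\<lambda>u. osc_phase u (s u)) \<in> borel_measurable borel" by measurable
  show ?thesis unfolding resid_def[abs_def] sample_def by measurable
qed

lemma nn_integral_kernel:
  "(\<integral>\<^sup>+ u. ennreal (exp (a * norm u)) * ennreal (sqrt 2 ^ CARD('d) * \<theta> * gauss_bound u) \<partial>(lborel :: 'd tfplane measure)) \<le> ennreal (1 / 2)"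
proof -
  have "(\<integral>\<^sup>+ u. ennreal (exp (a * norm u)) * ennreal (sqrt 2 ^ CARD('d) * \<theta> * gauss_bound u) \<partial>(lborel :: 'd tfplane measure))
    = (\<integral>\<^sup>+ u. ennreal (sqrt 2 ^ CARD('d) * \<theta>) * (ennreal (exp (a * norm u)) * ennreal (gauss_bound u)) \<partial>(lborel :: 'd tfplane measure))"
    using \<theta> by (intro nn_integral_cong) (simp add: ennreal_mult' mult_ac)
  also have "\<dots> = ennreal (sqrt 2 ^ CARD('d) * \<theta>) * ennreal (exp_gauss_mass TYPE('d tfplane) a)"
    unfolding nn_integral_exp_gauss[symmetric] by (rule nn_integral_cmult) measurable
  also have "\<dots> = ennreal (sqrt 2 ^ CARD('d) * \<theta> * exp_gauss_mass TYPE('d tfplane) a)"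
    using \<theta> by (intro ennreal_mult[symmetric] exp_gauss_mass_nonneg) simp
  also have "\<dots> \<le> ennreal (1 / 2)" by (intro ennreal_leI contraction)
  finally show ?thesis .
qed

text \<open>Young's inequality for the weighted supremum, carried out point by point;
  \<open>contraction\<close> makes the mass of the kernel at most one half.\<close>

lemma bounded_by_resid:
  assumes G: "bounded_by \<mu> M G"
  shows "bounded_by \<mu> (M / 2) (resid s G)"
  unfolding bounded_by_def
proof (intro conjI allI)
  have [measurable]: "G \<in> borel_measurable borel" using G by (simp add: bounded_by_def)
  show "resid s G \<in> borel_measurable borel" by (rule measurable_resid) simp
  fix u
  have M: "0 \<le> M" by (rule bounded_by_nonneg[OF G regular_weight_pos[OF reg]])
  let ?k = "\<lambda>y. ennreal (sqrt 2 ^ CARD('d) * \<theta> * gauss_bound (y :: 'd tfplane))"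
  have "ennreal (\<mu> u * cmod (resid s G u)) \<le> ennreal (\<mu> u) * (\<integral>\<^sup>+ y. ennreal (cmod (G y)) * ?k (u - y) \<partial>lborel)"
    using regular_weight_pos[OF reg, of u] mult_left_mono[OF norm_resid_le[OF G, of u], of "ennreal (\<mu> u)"]
    by (simp add: ennreal_mult less_imp_le)
  also have "\<dots> = (\<integral>\<^sup>+ y. ennreal (\<mu> u) * (ennreal (cmod (G y)) * ?k (u - y)) \<partial>lborel)"
    by (rule nn_integral_cmult[symmetric]) measurable
  also have "\<dots> \<le> (\<integral>\<^sup>+ y. ennreal M * (ennreal (exp (a * norm (u - y))) * ?k (u - y)) \<partial>lborel)"
  proof (rule nn_integral_mono)
    fix y
    have "\<mu> u * cmod (G y) \<le> exp (a * norm (u - y)) * (\<mu> y * cmod (G y))"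
      using mult_right_mono[OF regular_weight_le[OF reg, of u y] norm_ge_zero[of "G y"]] by (simp add: mult.assoc)
    also have "\<dots> \<le> exp (a * norm (u - y)) * M" by (intro mult_left_mono bounded_byD[OF G]) simp
    finally have "ennreal (\<mu> u) * ennreal (cmod (G y)) \<le> ennreal M * ennreal (exp (a * norm (u - y)))"
      using M regular_weight_pos[OF reg, of u] by (simp add: mult.commute flip: ennreal_mult)
    from mult_right_mono[OF this, of "?k (u - y)"]
    show "ennreal (\<mu> u) * (ennreal (cmod (G y)) * ?k (u - y)) \<le> ennreal M * (ennreal (exp (a * norm (u - y))) * ?k (u - y))"
      by (simp add: mult.assoc)
  qed
  also have "\<dots> = ennreal M * (\<integral>\<^sup>+ y. ennreal (exp (a * norm (u - y))) * ?k (u - y) \<partial>lborel)"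
    by (rule nn_integral_cmult) measurable
  also have "(\<integral>\<^sup>+ y. ennreal (exp (a * norm (u - y))) * ?k (u - y) \<partial>lborel) = (\<integral>\<^sup>+ y. ennreal (exp (a * norm y)) * ?k y \<partial>lborel)"
    by (rule nn_integral_lborel_reflect) measurable
  also have "ennreal M * \<dots> \<le> ennreal M * ennreal (1 / 2)"
    by (intro mult_left_mono nn_integral_kernel) simp
  also have "\<dots> = ennreal (M / 2)"
    using M by (subst ennreal_mult[symmetric]) simp_all
  finally show "\<mu> u * cmod (resid s G u) \<le> M / 2"
    using M by (simp add: ennreal_le_iff)
qed

lemma bounded_by_funpow:
  assumes "bounded_by \<mu> M G"
  shows "bounded_by \<mu> (M / 2 ^ k) ((resid s ^^ k) G)"
proof (induction k)
  case (Suc k)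
  then show ?case using bounded_by_resid[OF Suc] by (simp add: field_simps)
qed (use assms in simp)

lemma bounded_by_summable:
  assumes G: "bounded_by \<mu> M G"
  shows "summable (\<lambda>k. cmod ((resid s ^^ k) G u))"
    and "(\<Sum>k. cmod ((resid s ^^ k) G u)) \<le> 2 * M / \<mu> u"
proof -
  have \<mu>: "0 < \<mu> u" by (rule regular_weight_pos[OF reg])
  have le: "cmod ((resid s ^^ k) G u) \<le> M / \<mu> u * (1 / 2) ^ k" for k
    using bounded_byD[OF bounded_by_funpow[OF G, of k], of u] \<mu> by (simp add: field_simps)
  have sums: "(\<lambda>k. M / \<mu> u * (1 / 2) ^ k) sums (M / \<mu> u * 2)"
    using sums_mult[OF geometric_sums[of "1 / 2 :: real"], of "M / \<mu> u"] by simp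
  show *: "summable (\<lambda>k. cmod ((resid s ^^ k) G u))"
    by (rule summable_comparison_test'[OF sums_summable[OF sums], of 0]) (use le in simp)
  have "(\<Sum>k. cmod ((resid s ^^ k) G u)) \<le> (\<Sum>k. M / \<mu> u * (1 / 2) ^ k)"
    by (rule suminf_le[OF le * sums_summable[OF sums]])
  then show "(\<Sum>k. cmod ((resid s ^^ k) G u)) \<le> 2 * M / \<mu> u"
    using sums_unique[OF sums] by (simp add: mult.commute)
qed

lemma bounded_by_neumann:
  assumes G: "bounded_by \<mu> M G"
  shows "bounded_by \<mu> (2 * M) (neumann s G)"
  unfolding bounded_by_def
proof (intro conjI allI)
  have [measurable]: "(resid s ^^ k) G \<in> borel_measurable borel" for k
    using bounded_by_funpow[OF G] by (simp add: bounded_by_def)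
  show "neumann s G \<in> borel_measurable borel" unfolding neumann_def[abs_def] by measurable
  fix u
  have "cmod (neumann s G u) \<le> (\<Sum>k. cmod ((resid s ^^ k) G u))"
    unfolding neumann_def by (rule summable_norm[OF bounded_by_summable(1)[OF G]])
  also have "\<dots> \<le> 2 * M / \<mu> u" by (rule bounded_by_summable(2)[OF G])
  finally show "\<mu> u * cmod (neumann s G u) \<le> 2 * M"
    using regular_weight_pos[OF reg, of u] by (simp add: field_simps)
qed

lemma resid_add:
  assumes "bounded_by \<mu> M G" "bounded_by \<mu> N H"
  shows "resid s (\<lambda>u. G u + H u) = (\<lambda>u. resid s G u + resid s H u)"
  using bounded_by_integrable[OF assms(1)] bounded_by_integrable[OF assms(2)]
  by (simp add: fun_eq_iff resid_def sample_def proj_def distrib_left distrib_right)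

lemma funpow_resid_add:
  assumes "bounded_by \<mu> M G" "bounded_by \<mu> N H"
  shows "(resid s ^^ k) (\<lambda>u. G u + H u) = (\<lambda>u. (resid s ^^ k) G u + (resid s ^^ k) H u)"
proof (induction k)
  case (Suc k)
  then show ?case
    using resid_add[OF bounded_by_funpow[OF assms(1), of k] bounded_by_funpow[OF assms(2), of k]] by simp
qed simp

lemma funpow_resid_cmult: "(resid s ^^ k) (\<lambda>u. c * G u) = (\<lambda>u. c * (resid s ^^ k) G u)"
  by (induction k) (simp_all add: resid_cmult)

lemma neumann_add:
  assumes "bounded_by \<mu> M G" "bounded_by \<mu> N H"
  shows "neumann s (\<lambda>u. G u + H u) = (\<lambda>u. neumann s G u + neumann s H u)"
  unfolding neumann_def funpow_resid_add[OF assms]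
  using bounded_by_summable(1)[OF assms(1), THEN summable_norm_cancel] bounded_by_summable(1)[OF assms(2), THEN summable_norm_cancel]
  by (simp add: suminf_add)

lemma neumann_cmult:
  assumes "bounded_by \<mu> M G"
  shows "neumann s (\<lambda>u. c * G u) = (\<lambda>u. c * neumann s G u)"
  unfolding neumann_def funpow_resid_cmult
  using bounded_by_summable(1)[OF assms, THEN summable_norm_cancel] by (simp add: suminf_mult)

text \<open>The series telescopes, and the powers of \<open>resid s\<close> tend to 0 by the
  geometric bound.\<close>

lemma neumann_diff_resid:
  assumes G: "bounded_by \<mu> M G"
  shows "neumann s (\<lambda>u. G u - resid s G u) = G"
proof
  fix u
  have "(resid s ^^ k) (\<lambda>u. G u - resid s G u) u = (resid s ^^ k) G u - (resid s ^^ Suc k) G u" for k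
  proof -
    \<comment> \<open>The difference is written as a sum with a multiple by -1, to which additivity
      and homogeneity of the powers apply.\<close>
    have "bounded_by \<mu> (M / 2) (\<lambda>u. (- 1) * resid s G u)"
      using bounded_by_resid[OF G] unfolding bounded_by_def by simp
    from fun_cong[OF funpow_resid_add[OF G this, of k], of u]
    show ?thesis
      unfolding funpow_resid_cmult by (simp add: funpow_swap1)
  qed
  moreover have "(\<lambda>k. (resid s ^^ k) G u) \<longlonglongrightarrow> 0"
    using summable_LIMSEQ_zero[OF summable_norm_cancel[OF bounded_by_summable(1)[OF G]]] .
  then have "(\<lambda>k. (resid s ^^ k) G u - (resid s ^^ Suc k) G u) sums ((resid s ^^ 0) G u - 0)"
    by (rule telescope_sums')
  ultimately show "neumann s (\<lambda>u. G u - resid s G u) u = G u"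
    unfolding neumann_def by (simp add: sums_unique[symmetric])
qed

text \<open>Each application of \<open>resid s\<close> halves the mixed norm, by Young's inequality
  with the same kernel for all \<open>p\<close> and \<open>q\<close>; the factor 2 is the sum of the
  geometric series. The sup bound on \<open>G\<close> guarantees that the integrals and the series
  converge.\<close>

lemma wnorm_neumann_le:
  assumes p: "1 \<le> p" and q: "1 \<le> q" and G: "bounded_by \<mu> M G"
  shows "wnorm \<mu> p q (\<lambda>z. ennreal (cmod (neumann s G z))) \<le> 2 * wnorm \<mu> p q (\<lambda>z. ennreal (cmod (G z)))"
proof -
  have m[measurable]: "(resid s ^^ k) G \<in> borel_measurable borel" for k
    using bounded_by_funpow[OF G] by (simp add: bounded_by_def)
  have [measurable]: "neumann s G \<in> borel_measurable borel"
    using bounded_by_neumann[OF G] by (simp add: bounded_by_def)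
  let ?W = "wnorm \<mu> p q (\<lambda>z. ennreal (cmod (G z)))"
  have step: "wnorm \<mu> p q (\<lambda>z. ennreal (cmod ((resid s ^^ k) G z))) \<le> ennreal ((1 / 2) ^ k) * ?W" for k
  proof (induction k)
    case (Suc k)
    have "wnorm \<mu> p q (\<lambda>z. ennreal (cmod ((resid s ^^ Suc k) G z)))
      \<le> (\<integral>\<^sup>+ u. ennreal (exp (a * norm u)) * ennreal (sqrt 2 ^ CARD('d) * \<theta> * gauss_bound u) \<partial>(lborel :: 'd tfplane measure))
          * wnorm \<mu> p q (\<lambda>z. ennreal (cmod ((resid s ^^ k) G z)))"
      by (rule wnorm_convolution_exp[OF reg p q, where k = "\<lambda>y. ennreal (sqrt 2 ^ CARD('d) * \<theta> * gauss_bound y)"])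
        (measurable, use norm_resid_le[OF bounded_by_funpow[OF G, of k]] in simp)
    also have "\<dots> \<le> ennreal (1 / 2) * (ennreal ((1 / 2) ^ k) * ?W)"
      by (intro mult_mono nn_integral_kernel Suc) simp_all
    also have "\<dots> = ennreal ((1 / 2) ^ Suc k) * ?W"
      by (subst mult.assoc[symmetric], subst ennreal_mult[symmetric]) simp_all
    finally show ?case .
  qed simp
  have "wnorm \<mu> p q (\<lambda>z. ennreal (cmod (neumann s G z)))
    \<le> wnorm \<mu> p q (\<lambda>z. \<Sum>k. ennreal (cmod ((resid s ^^ k) G z)))"
  proof (rule wnorm_mono_AE[OF reg p q])
    have "ennreal (cmod (neumann s G z)) \<le> (\<Sum>k. ennreal (cmod ((resid s ^^ k) G z)))" for z
      using summable_norm[OF bounded_by_summable(1)[OF G, of z]] bounded_by_summable(1)[OF G, of z]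
      unfolding neumann_def by (subst suminf_ennreal2) (auto intro: ennreal_leI)
    then show "AE z in lborel. ennreal (cmod (neumann s G z)) \<le> (\<Sum>k. ennreal (cmod ((resid s ^^ k) G z)))"
      by simp
  qed measurable
  also have "\<dots> \<le> (\<Sum>k. wnorm \<mu> p q (\<lambda>z. ennreal (cmod ((resid s ^^ k) G z))))"
    by (rule wnorm_suminf_le[OF reg p q]) measurable
  also have "\<dots> \<le> (\<Sum>k. ennreal ((1 / 2) ^ k) * ?W)"
    by (intro suminf_le step) auto
  also have "\<dots> = (\<Sum>k. ennreal ((1 / 2) ^ k)) * ?W"
    by (rule ennreal_suminf_multc)
  also have "(\<Sum>k. ennreal ((1 / 2) ^ k)) = 2"
    using geometric_sums[of "1 / 2 :: real"] by (subst suminf_ennreal_eq[of _ 2]) auto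
  finally show ?thesis .
qed

lemma wnorm_proj_le:
  assumes p: "1 \<le> p" and q: "1 \<le> q" and [measurable]: "G \<in> borel_measurable borel"
  shows "wnorm \<mu> p q (\<lambda>z. ennreal (cmod (proj G z)))
    \<le> ennreal (sqrt 2 ^ CARD('d) * exp_gauss_mass TYPE('d tfplane) a) * wnorm \<mu> p q (\<lambda>z. ennreal (cmod (G z)))"
proof -
  have [measurable]: "proj G \<in> borel_measurable borel" by (rule measurable_proj) simp
  have "wnorm \<mu> p q (\<lambda>z. ennreal (cmod (proj G z)))
    \<le> (\<integral>\<^sup>+ u. ennreal (exp (a * norm u)) * ennreal (sqrt 2 ^ CARD('d) * gauss_bound u) \<partial>(lborel :: 'd tfplane measure))
        * wnorm \<mu> p q (\<lambda>z. ennreal (cmod (G z)))"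
    by (rule wnorm_convolution_exp[OF reg p q, where k = "\<lambda>y. ennreal (sqrt 2 ^ CARD('d) * gauss_bound y)"]) (measurable, use norm_proj_le[of G] in simp)
  also have "(\<integral>\<^sup>+ u. ennreal (exp (a * norm u)) * ennreal (sqrt 2 ^ CARD('d) * gauss_bound u) \<partial>(lborel :: 'd tfplane measure))
    = (\<integral>\<^sup>+ u. ennreal (sqrt 2 ^ CARD('d)) * (ennreal (exp (a * norm u)) * ennreal (gauss_bound u)) \<partial>(lborel :: 'd tfplane measure))"
    by (intro nn_integral_cong) (simp add: ennreal_mult' mult_ac)
  also have "\<dots> = ennreal (sqrt 2 ^ CARD('d)) * ennreal (exp_gauss_mass TYPE('d tfplane) a)"
    unfolding nn_integral_exp_gauss[symmetric] by (rule nn_integral_cmult) measurable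
  finally show ?thesis by (simp add: ennreal_mult exp_gauss_mass_nonneg)
qed

end

end

subsection \<open>Sequences on a lattice\<close>

text \<open>With it the sum of indicators in \<open>seq_norm\<close> collapses to the step function
  with value \<open>a i (lattice_part \<Lambda> Q z)\<close> at \<open>z\<close>.\<close>

definition lattice_part :: "'d::finite tfplane set \<Rightarrow> 'd tfplane set \<Rightarrow> 'd tfplane \<Rightarrow> 'd tfplane" where
  "lattice_part \<Lambda> Q z = (THE l. l \<in> \<Lambda> \<and> z \<in> (+) l ` Q)"

context
  fixes \<Lambda> Q :: "'d::finite tfplane set"
  assumes L: "is_lattice \<Lambda>" and Q: "fundamental_domain \<Lambda> Q"
begin

lemma lattice_part: "lattice_part \<Lambda> Q z \<in> \<Lambda>" "z \<in> (+) (lattice_part \<Lambda> Q z) ` Q"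
proof -
  have "\<exists>!l. l \<in> \<Lambda> \<and> z \<in> (+) l ` Q" using Q unfolding fundamental_domain_def by blast
  from theI'[OF this] show "lattice_part \<Lambda> Q z \<in> \<Lambda>" "z \<in> (+) (lattice_part \<Lambda> Q z) ` Q"
    by (simp_all add: lattice_part_def)
qed

lemma lattice_part_eq: "l \<in> \<Lambda> \<Longrightarrow> z \<in> (+) l ` Q \<Longrightarrow> lattice_part \<Lambda> Q z = l"
  using Q lattice_part[of z] unfolding fundamental_domain_def by blast

lemma lattice_closed: "l \<in> \<Lambda> \<Longrightarrow> k \<in> \<Lambda> \<Longrightarrow> l - k \<in> \<Lambda>"
  using L unfolding is_lattice_def by (metis diff_conv_add_uminus)

lemma lattice_part_diff:
  assumes "k \<in> \<Lambda>"
  shows "lattice_part \<Lambda> Q (z - k) = lattice_part \<Lambda> Q z - k"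
proof (rule lattice_part_eq)
  show "lattice_part \<Lambda> Q z - k \<in> \<Lambda>" using lattice_part(1) assms by (rule lattice_closed)
  obtain x where "x \<in> Q" "z = lattice_part \<Lambda> Q z + x" using lattice_part(2)[of z] by auto
  then show "z - k \<in> (+) (lattice_part \<Lambda> Q z - k) ` Q"
    by (intro image_eqI[of _ _ x]) (auto simp: algebra_simps)
qed

lemma lattice_part_bounded:
  obtains r where "0 \<le> r" "\<And>z. norm (z - lattice_part \<Lambda> Q z) \<le> r" "\<And>x. x \<in> Q \<Longrightarrow> norm x \<le> r"
proof -
  have "bounded Q"
    using Q bounded_subset[OF compact_imp_bounded closure_subset] unfolding fundamental_domain_def by blast
  then obtain r where r: "\<And>x. x \<in> Q \<Longrightarrow> norm x \<le> r" by (auto simp: bounded_iff)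
  show thesis
  proof (rule that[of "max 0 r"])
    fix z
    obtain x where "x \<in> Q" "z = lattice_part \<Lambda> Q z + x" using lattice_part(2)[of z] by auto
    then show "norm (z - lattice_part \<Lambda> Q z) \<le> max 0 r"
      using r[of x] by (metis add_diff_cancel_left' max.coboundedI2)
  qed (use r in \<open>force\<close>)+
qed

lemma measurable_lattice_part:
  fixes h :: "'d tfplane \<Rightarrow> ennreal"
  shows "(\<lambda>z. h (lattice_part \<Lambda> Q z)) \<in> borel_measurable lebesgue"
proof -
  have c: "countable \<Lambda>" by (rule lattice_countable[OF L])
  have "lattice_part \<Lambda> Q \<in> lebesgue \<rightarrow>\<^sub>M count_space \<Lambda>"
    unfolding measurable_count_space_eq_countable[OF c]
  proof (intro conjI ballI)
    show "lattice_part \<Lambda> Q \<in> space lebesgue \<rightarrow> \<Lambda>" using lattice_part(1) by blast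
    fix l assume l: "l \<in> \<Lambda>"
    have "lattice_part \<Lambda> Q -` {l} = (+) l ` Q" using lattice_part_eq[OF l] lattice_part(2) by blast
    then show "lattice_part \<Lambda> Q -` {l} \<inter> space lebesgue \<in> sets lebesgue"
      using lebesgue_sets_translation[of Q l] Q by (simp add: fundamental_domain_def)
  qed
  then show ?thesis by (rule measurable_compose) simp
qed

lemma infsum_lattice_indicator:
  "(\<Sum>\<^sub>\<infinity>l\<in>\<Lambda>. h l * indicator ((+) l ` Q) z) = (h (lattice_part \<Lambda> Q z) :: ennreal)"
proof -
  have "(\<Sum>\<^sub>\<infinity>l\<in>\<Lambda>. h l * indicator ((+) l ` Q) z) = (\<Sum>\<^sub>\<infinity>l\<in>{lattice_part \<Lambda> Q z}. h l * indicator ((+) l ` Q) z)"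
  proof (rule infsum_cong_neutral)
    fix l assume "l \<in> \<Lambda> - {lattice_part \<Lambda> Q z}"
    then have "z \<notin> (+) l ` Q" using lattice_part_eq[of l z] by auto
    then show "h l * indicator ((+) l ` Q) z = 0" by simp
  qed (use lattice_part(1) in auto)
  also have "\<dots> = h (lattice_part \<Lambda> Q z)" using lattice_part(2)[of z] by simp
  finally show ?thesis .
qed

lemma seq_norm_eq:
  "seq_norm p q m \<Lambda> Q n a = (\<Sum>i=1..n. mixed_norm p q m (\<lambda>z. ennreal (cmod (a i (lattice_part \<Lambda> Q z)))))"
  by (simp only: seq_norm_def infsum_lattice_indicator)

text \<open>Countably many translates of \<open>Q\<close> cover the plane, and all of them would be
  null.\<close>

lemma fundamental_domain_not_null: "Q \<notin> null_sets lebesgue"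
proof
  assume null: "Q \<in> null_sets lebesgue"
  have "(+) l ` Q \<in> null_sets lebesgue" for l
    using negligible_translation[of Q l] null by (simp add: negligible_iff_null_sets)
  then have "(\<Union>l\<in>\<Lambda>. (+) l ` Q) \<in> null_sets lebesgue"
    by (intro null_sets_UN' lattice_countable[OF L])
  moreover have "(\<Union>l\<in>\<Lambda>. (+) l ` Q) = UNIV" using lattice_part by blast
  ultimately show False by (simp add: null_sets_def emeasure_lborel_UNIV)
qed

end

subsection \<open>The frame property\<close>

context
  fixes \<Lambda> Q :: "'d::finite tfplane set" and v :: "'d tfplane \<Rightarrow> real" and a \<theta> \<epsilon> :: real
    and n :: nat and x :: "nat \<Rightarrow> 'd tfplane"
    and p q :: ennreal and m \<mu> :: "'d tfplane \<Rightarrow> real" and c :: real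
  assumes L: "is_lattice \<Lambda>" and Q: "fundamental_domain \<Lambda> Q" and v: "is_weight v"
    and a: "0 \<le> a" and \<theta>: "0 < \<theta>" and \<epsilon>: "0 < \<epsilon>"
    and contraction: "sqrt 2 ^ CARD('d) * \<theta> * exp_gauss_mass TYPE('d tfplane) a \<le> 1 / 2"
    and osc: "\<And>u u' z :: 'd tfplane. norm (u' - u) \<le> \<epsilon> \<Longrightarrow>
      cmod (gker u z - osc_phase u u' * gker u' z) \<le> \<theta> * gauss_bound (z - u)"
    and cover: "\<And>u. \<exists>i\<in>{1..n}. \<exists>l\<in>\<Lambda>. norm (l + x i - u) \<le> \<epsilon>"
    and p: "1 \<le> p" and q: "1 \<le> q" and m: "moderate_weight v m"
    and reg: "regular_weight a \<mu>" and c: "0 < c" "\<And>z. m z \<le> c * \<mu> z" "\<And>z. \<mu> z \<le> c * m z"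
    and mod: "\<And>z u. \<mu> (z + u) \<le> c * v z * \<mu> u"
begin

abbreviation "lp \<equiv> lattice_part \<Lambda> Q"

abbreviation "wn A \<equiv> wnorm \<mu> p q A"

definition cell_enum :: "nat \<Rightarrow> nat \<times> 'd tfplane" where
  "cell_enum = from_nat_into ({1..n} \<times> \<Lambda>)"

text \<open>The sample point for \<open>u\<close> is the first one, in a fixed enumeration of
  windows and lattice points, within distance \<open>\<epsilon>\<close>; taking the first makes the
  choice Borel measurable.\<close>

definition cell_index :: "'d tfplane \<Rightarrow> nat" where
  "cell_index u = (LEAST k. norm (snd (cell_enum k) + x (fst (cell_enum k)) - u) \<le> \<epsilon>)"

definition cell :: "'d tfplane \<Rightarrow> nat \<times> 'd tfplane" where
  "cell u = cell_enum (cell_index u)"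

definition cell_point :: "'d tfplane \<Rightarrow> 'd tfplane" where
  "cell_point u = snd (cell u) + x (fst (cell u))"

text \<open>The inner phase comes from \<open>\<pi>(l) \<pi>(x) = phase (- (snd x \<bullet> fst l)) \<pi>(l + x)\<close>.\<close>

definition step_fun :: "(nat \<Rightarrow> 'd tfplane \<Rightarrow> complex) \<Rightarrow> 'd tfplane \<Rightarrow> complex" where
  "step_fun b u = cnj (osc_phase u (cell_point u)) *
     (phase (- (snd (x (fst (cell u))) \<bullet> fst (snd (cell u)))) * b (fst (cell u)) (snd (cell u)))"

lemma range_cell_enum: "range cell_enum = {1..n} \<times> \<Lambda>"
proof -
  obtain i l where "i \<in> {1..n}" "l \<in> \<Lambda>" using cover by blast
  then have "{1..n} \<times> \<Lambda> \<noteq> {}" by blast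
  then show ?thesis
    unfolding cell_enum_def by (rule range_from_nat_into) (simp add: lattice_countable[OF L])
qed

lemma cell: "fst (cell u) \<in> {1..n}" "snd (cell u) \<in> \<Lambda>" "norm (cell_point u - u) \<le> \<epsilon>"
proof -
  have "cell u \<in> {1..n} \<times> \<Lambda>" unfolding cell_def range_cell_enum[symmetric] by blast
  then show "fst (cell u) \<in> {1..n}" "snd (cell u) \<in> \<Lambda>" by auto
  obtain i l where il: "i \<in> {1..n}" "l \<in> \<Lambda>" "norm (l + x i - u) \<le> \<epsilon>" using cover by blast
  then obtain k where "cell_enum k = (i, l)" using range_cell_enum by (metis SigmaI imageE)
  with il(3) have "norm (snd (cell_enum k) + x (fst (cell_enum k)) - u) \<le> \<epsilon>" by simp
  from LeastI[of "\<lambda>k. norm (snd (cell_enum k) + x (fst (cell_enum k)) - u) \<le> \<epsilon>", OF this]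
  show "norm (cell_point u - u) \<le> \<epsilon>" by (simp add: cell_point_def cell_def cell_index_def)
qed

lemma measurable_cell_index [measurable]: "cell_index \<in> borel \<rightarrow>\<^sub>M count_space UNIV"
  unfolding cell_index_def[abs_def] by measurable

lemma measurable_cell:
  fixes h :: "nat \<times> 'd tfplane \<Rightarrow> 'b::topological_space"
  shows "(\<lambda>u. h (cell u)) \<in> borel_measurable borel"
  unfolding cell_def by (rule measurable_compose[OF measurable_cell_index]) simp

lemma measurable_cell_point [measurable]: "cell_point \<in> borel_measurable borel"
  using measurable_cell[of "\<lambda>c. snd c + x (fst c)"] by (simp add: cell_point_def[abs_def])

lemma measurable_step_fun [measurable]: "step_fun b \<in> borel_measurable borel"
proof -
  have "(\<lambda>(u, u'). osc_phase u (u' :: 'd tfplane)) \<in> borel_measurable (borel \<Otimes>\<^sub>M borel)"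
    unfolding osc_phase_def borel_prod split_beta' by (intro borel_measurable_continuous_onI continuous_intros)
  then have [measurable]: "(\<lambda>u. osc_phase u (cell_point u)) \<in> borel_measurable borel" by measurable
  have [measurable]: "(\<lambda>u. phase (- (snd (x (fst (cell u))) \<bullet> fst (snd (cell u)))) * b (fst (cell u)) (snd (cell u)))
      \<in> borel_measurable borel"
    using measurable_cell[of "\<lambda>c. phase (- (snd (x (fst c)) \<bullet> fst (snd c))) * b (fst c) (snd c)"] .
  show ?thesis unfolding step_fun_def[abs_def] by measurable
qed

lemma norm_step_fun: "cmod (step_fun b u) = cmod (b (fst (cell u)) (snd (cell u)))"
  by (simp add: step_fun_def norm_mult)

lemma cell_osc: "cmod (gker u z - osc_phase u (cell_point u) * gker (cell_point u) z) \<le> \<theta> * gauss_bound (z - u)"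
  by (rule osc[OF cell(3)])

text \<open>The phase from composing the shifts by \<open>l\<close> and \<open>x i\<close> cancels
  against the inner phase of \<open>step_fun\<close>, leaving the value of \<open>stft f\<close> at
  the point \<open>l + x i\<close>.\<close>

lemma step_fun_gabor_coeffs:
  assumes f: "f \<in> M1_dual v"
  shows "step_fun (gabor_coeffs \<Lambda> n (\<lambda>i. tf_shift (x i) gaussian) f) = sample cell_point (stft f)"
proof
  fix u
  obtain i l where il: "cell u = (i, l)" by (cases "cell u")
  have "i \<in> {1..n}" "l \<in> \<Lambda>" using cell[of u] il by auto
  moreover have "tf_shift l (tf_shift (x i) gaussian) = (\<lambda>t. phase (- (snd (x i) \<bullet> fst l)) * tf_shift (l + x i) gaussian t)"
    by (rule ext) (rule tf_shift_tf_shift)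
  ultimately have "gabor_coeffs \<Lambda> n (\<lambda>i. tf_shift (x i) gaussian) f i l = cnj (phase (- (snd (x i) \<bullet> fst l))) * stft f (l + x i)"
    by (simp add: gabor_coeffs_def M1_dual_cmult[OF v f M1_space_gaussian[OF v]])
  then show "step_fun (gabor_coeffs \<Lambda> n (\<lambda>i. tf_shift (x i) gaussian) f) u = sample cell_point (stft f) u"
    by (simp add: step_fun_def sample_def cell_point_def il phase_cnj mult.assoc[symmetric, of "phase _" "phase _"])
qed

text \<open>Since \<open>Q\<close> is only Lebesgue measurable, so is the step function of a
  sequence. A Borel representative gives access to the norms with weight
  \<open>\<mu>\<close>.\<close>

lemma sequence_borel:
  obtains A where "A \<in> borel_measurable borel" "AE z in lborel. ennreal (cmod (b (i::nat) (lp z))) = A z"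
    "mixed_norm p q m (\<lambda>z. ennreal (cmod (b i (lp z)))) \<le> ennreal c * wn A"
    "wn A \<le> ennreal c * mixed_norm p q m (\<lambda>z. ennreal (cmod (b i (lp z))))"
proof -
  obtain A where A: "A \<in> borel_measurable lborel" "AE z in lborel. ennreal (cmod (b i (lp z))) = A z"
    using completion_ex_borel_measurable[OF measurable_lattice_part[OF L Q, of "\<lambda>l. ennreal (cmod (b i l))"]] by auto
  have m': "m \<in> borel_measurable lebesgue" "\<And>z. 0 < m z" using m unfolding moderate_weight_def by blast+
  have A': "A \<in> borel_measurable borel" using A(1) by simp
  show thesis
    using that[OF A' A(2)] mixed_norm_equiv[OF reg p q m' c A' A(2)] by blast
qed

lemma window_shift_bound: obtains Z where "0 \<le> Z" "\<And>i. i \<in> {1..n} \<Longrightarrow> norm (x i) \<le> Z"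
proof
  show "0 \<le> (\<Sum>i=1..n. norm (x i))" by (simp add: sum_nonneg)
  show "norm (x i) \<le> (\<Sum>i=1..n. norm (x i))" if "i \<in> {1..n}" for i
    using that by (intro member_le_sum) auto
qed

lemma norm_cell_le:
  assumes "\<And>i. i \<in> {1..n} \<Longrightarrow> norm (x i) \<le> Z"
  shows "norm (u - snd (cell u)) \<le> \<epsilon> + Z"
proof -
  have "norm (u - snd (cell u)) = norm (x (fst (cell u)) - (cell_point u - u))"
    by (simp add: cell_point_def algebra_simps)
  also have "\<dots> \<le> norm (x (fst (cell u))) + norm (cell_point u - u)" by (rule norm_triangle_ineq4)
  also have "\<dots> \<le> Z + \<epsilon>" by (intro add_mono assms cell)
  finally show ?thesis by simp
qed

text \<open>The lattice point chosen for the cell of \<open>u\<close> and the one whose tile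
  contains \<open>u\<close> both have bounded distance to \<open>u\<close>, so they differ by one of
  finitely many \<open>t\<close>. Hence the step function is dominated by a finite sum of translates
  of the functions in \<open>seq_norm\<close>.\<close>

lemma wnorm_step_fun_le:
  obtains k where "k < \<top>" "\<And>b. wn (\<lambda>u. ennreal (cmod (step_fun b u))) \<le> k * seq_norm p q m \<Lambda> Q n b"
proof -
  obtain r where r: "0 \<le> r" "\<And>z. norm (z - lp z) \<le> r" using lattice_part_bounded[OF L Q] by metis
  obtain Z where Z: "0 \<le> Z" "\<And>i. i \<in> {1..n} \<Longrightarrow> norm (x i) \<le> Z" using window_shift_bound by metis
  define T where "T = \<Lambda> \<inter> cball 0 (r + (\<epsilon> + Z))"
  have T: "finite T" unfolding T_def by (rule lattice_finite_bounded[OF L bounded_cball])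
  define k where "k = (\<Sum>t\<in>T. ennreal (exp (a * norm t))) * ennreal c"
  show thesis
  proof (rule that[of k])
    show "k < \<top>" using T by (simp add: k_def ennreal_mult_less_top)
    fix b :: "nat \<Rightarrow> 'd tfplane \<Rightarrow> complex"
    have "\<exists>A. \<forall>i. A i \<in> borel_measurable borel \<and> (AE z in lborel. ennreal (cmod (b i (lp z))) = A i z) \<and>
      wn (A i) \<le> ennreal c * mixed_norm p q m (\<lambda>z. ennreal (cmod (b i (lp z))))"
    proof (intro choice allI)
      fix i
      show "\<exists>A. A \<in> borel_measurable borel \<and> (AE z in lborel. ennreal (cmod (b i (lp z))) = A z) \<and>
        wn A \<le> ennreal c * mixed_norm p q m (\<lambda>z. ennreal (cmod (b i (lp z))))"
        by (rule sequence_borel[of b i]) blast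
    qed
    then obtain A where A[measurable]: "\<And>i. A i \<in> borel_measurable borel"
      and ae: "\<And>i. AE z in lborel. ennreal (cmod (b i (lp z))) = A i z"
      and le: "\<And>i. wn (A i) \<le> ennreal c * mixed_norm p q m (\<lambda>z. ennreal (cmod (b i (lp z))))" by blast
    have pt: "ennreal (cmod (step_fun b u)) \<le> (\<Sum>i\<in>{1..n}. \<Sum>t\<in>T. ennreal (cmod (b i (lp (u + - t)))))" for u
    proof -
      define t where "t = lp u - snd (cell u)"
      have tL: "t \<in> \<Lambda>" unfolding t_def by (intro lattice_closed[OF L Q] lattice_part(1)[OF L Q] cell)
      have "norm t \<le> norm (u - snd (cell u)) + norm (u - lp u)"
        using norm_triangle_ineq4[of "u - snd (cell u)" "u - lp u"] by (simp add: t_def)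
      also have "\<dots> \<le> (\<epsilon> + Z) + r" by (intro add_mono norm_cell_le Z r)
      finally have tT: "t \<in> T" using tL by (simp add: T_def)
      have "lp (u + - t) = lp u - t"
        using lattice_part_diff[OF L Q tL, of u] by simp
      also have "\<dots> = snd (cell u)" by (simp add: t_def)
      finally have "lp (u + - t) = snd (cell u)" .
      then have "ennreal (cmod (step_fun b u)) = ennreal (cmod (b (fst (cell u)) (lp (u + - t))))"
        by (simp add: norm_step_fun)
      also have "\<dots> \<le> (\<Sum>t\<in>T. ennreal (cmod (b (fst (cell u)) (lp (u + - t)))))"
        using tT T by (intro member_le_sum) auto
      also have "\<dots> \<le> (\<Sum>i\<in>{1..n}. \<Sum>t\<in>T. ennreal (cmod (b i (lp (u + - t)))))"
        using cell(1)[of u] by (intro member_le_sum[of _ _ "\<lambda>i. \<Sum>t\<in>T. ennreal (cmod (b i (lp (u + - t))))"]) auto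
      finally show ?thesis .
    qed
    have "wn (\<lambda>u. ennreal (cmod (step_fun b u))) \<le> wn (\<lambda>u. \<Sum>i\<in>{1..n}. \<Sum>t\<in>T. A i (u + - t))"
    proof (rule wnorm_mono_AE[OF reg p q])
      have "AE u in lborel. \<forall>i\<in>{1..n}. \<forall>t\<in>T. ennreal (cmod (b i (lp (u + - t)))) = A i (u + - t)"
        by (rule AE_finite_allI[OF finite_atLeastAtMost], rule AE_finite_allI[OF T], rule AE_lborel_translate, rule ae)
      then show "AE u in lborel. ennreal (cmod (step_fun b u)) \<le> (\<Sum>i\<in>{1..n}. \<Sum>t\<in>T. A i (u + - t))"
      proof eventually_elim
        case (elim u)
        then have "(\<Sum>i\<in>{1..n}. \<Sum>t\<in>T. ennreal (cmod (b i (lp (u + - t))))) = (\<Sum>i\<in>{1..n}. \<Sum>t\<in>T. A i (u + - t))"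
          by (intro sum.cong refl) blast
        then show ?case using pt[of u] by simp
      qed
    qed measurable
    also have "\<dots> \<le> (\<Sum>i\<in>{1..n}. wn (\<lambda>u. \<Sum>t\<in>T. A i (u + - t)))"
      by (rule wnorm_sum_le[OF reg p q]) (simp, measurable)
    also have "\<dots> \<le> (\<Sum>i\<in>{1..n}. \<Sum>t\<in>T. wn (\<lambda>u. A i (u + - t)))"
      by (intro sum_mono wnorm_sum_le[OF reg p q] T) measurable
    also have "\<dots> \<le> (\<Sum>i\<in>{1..n}. \<Sum>t\<in>T. ennreal (exp (a * norm (- t))) * (ennreal c * mixed_norm p q m (\<lambda>z. ennreal (cmod (b i (lp z))))))"
      by (intro sum_mono order_trans[OF wnorm_translate_le[OF reg p q A]] mult_left_mono le) simp
    also have "\<dots> = (\<Sum>i\<in>{1..n}. k * mixed_norm p q m (\<lambda>z. ennreal (cmod (b i (lp z)))))"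
      by (intro sum.cong refl) (simp only: k_def norm_minus_cancel sum_distrib_right mult.assoc)
    also have "\<dots> = k * seq_norm p q m \<Lambda> Q n b"
      by (simp only: seq_norm_eq[OF L Q] sum_distrib_left)
    finally show "wn (\<lambda>u. ennreal (cmod (step_fun b u))) \<le> k * seq_norm p q m \<Lambda> Q n b" .
  qed
qed

text \<open>A Gabor coefficient is, up to a phase, a value of \<open>stft f\<close> at distance at
  most \<open>\<rho>\<close> from each point of its tile. The reproducing formula bounds it by a
  convolution, and halving the exponent of the Gaussian makes room for the displacement, at the cost
  of \<open>exp (\<rho>\<^sup>2 / 4)\<close>.\<close>

lemma seq_norm_coeffs_le:
  obtains k where "k < \<top>"
    "\<And>f. f \<in> M1_dual v \<Longrightarrow> seq_norm p q m \<Lambda> Q n (gabor_coeffs \<Lambda> n (\<lambda>i. tf_shift (x i) gaussian) f)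
      \<le> k * wn (\<lambda>z. ennreal (cmod (stft f z)))"
proof -
  obtain r where r: "0 \<le> r" "\<And>z. norm (z - lp z) \<le> r" using lattice_part_bounded[OF L Q] by metis
  obtain Z where Z: "0 \<le> Z" "\<And>i. i \<in> {1..n} \<Longrightarrow> norm (x i) \<le> Z" using window_shift_bound by metis
  define \<rho> where "\<rho> = r + Z"
  let ?k = "\<lambda>y :: 'd tfplane. ennreal (sqrt 2 ^ CARD('d) * exp (\<rho>\<^sup>2 / 4) * exp (- (norm y)\<^sup>2 / 8))"
  define I where "I = (\<integral>\<^sup>+ y. ennreal (exp (a * norm y)) * ?k y \<partial>lborel)"
  have I: "I < \<top>"
  proof -
    have "integrable lborel (\<lambda>y::'d tfplane. sqrt 2 ^ CARD('d) * exp (\<rho>\<^sup>2 / 4) * exp (- (1/8) * (norm y)\<^sup>2 + a * norm y))"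
      by (intro integrable_mult_right integrable_gauss_exp_norm) simp
    then have "(\<integral>\<^sup>+ y. ennreal (sqrt 2 ^ CARD('d) * exp (\<rho>\<^sup>2 / 4) * exp (- (1/8) * (norm (y :: 'd tfplane))\<^sup>2 + a * norm y)) \<partial>lborel) < \<top>"
      by (subst nn_integral_eq_integral) auto
    moreover have "ennreal (exp (a * norm y)) * ?k y = ennreal (sqrt 2 ^ CARD('d) * exp (\<rho>\<^sup>2 / 4) * exp (- (1/8) * (norm y)\<^sup>2 + a * norm y))" for y
      by (simp add: exp_add[symmetric] mult_ac flip: ennreal_mult)
    ultimately show ?thesis by (simp only: I_def)
  qed
  show thesis
  proof (rule that[of "of_nat n * (ennreal c * I)"])
    show "of_nat n * (ennreal c * I) < \<top>" using I by (simp add: ennreal_mult_less_top of_nat_less_top)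
    fix f assume f: "f \<in> M1_dual v"
    note [measurable] = measurable_stft[OF v f]
    let ?b = "gabor_coeffs \<Lambda> n (\<lambda>i. tf_shift (x i) gaussian) f"
    have "mixed_norm p q m (\<lambda>z. ennreal (cmod (?b i (lp z)))) \<le> ennreal c * I * wn (\<lambda>z. ennreal (cmod (stft f z)))"
      if i: "i \<in> {1..n}" for i
    proof -
      obtain A where [measurable]: "A \<in> borel_measurable borel" and ae: "AE z in lborel. ennreal (cmod (?b i (lp z))) = A z"
        and le: "mixed_norm p q m (\<lambda>z. ennreal (cmod (?b i (lp z)))) \<le> ennreal c * wn A"
        by (rule sequence_borel[of ?b i]) blast
      have pt: "ennreal (cmod (?b i (lp z))) \<le> (\<integral>\<^sup>+ y. ennreal (cmod (stft f y)) * ?k (z - y) \<partial>lborel)" for z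
      proof -
        have "tf_shift (lp z) (tf_shift (x i) gaussian) = (\<lambda>t. phase (- (snd (x i) \<bullet> fst (lp z))) * tf_shift (lp z + x i) gaussian t)"
          by (rule ext) (rule tf_shift_tf_shift)
        then have "cmod (?b i (lp z)) = cmod (stft f (lp z + x i))"
          using i lattice_part(1)[OF L Q, of z]
          by (simp add: gabor_coeffs_def M1_dual_cmult[OF v f M1_space_gaussian[OF v]] norm_mult)
        also have "ennreal \<dots> \<le> (\<integral>\<^sup>+ y. ennreal (cmod (stft f y)) * ennreal (sqrt 2 ^ CARD('d) * gauss_bound ((lp z + x i) - y)) \<partial>lborel)"
          using norm_proj_le[of "stft f" "lp z + x i"] by (simp only: fun_cong[OF stft_eq_proj[OF v f], symmetric])
        also have "\<dots> \<le> (\<integral>\<^sup>+ y. ennreal (cmod (stft f y)) * ?k (z - y) \<partial>lborel)"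
        proof (intro nn_integral_mono mult_left_mono ennreal_leI)
          fix y
          have n1: "norm (z - lp z - x i) \<le> \<rho>"
            using norm_triangle_ineq4[of "z - lp z" "x i"] r(2)[of z] Z(2)[OF i] by (simp add: \<rho>_def)
          have "(norm (z - y))\<^sup>2 \<le> (norm (lp z + x i - y) + norm (z - lp z - x i))\<^sup>2"
            using norm_triangle_ineq[of "lp z + x i - y" "z - lp z - x i"] by (intro power_mono) (auto simp: algebra_simps)
          also have "\<dots> \<le> 2 * (norm (lp z + x i - y))\<^sup>2 + 2 * (norm (z - lp z - x i))\<^sup>2"
            using sum_squares_bound[of "norm (lp z + x i - y)" "norm (z - lp z - x i)"] by (simp add: power2_sum)
          also have "\<dots> \<le> 2 * (norm (lp z + x i - y))\<^sup>2 + 2 * \<rho>\<^sup>2"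
            using n1 by (intro add_left_mono mult_left_mono power_mono) auto
          finally have "gauss_bound (lp z + x i - y) \<le> exp (\<rho>\<^sup>2 / 4) * exp (- (norm (z - y))\<^sup>2 / 8)"
            by (simp flip: exp_add)
          from mult_left_mono[OF this, of "sqrt 2 ^ CARD('d)"]
          show "sqrt 2 ^ CARD('d) * gauss_bound (lp z + x i - y) \<le> sqrt 2 ^ CARD('d) * exp (\<rho>\<^sup>2 / 4) * exp (- (norm (z - y))\<^sup>2 / 8)"
            by (simp add: mult.assoc)
        qed simp
        finally show ?thesis .
      qed
      have "wn A \<le> I * wn (\<lambda>z. ennreal (cmod (stft f z)))"
        unfolding I_def
      proof (rule wnorm_convolution_exp[OF reg p q, where k = ?k])
        show "AE z in lborel. A z \<le> (\<integral>\<^sup>+ y. ennreal (cmod (stft f y)) * ?k (z - y) \<partial>lborel)"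
          using ae
        proof eventually_elim
          case (elim z)
          show ?case unfolding elim[symmetric] by (rule pt)
        qed
      qed measurable
      from order_trans[OF le mult_left_mono[OF this]] show ?thesis by (simp add: mult.assoc)
    qed
    then have "seq_norm p q m \<Lambda> Q n ?b \<le> (\<Sum>i=1..n. ennreal c * I * wn (\<lambda>z. ennreal (cmod (stft f z))))"
      unfolding seq_norm_eq[OF L Q] by (intro sum_mono)
    then show "seq_norm p q m \<Lambda> Q n ?b \<le> of_nat n * (ennreal c * I) * wn (\<lambda>z. ennreal (cmod (stft f z)))"
      by (simp add: mult.assoc)
  qed
qed

text \<open>The whole norm controls each coefficient: on the tile of \<open>l\<close> the weight is
  comparable to \<open>\<mu> l\<close>, and the indicator of that tile has the same unweighted norm
  \<open>\<eta>\<close> for every \<open>l\<close>, positive because \<open>Q\<close> is not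
  null.\<close>

lemma step_fun_bounded:
  assumes b: "b \<in> seq_space p q m \<Lambda> Q n"
  obtains M where "bounded_by \<mu> M (step_fun b)"
proof -
  obtain r where r: "0 \<le> r" "\<And>z. norm (z - lp z) \<le> r" "\<And>y. y \<in> Q \<Longrightarrow> norm y \<le> r"
    using lattice_part_bounded[OF L Q] by metis
  obtain Z where Z: "0 \<le> Z" "\<And>i. i \<in> {1..n} \<Longrightarrow> norm (x i) \<le> Z" using window_shift_bound by metis
  have "(\<lambda>z. indicator Q z :: ennreal) \<in> borel_measurable lebesgue"
    using Q by (intro borel_measurable_indicator) (simp add: fundamental_domain_def)
  then obtain j where "j \<in> borel_measurable lborel" and j_ae: "AE z in lborel. indicator Q z = (j z :: ennreal)"
    using completion_ex_borel_measurable by blast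
  then have j[measurable]: "j \<in> borel_measurable borel" by simp
  define \<eta> where "\<eta> = mnorm p q j"
  have "\<eta> \<noteq> 0"
  proof
    assume "\<eta> = 0"
    then have "AE z in lborel. j z = 0" unfolding \<eta>_def by (rule mnorm_eq_0[OF p q j])
    with j_ae have "AE z in lborel. z \<notin> Q"
      by eventually_elim (auto simp: indicator_def split: if_splits)
    then have "AE z in lebesgue. z \<notin> Q" by (simp add: AE_completion_iff)
    then have "Q \<in> null_sets lebesgue"
      using Q by (subst (asm) AE_iff_null_sets[symmetric]) (auto simp: fundamental_domain_def)
    with fundamental_domain_not_null[OF L Q] show False by simp
  qed
  \<comment> \<open>Truncation at 1 gives a lower bound for \<open>\<eta>\<close> that is a positive
    real number.\<close>
  then have "0 < min 1 \<eta>" "min 1 \<eta> < \<top>" by (auto simp: min_less_iff_disj zero_less_iff_neq_zero)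
  then obtain e where me: "min 1 \<eta> = ennreal e" "0 \<le> e" by (cases "min 1 \<eta>") auto
  have e: "0 < e" "ennreal e \<le> \<eta>"
    using \<open>0 < min 1 \<eta>\<close> unfolding me(1) by (simp, simp flip: me(1))
  have fin: "mixed_norm p q m (\<lambda>z. ennreal (cmod (b i (lp z)))) < \<top>" if "i \<in> {1..n}" for i
  proof -
    have "mixed_norm p q m (\<lambda>z. ennreal (cmod (b i (lp z)))) \<le> seq_norm p q m \<Lambda> Q n b"
      unfolding seq_norm_eq[OF L Q]
      using that by (intro member_le_sum[of _ _ "\<lambda>i. mixed_norm p q m (\<lambda>z. ennreal (cmod (b i (lp z))))"]) auto
    also have "\<dots> < \<top>" using b by (simp add: seq_space_def)
    finally show ?thesis .
  qed
  have "\<exists>M. \<forall>l\<in>\<Lambda>. cmod (b i l) * \<mu> l \<le> M" if i: "i \<in> {1..n}" for i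
  proof -
    obtain A where A[measurable]: "A \<in> borel_measurable borel" and ae: "AE z in lborel. ennreal (cmod (b i (lp z))) = A z"
      and le: "wn A \<le> ennreal c * mixed_norm p q m (\<lambda>z. ennreal (cmod (b i (lp z))))"
      by (rule sequence_borel[of b i]) blast
    have "wn A < \<top>"
      using le_less_trans[OF le] fin[OF i] by (simp add: ennreal_mult_less_top)
    then obtain W where W: "wn A = ennreal W" "0 \<le> W" by (cases "wn A") auto
    have "cmod (b i l) * \<mu> l \<le> W / e * exp (a * r)" if l: "l \<in> \<Lambda>" for l
    proof -
      let ?y = "cmod (b i l) * \<mu> l * exp (- (a * r))"
      note [measurable] = regular_weight_measurable[OF reg]
      have "mnorm p q (\<lambda>z. ennreal ?y * j (z + - l)) \<le> wn A"
        unfolding wnorm_def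
      proof (rule mnorm_mono_AE[OF p q])
        show "AE z in lborel. ennreal ?y * j (z + - l) \<le> A z * ennreal (\<mu> z)"
          using ae AE_lborel_translate[OF j_ae, of "- l"]
        proof eventually_elim
          case (elim z)
          show ?case
          proof (cases "z + - l \<in> Q")
            case True
            then have "z \<in> (+) l ` Q" by (intro image_eqI[of _ _ "z + - l"]) auto
            then have "lp z = l" by (rule lattice_part_eq[OF L Q l])
            have "\<mu> l \<le> exp (a * norm (l - z)) * \<mu> z" by (rule regular_weight_le[OF reg])
            also have "\<dots> \<le> exp (a * r) * \<mu> z"
              using r(3)[OF True] a regular_weight_pos[OF reg, of z]
              by (intro mult_right_mono) (auto simp: norm_minus_commute intro!: mult_left_mono)
            finally have "\<mu> l * exp (- (a * r)) \<le> \<mu> z"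
              by (simp add: exp_minus field_simps)
            then have "?y \<le> cmod (b i l) * \<mu> z" by (simp add: mult.assoc mult_left_mono)
            then have "ennreal ?y \<le> ennreal (cmod (b i l)) * ennreal (\<mu> z)"
              using regular_weight_pos[OF reg, of z] by (simp add: ennreal_leI flip: ennreal_mult)
            then show ?thesis using elim True by (simp add: \<open>lp z = l\<close>)
          next
            case False
            then show ?thesis using elim by simp
          qed
        qed
      qed measurable
      also have "mnorm p q (\<lambda>z. ennreal ?y * j (z + - l)) = ennreal ?y * \<eta>"
      proof -
        have "(\<lambda>z. z + - l) \<in> borel_measurable borel"
          by (intro borel_measurable_continuous_onI continuous_intros)
        then have "(\<lambda>z. j (z + - l)) \<in> borel_measurable borel" using j by (rule measurable_compose)
        from mnorm_cmult[OF p q this, of "ennreal ?y"] show ?thesis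
          unfolding \<eta>_def mnorm_translate[OF p q j, of "- l"] by simp
      qed
      finally have "ennreal ?y * \<eta> \<le> ennreal W" unfolding W .
      then have "ennreal ?y * ennreal e \<le> ennreal W"
        using mult_left_mono[OF e(2), of "ennreal ?y"] by (auto intro: order_trans)
      then have "?y * e \<le> W"
        using e(1) W(2) regular_weight_pos[OF reg, of l] by (simp add: ennreal_le_iff flip: ennreal_mult)
      then show ?thesis using e(1) by (simp add: exp_minus field_simps)
    qed
    then show ?thesis by blast
  qed
  then obtain M where M: "\<And>i l. i \<in> {1..n} \<Longrightarrow> l \<in> \<Lambda> \<Longrightarrow> cmod (b i l) * \<mu> l \<le> M i" by metis
  define N where "N = (\<Sum>i=1..n. \<bar>M i\<bar>)"
  have N: "cmod (b i l) * \<mu> l \<le> N" if "i \<in> {1..n}" "l \<in> \<Lambda>" for i l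
  proof -
    have "\<bar>M i\<bar> \<le> N" unfolding N_def using that by (intro member_le_sum[of _ _ "\<lambda>i. \<bar>M i\<bar>"]) auto
    then show ?thesis using M[OF that] by linarith
  qed
  have "bounded_by \<mu> (exp (a * (\<epsilon> + Z)) * N) (step_fun b)"
    unfolding bounded_by_def
  proof (intro conjI allI measurable_step_fun)
    fix u
    let ?i = "fst (cell u)" and ?l = "snd (cell u)"
    have "\<mu> u \<le> exp (a * norm (u - ?l)) * \<mu> ?l" by (rule regular_weight_le[OF reg])
    also have "\<dots> \<le> exp (a * (\<epsilon> + Z)) * \<mu> ?l"
      using a regular_weight_pos[OF reg, of ?l] norm_cell_le[OF Z(2), of u]
      by (intro mult_right_mono) (auto intro!: mult_left_mono)
    finally have "\<mu> u * cmod (b ?i ?l) \<le> exp (a * (\<epsilon> + Z)) * \<mu> ?l * cmod (b ?i ?l)"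
      by (rule mult_right_mono) simp
    also have "\<dots> = exp (a * (\<epsilon> + Z)) * (cmod (b ?i ?l) * \<mu> ?l)" by (simp add: mult_ac)
    also have "\<dots> \<le> exp (a * (\<epsilon> + Z)) * N" by (intro mult_left_mono N cell) simp
    finally show "\<mu> u * cmod (step_fun b u) \<le> exp (a * (\<epsilon> + Z)) * N" by (simp add: norm_step_fun)
  qed
  then show thesis by (rule that)
qed

section \<open>The reconstruction operator and the frame inequalities\<close>

abbreviation "recon b \<equiv> synth v (neumann cell_point (step_fun b))"

lemmas neumann_rules = a \<theta> contraction measurable_cell_point cell_osc

text \<open>A bound by a multiple of \<open>1 / \<mu>\<close> is also one by a multiple of
  \<open>v\<close>, because \<open>\<mu> 0 \<le> c * v u * \<mu> u\<close>. In this form it lets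
  \<open>synth\<close> produce an element of \<open>M1_dual v\<close>.\<close>

lemma neumann_step_fun_bound:
  assumes "b \<in> seq_space p q m \<Lambda> Q n"
  obtains C where "neumann cell_point (step_fun b) \<in> borel_measurable borel"
    "\<And>u. cmod (neumann cell_point (step_fun b) u) \<le> C * v u"
proof -
  obtain M where "bounded_by \<mu> M (step_fun b)" using step_fun_bounded[OF assms] .
  then have G: "bounded_by \<mu> (2 * M) (neumann cell_point (step_fun b))"
    by (rule bounded_by_neumann[OF neumann_rules reg])
  show ?thesis
  proof (rule that[OF bounded_by_measurable[OF G]])
    fix u
    have "\<mu> 0 \<le> c * v u * \<mu> u" using mod[of "- u" u] by (simp add: weight_minus[OF v])
    then have "\<mu> 0 * cmod (neumann cell_point (step_fun b) u) \<le> c * v u * (\<mu> u * cmod (neumann cell_point (step_fun b) u))"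
      using mult_right_mono[of "\<mu> 0" "c * v u * \<mu> u" "cmod (neumann cell_point (step_fun b) u)"] by (simp add: mult.assoc)
    also have "\<dots> \<le> c * v u * (2 * M)"
      using c(1) weight_nonneg[OF v, of u] by (intro mult_left_mono bounded_byD[OF G]) simp
    finally show "cmod (neumann cell_point (step_fun b) u) \<le> c * (2 * M) / \<mu> 0 * v u"
      using regular_weight_pos[OF reg, of 0] by (simp add: field_simps)
  qed
qed

lemma recon_M1_dual:
  assumes "b \<in> seq_space p q m \<Lambda> Q n"
  shows "recon b \<in> M1_dual v"
  using neumann_step_fun_bound[OF assms] synth_M1_dual[OF v] by metis

lemma recon_add:
  assumes b: "b \<in> seq_space p q m \<Lambda> Q n" and d: "d \<in> seq_space p q m \<Lambda> Q n"
  shows "recon (\<lambda>i l. b i l + d i l) = (\<lambda>h. recon b h + recon d h)"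
proof -
  obtain M where M: "bounded_by \<mu> M (step_fun b)" using step_fun_bounded[OF b] .
  obtain N where N: "bounded_by \<mu> N (step_fun d)" using step_fun_bounded[OF d] .
  have "step_fun (\<lambda>i l. b i l + d i l) = (\<lambda>u. step_fun b u + step_fun d u)"
    by (rule ext) (simp add: step_fun_def distrib_left)
  then have eq: "neumann cell_point (step_fun (\<lambda>i l. b i l + d i l))
      = (\<lambda>u. neumann cell_point (step_fun b) u + neumann cell_point (step_fun d) u)"
    by (simp only: neumann_add[OF neumann_rules reg M N])
  have int: "integrable lborel (\<lambda>u. neumann cell_point (step_fun b') u * cnj (gst h u))"
    if "b' \<in> seq_space p q m \<Lambda> Q n" "h \<in> M1_space v" for b' h
    by (rule neumann_step_fun_bound[OF that(1)]) (rule pairing(1)[OF v _ _ that(2)])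
  show ?thesis
    unfolding eq using int[OF b] int[OF d] by (auto simp: synth_def distrib_left distrib_right)
qed

lemma recon_cmult:
  assumes b: "b \<in> seq_space p q m \<Lambda> Q n"
  shows "recon (\<lambda>i l. k * b i l) = (\<lambda>h. k * recon b h)"
proof -
  obtain M where M: "bounded_by \<mu> M (step_fun b)" using step_fun_bounded[OF b] .
  have "step_fun (\<lambda>i l. k * b i l) = (\<lambda>u. k * step_fun b u)"
    by (rule ext) (simp add: step_fun_def)
  then have eq: "neumann cell_point (step_fun (\<lambda>i l. k * b i l)) = (\<lambda>u. k * neumann cell_point (step_fun b) u)"
    by (simp only: neumann_cmult[OF neumann_rules reg M])
  show ?thesis
    unfolding eq by (rule ext) (simp add: synth_def mult.assoc)
qed

text \<open>On coefficients of \<open>f\<close>, \<open>step_fun\<close> equals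
  \<open>stft f\<close> minus its \<open>resid\<close>, and the Neumann series undoes this. As
  \<open>f\<close> is any functional of the dual, convergence is based on the weight
  \<open>exp (- (a * norm u))\<close> instead of \<open>\<mu>\<close>.\<close>

lemma recon_gabor_coeffs:
  assumes f: "f \<in> M1_dual v" and bound: "\<And>u. v u \<le> K * exp (a * norm u)"
  shows "recon (gabor_coeffs \<Lambda> n (\<lambda>i. tf_shift (x i) gaussian) f) = f"
proof -
  obtain C where C: "0 \<le> C" "\<And>u. cmod (stft f u) \<le> C * v u" using stft_bound[OF v f] by metis
  have "bounded_by (\<lambda>u. exp (- (a * norm u))) (C * K) (stft f)"
    unfolding bounded_by_def
  proof (intro conjI allI measurable_stft[OF v f])
    fix u
    have "cmod (stft f u) \<le> C * (K * exp (a * norm u))"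
      using C(2)[of u] mult_left_mono[OF bound[of u] C(1)] by linarith
    then have "exp (- (a * norm u)) * cmod (stft f u) \<le> exp (- (a * norm u)) * (C * (K * exp (a * norm u)))"
      by (rule mult_left_mono) simp
    also have "\<dots> = C * K" by (simp add: exp_minus)
    finally show "exp (- (a * norm u)) * cmod (stft f u) \<le> C * K" .
  qed
  then have "neumann cell_point (\<lambda>u. stft f u - resid cell_point (stft f) u) = stft f"
    by (rule neumann_diff_resid[OF neumann_rules regular_weight_exp[OF a]])
  moreover have "step_fun (gabor_coeffs \<Lambda> n (\<lambda>i. tf_shift (x i) gaussian) f) u = stft f u - resid cell_point (stft f) u" for u
    unfolding step_fun_gabor_coeffs[OF f] resid_def stft_eq_proj[OF v f, symmetric] by simp
  ultimately have "neumann cell_point (step_fun (gabor_coeffs \<Lambda> n (\<lambda>i. tf_shift (x i) gaussian) f)) = stft f"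
    by presburger
  then show ?thesis by (simp only: M1_dual_representation[OF v f])
qed

lemma wnorm_stft_recon_le:
  obtains k where "k < \<top>" "\<And>b. b \<in> seq_space p q m \<Lambda> Q n \<Longrightarrow>
    wn (\<lambda>z. ennreal (cmod (stft (recon b) z))) \<le> k * seq_norm p q m \<Lambda> Q n b"
proof -
  obtain k where k: "k < \<top>" "\<And>b. wn (\<lambda>u. ennreal (cmod (step_fun b u))) \<le> k * seq_norm p q m \<Lambda> Q n b"
    using wnorm_step_fun_le by blast
  let ?P = "ennreal (sqrt 2 ^ CARD('d) * exp_gauss_mass TYPE('d tfplane) a)"
  show thesis
  proof (rule that[of "?P * (2 * k)"])
    show "?P * (2 * k) < \<top>" using k(1) by (simp add: ennreal_mult_less_top)
    fix b assume b: "b \<in> seq_space p q m \<Lambda> Q n"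
    obtain M where M: "bounded_by \<mu> M (step_fun b)" using step_fun_bounded[OF b] .
    have "wn (\<lambda>z. ennreal (cmod (stft (recon b) z)))
        = wn (\<lambda>z. ennreal (cmod (proj (neumann cell_point (step_fun b)) z)))"
      by (simp only: fun_cong[OF stft_synth_eq_proj[OF v]])
    also have "\<dots> \<le> ?P * wn (\<lambda>z. ennreal (cmod (neumann cell_point (step_fun b) z)))"
      by (rule wnorm_proj_le[OF neumann_rules reg p q
            bounded_by_measurable[OF bounded_by_neumann[OF neumann_rules reg M]]])
    also have "\<dots> \<le> ?P * (2 * wn (\<lambda>z. ennreal (cmod (step_fun b z))))"
      by (intro mult_left_mono wnorm_neumann_le[OF neumann_rules reg p q M]) simp
    also have "\<dots> \<le> ?P * (2 * (k * seq_norm p q m \<Lambda> Q n b))"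
      by (intro mult_left_mono k) simp_all
    finally show "wn (\<lambda>z. ennreal (cmod (stft (recon b) z))) \<le> ?P * (2 * k) * seq_norm p q m \<Lambda> Q n b"
      by (simp add: mult.assoc)
  qed
qed

text \<open>All norms are compared with \<open>wn\<close> of the Gaussian transform. The lower frame
  bound comes from the boundedness of \<open>recon\<close> together with its being a left inverse of
  the coefficient map.\<close>

theorem gabor_frame_of_cover:
  assumes w: "is_window v w" and bound: "\<And>u. v u \<le> K * exp (a * norm u)"
  shows "multi_window_gabor_frame v w Q p q m \<Lambda> n (\<lambda>i. tf_shift (x i) gaussian)"
proof -
  let ?C = "gabor_coeffs \<Lambda> n (\<lambda>i. tf_shift (x i) gaussian)"
  let ?S = "seq_space p q m \<Lambda> Q n" and ?s = "seq_norm p q m \<Lambda> Q n"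
  let ?X = "modulation_space v w p q m" and ?N = "modulation_norm w p q m"
  have wM: "w \<in> M1_space v" using w by (simp add: is_window_def)
  have m': "m \<in> borel_measurable lebesgue" "\<And>z. 0 < m z" using m unfolding moderate_weight_def by blast+
  have X: "f \<in> M1_dual v" "?N f < \<top>" if "f \<in> ?X" for f
    using that by (simp_all add: modulation_space_def)
  obtain k1 k2 where k: "k1 < \<top>" "k2 < \<top>"
    "\<And>f. f \<in> M1_dual v \<Longrightarrow> wn (\<lambda>z. ennreal (cmod (STFT w f z))) \<le> k1 * wn (\<lambda>z. ennreal (cmod (stft f z)))"
    "\<And>f. f \<in> M1_dual v \<Longrightarrow> wn (\<lambda>z. ennreal (cmod (stft f z))) \<le> k2 * wn (\<lambda>z. ennreal (cmod (STFT w f z)))"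
    using wnorm_window_equiv[OF reg p q v mod c(1) w] by blast
  obtain kC where kC: "kC < \<top>" "\<And>f. f \<in> M1_dual v \<Longrightarrow> ?s (?C f) \<le> kC * wn (\<lambda>z. ennreal (cmod (stft f z)))"
    using seq_norm_coeffs_le by blast
  obtain kR where kR: "kR < \<top>" "\<And>b. b \<in> ?S \<Longrightarrow> wn (\<lambda>z. ennreal (cmod (stft (recon b) z))) \<le> kR * ?s b"
    using wnorm_stft_recon_le by blast
  have N: "?N f \<le> ennreal c * wn (\<lambda>z. ennreal (cmod (STFT w f z)))"
    "wn (\<lambda>z. ennreal (cmod (STFT w f z))) \<le> ennreal c * ?N f" if f: "f \<in> M1_dual v" for f
  proof -
    have [measurable]: "STFT w f \<in> borel_measurable borel" by (rule measurable_STFT[OF v f wM])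
    have A: "(\<lambda>z. ennreal (cmod (STFT w f z))) \<in> borel_measurable borel" by measurable
    show "?N f \<le> ennreal c * wn (\<lambda>z. ennreal (cmod (STFT w f z)))"
      "wn (\<lambda>z. ennreal (cmod (STFT w f z))) \<le> ennreal c * ?N f"
      unfolding modulation_norm_def by (rule mixed_norm_equiv[OF reg p q m' c A], simp)+
  qed
  \<comment> \<open>The factors are finite, so their product is a real number; the added 1 makes the
    constant positive.\<close>
  define B where "B = enn2real (kC * (k2 * ennreal c)) + 1"
  have upper: "?s (?C f) \<le> ennreal B * ?N f" if f: "f \<in> M1_dual v" for f
  proof -
    have "?s (?C f) \<le> kC * (k2 * (ennreal c * ?N f))"
      by (intro order_trans[OF kC(2)[OF f]] mult_left_mono order_trans[OF k(4)[OF f]] N(2)[OF f]) simp_all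
    also have "\<dots> = (kC * (k2 * ennreal c)) * ?N f" by (simp add: mult.assoc)
    also have "\<dots> \<le> ennreal B * ?N f"
    proof (rule mult_right_mono)
      have "kC * (k2 * ennreal c) = ennreal (enn2real (kC * (k2 * ennreal c)))"
        using kC(1) k(2) by (simp add: ennreal_mult_less_top)
      also have "\<dots> \<le> ennreal B" unfolding B_def by (intro ennreal_leI) simp
      finally show "kC * (k2 * ennreal c) \<le> ennreal B" .
    qed simp
    finally show ?thesis .
  qed
  define K' where "K' = enn2real (ennreal c * (k1 * kR)) + 1"
  have K': "0 < K'" by (simp add: K'_def add_nonneg_pos)
  have recon_le: "?N (recon b) \<le> ennreal K' * ?s b" if b: "b \<in> ?S" for b
  proof -
    note f = recon_M1_dual[OF b]
    have "?N (recon b) \<le> ennreal c * (k1 * (kR * ?s b))"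
      by (intro order_trans[OF N(1)[OF f]] mult_left_mono order_trans[OF k(3)[OF f]] kR(2) b) simp_all
    also have "\<dots> = (ennreal c * (k1 * kR)) * ?s b" by (simp add: mult.assoc)
    also have "\<dots> \<le> ennreal K' * ?s b"
    proof (rule mult_right_mono)
      have "ennreal c * (k1 * kR) = ennreal (enn2real (ennreal c * (k1 * kR)))"
        using kR(1) k(1) by (simp add: ennreal_mult_less_top)
      also have "\<dots> \<le> ennreal K'" unfolding K'_def by (intro ennreal_leI) simp
      finally show "ennreal c * (k1 * kR) \<le> ennreal K'" .
    qed simp
    finally show ?thesis .
  qed
  have coeffs: "?C f \<in> ?S" if "f \<in> ?X" for f
    using le_less_trans[OF upper[OF X(1)[OF that]]] X(2)[OF that]
    by (simp add: seq_space_def gabor_coeffs_def ennreal_mult_less_top)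
  have inverse: "recon (?C f) = f" if "f \<in> ?X" for f
    by (rule recon_gabor_coeffs[OF X(1)[OF that] bound])
  have recon_X: "recon b \<in> ?X" if "b \<in> ?S" for b
    using recon_M1_dual[OF that] le_less_trans[OF recon_le[OF that]] that
    by (simp add: modulation_space_def seq_space_def ennreal_mult_less_top)
  have lower: "ennreal (1 / K') * ?N f \<le> ?s (?C f)" if f: "f \<in> ?X" for f
  proof -
    have "ennreal (1 / K') * ?N f \<le> ennreal (1 / K') * (ennreal K' * ?s (?C f))"
      using recon_le[OF coeffs[OF f]] unfolding inverse[OF f] by (rule mult_left_mono) simp
    also have "\<dots> = ?s (?C f)"
      using K' by (subst mult.assoc[symmetric], subst ennreal_mult[symmetric]) auto
    finally show ?thesis .
  qed
  show ?thesis
    unfolding multi_window_gabor_frame_def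
  proof (intro conjI)
    have "0 < B" by (simp add: B_def add_nonneg_pos)
    then show "\<exists>A>0. \<exists>B>0. \<forall>f\<in>?X. ennreal A * ?N f \<le> ?s (?C f) \<and> ?s (?C f) \<le> ennreal B * ?N f"
      using K' lower upper X(1) by (intro exI[of _ "1 / K'"] exI[of _ B] conjI ballI) auto
    show "\<exists>R. (\<forall>b\<in>?S. R b \<in> ?X) \<and>
        (\<forall>b\<in>?S. \<forall>d\<in>?S. R (\<lambda>i l. b i l + d i l) = (\<lambda>h. R b h + R d h)) \<and>
        (\<forall>k. \<forall>b\<in>?S. R (\<lambda>i l. k * b i l) = (\<lambda>h. k * R b h)) \<and>
        (\<exists>K. \<forall>b\<in>?S. ?N (R b) \<le> ennreal K * ?s b) \<and> (\<forall>f\<in>?X. R (?C f) = f)"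
      by (intro exI[of _ "\<lambda>b. recon b"] conjI ballI allI exI[of _ K'] recon_X recon_add recon_cmult recon_le inverse)
  qed
qed

end

section \<open>Admissibility of the windows and choice of the sampling density\<close>

lemma is_weight_powr:
  assumes v: "is_weight v" and s: "0 \<le> s"
  shows "is_weight (\<lambda>z. v z powr s)"
proof -
  note [measurable] = weight_measurable[OF v]
  have "(\<lambda>z. v z powr s) \<in> borel_measurable lebesgue" by measurable
  moreover have "v (z + w) powr s \<le> v z powr s * v w powr s" for z w
    using powr_mono2[OF s weight_nonneg[OF v] weight_add[OF v], of z w] weight_nonneg[OF v]
    by (simp add: powr_mult)
  moreover have "1 \<le> v z powr s" for z by (rule ge_one_powr_ge_zero[OF weight_ge_1[OF v] s])
  ultimately show ?thesis unfolding is_weight_def by (simp add: weight_minus[OF v])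
qed

text \<open>Each power of \<open>v\<close> is again a weight, and weights grow at most
  exponentially, so the Gaussian belongs to every space of the intersection.\<close>

lemma S_space_gaussian: "is_weight v \<Longrightarrow> tf_shift u gaussian \<in> S_space v"
  unfolding S_space_def by (intro INT_I M1_space_gaussian is_weight_powr) auto

theorem theorem4p6:
  fixes \<Lambda> :: "((real^'d::finite) \<times> (real^'d)) set"
    and v :: "(real^'d) \<times> (real^'d) \<Rightarrow> real"
  assumes "is_lattice \<Lambda>"
    and "GRS_weight \<Lambda> v"
    and "\<not> (\<lambda>x. v (x, 0)) constant_on UNIV"
    and "\<not> (\<lambda>\<omega>. v (0, \<omega>)) constant_on UNIV"
  shows "\<exists>n::nat. \<exists>g :: nat \<Rightarrow> real^'d \<Rightarrow> complex.
           1 \<le> n \<and> (\<forall>i\<in>{1..n}. g i \<in> S_space v) \<and>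
           (\<forall>(p::ennreal) (q::ennreal) m w Q.
              1 \<le> p \<longrightarrow> 1 \<le> q \<longrightarrow> moderate_weight v m \<longrightarrow>
              is_window v w \<longrightarrow> fundamental_domain \<Lambda> Q \<longrightarrow>
              multi_window_gabor_frame v w Q p q m \<Lambda> n g)"
proof -
  have v: "is_weight v" using assms(2) by (simp add: GRS_weight_def)
  obtain a K where a: "0 \<le> a" and K: "\<And>z. v z \<le> K * exp (a * norm z)"
    using weight_exp_bound[OF v] by metis
  let ?d = "sqrt 2 ^ CARD('d) :: real" and ?\<Gamma> = "exp_gauss_mass TYPE('d tfplane) a"
  have \<Gamma>: "0 \<le> ?\<Gamma>" by (rule exp_gauss_mass_nonneg)
  \<comment> \<open>Makes the product in the contraction condition equal to
    \<open>?\<Gamma> / (2 * (?\<Gamma> + 1))\<close>, which is at most one half; given the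
    dimension, \<open>\<theta>\<close> depends only on the growth rate \<open>a\<close>.\<close>
  define \<theta> where "\<theta> = 1 / (2 * ?d * (?\<Gamma> + 1))"
  have \<theta>: "0 < \<theta>" using \<Gamma> by (simp add: \<theta>_def add_nonneg_pos)
  have "?d * \<theta> * ?\<Gamma> = ?\<Gamma> / (2 * (?\<Gamma> + 1))" by (simp add: \<theta>_def)
  also have "\<dots> \<le> 1 / 2" using \<Gamma> by (simp add: divide_le_eq)
  finally have contraction: "?d * \<theta> * ?\<Gamma> \<le> 1 / 2" .
  obtain \<epsilon> where \<epsilon>: "0 < \<epsilon>" and osc: "\<And>u u' z :: 'd tfplane. norm (u' - u) \<le> \<epsilon> \<Longrightarrow>
      cmod (gker u z - osc_phase u u' * gker u' z) \<le> \<theta> * gauss_bound (z - u)"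
    using gker_osc[OF \<theta>] by metis
  obtain F where F: "finite F" "\<And>u. \<exists>l\<in>\<Lambda>. \<exists>z\<in>F. dist u (l + z) < \<epsilon>"
    using lattice_finite_cover[OF assms(1) \<epsilon>] by metis
  have "F \<noteq> {}" using F(2) by blast
  obtain x where x: "bij_betw x {1..card F} F" using ex_bij_betw_nat_finite_1[OF F(1)] by blast
  have cover: "\<exists>i\<in>{1..card F}. \<exists>l\<in>\<Lambda>. norm (l + x i - u) \<le> \<epsilon>" for u
  proof -
    obtain l z where lz: "l \<in> \<Lambda>" "z \<in> F" "dist u (l + z) < \<epsilon>" using F(2) by blast
    then obtain i where "i \<in> {1..card F}" "x i = z" using x by (metis bij_betw_imp_surj_on imageE)
    with lz show ?thesis by (metis dist_commute dist_norm less_imp_le)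
  qed
  show ?thesis
  \<comment> \<open>The windows are fixed before \<open>p\<close>, \<open>q\<close>,
    \<open>m\<close>, \<open>w\<close> and \<open>Q\<close> are introduced; of the data used below,
    only \<open>\<mu>\<close> and \<open>c\<close> depend on \<open>m\<close>.\<close>
  proof (intro exI[of _ "card F"] exI[of _ "\<lambda>i. tf_shift (x i) gaussian"] conjI ballI allI impI)
    show "1 \<le> card F" using F(1) \<open>F \<noteq> {}\<close> by (simp add: Suc_le_eq card_gt_0_iff)
    show "tf_shift (x i) gaussian \<in> S_space v" for i by (rule S_space_gaussian[OF v])
    fix p q :: ennreal and m w Q
    assume p: "1 \<le> p" and q: "1 \<le> q" and m: "moderate_weight v m" and w: "is_window v w"
      and Q: "fundamental_domain \<Lambda> Q"
    obtain \<mu> c where \<mu>: "continuous_on UNIV \<mu>" "\<And>z. 0 < \<mu> z" and c: "0 < c"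
      "\<And>z. m z \<le> c * \<mu> z" "\<And>z. \<mu> z \<le> c * m z"
      and \<mu>': "\<And>z u. \<mu> (z + u) \<le> exp (a * norm u) * \<mu> z"
      and mod: "\<And>z u. \<mu> (z + u) \<le> c * v z * \<mu> u"
      using moderate_weight_regularise[OF v m a K] by blast
    have reg: "regular_weight a \<mu>" unfolding regular_weight_def using \<mu> \<mu>' by blast
    show "multi_window_gabor_frame v w Q p q m \<Lambda> (card F) (\<lambda>i. tf_shift (x i) gaussian)"
      by (rule gabor_frame_of_cover[OF assms(1) Q v a \<theta> \<epsilon> contraction osc cover p q m reg c mod w K])
  qed
qed

end
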